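(* Let $\lambda:[0,t_f]\to T^*M$ be a Pontryagin extremal that does not meet the singular locus $\Lambda_{sing}$. Then $\lambda$ has a bang-bang control with finitely many switches.
   Context: State equations. Let $J=\begin{pmatrix}0&-1\\1&0\end{pmatrix}$, $R=\exp(J\pi/3)$. $SL_2(\mathbb{R})$ acts on the upper half-plane $\mathfrak h=\{x+iy: y>0\}$ by linear fractional transformations $\rho.z$. For $z=x+iy\in\mathfrak h$ put $X=X(z)=\begin{pmatrix}x/y&-x^2/y-y\\1/y&-x/y\end{pmatrix}\in\mathfrak{sl}_2(\mathbb{R})$. The control set is $U=\{(u_0,u_1,u_2)\in\mathbb{R}^3:\sum u_i=1,\ u_i\ge0\}$ with vertices $e_1=(1,0,0)$, $e_2=(0,1,0)$, $e_3=(0,0,1)$. For $u\in U$ let $a=(u_1-u_2)/\sqrt3$, $b=u_0/3-2u_1/3-2u_2/3$, $c=u_0$, and $$f_1(x,y;u)=\frac{y(b+2ax-cx^2+cy^2)}{b+2ax-cx^2-cy^2},\qquad f_2(x,y;u)=\frac{2(a-cx)y^2}{b+2ax-cx^2-cy^2}.$$ Let $\mathfrak h^\star=\{x+iy\in\mathfrak h: |x|<1/\sqrt3,\ x^2+y^2>1/3\}$ and $M=SL_2(\mathbb{R})\times\mathfrak h$. A trajectory with measurable control $u:[0,t_f]\to U$ is an absolutely continuous $(g,z):[0,t_f]\to M$, $z=x+iy$, with $x'=f_1(x,y;u)$, $y'=f_2(x,y;u)$, $g'=gX(z)$ a.e. It is admissible if: $z$ has image in $\mathfrak h^\star$; $g(0)=I$,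 $g(t_f)=R$, $z(t_f)=R^{-1}.z(0)$; and $g$ is homotopic in $SL_2(\mathbb{R})$ (with fixed endpoints) to $t\mapsto\exp(J\pi t/(3t_f))$. Pontryagin extremals. Using left-invariant vector fields and the form $\langle A,B\rangle=\mathrm{trace}(AB)$, a point of $T^*M$ is written $\lambda=((g,\Lambda),(z,\nu))$ with $\Lambda\in\mathfrak{sl}_2(\mathbb{R})$, $\nu=(\nu_1,\nu_2)\in\mathbb{R}^2$. With $\lambda_{cost}\in\mathbb{R}$, the Hamiltonian is $H(\lambda;u)=\langle\Lambda,X\rangle-\tfrac32\lambda_{cost}\langle J,X\rangle+\nu_1f_1(x,y;u)+\nu_2f_2(x,y;u)$, and $H^+(\lambda)=\max_{u\in U}H(\lambda;u)$. A lifted trajectory of an admissible trajectory $(g,z)$ with control $u$ is a Lipschitz $\lambda:[0,t_f]\to T^*M$ over $(g,z)$ with, a.e., $\Lambda'=[\Lambda,X]$, $\nu_1'=-\partial H/\partial x$, $\nu_2'=-\partial H/\partial y$ (derivatives at fixed $\Lambda,\nu$ and at $u=u(t)$). It is a Pontryagin extremal if: (i) $H(\lambda(t);u(t))=H^+(\lambda(t))=0$ for a.e. $t$; (ii) $(\lambda_{cost},\Lambda(t),\nu(t))\ne0$ for every $t$; (iii) $\lambda_{cost}\le0$ is constant, normalized so that $\lambda_{cost}\in\{0,-1\}$; (iv) transversality: $\Lambda(t_f)=R^{-1}\Lambda(0)R$ and $F^t\nu(t_f)=\nu(0)$, where $F:T_{z(0)}\mathfrak h\to T_{z(t_f)}\mathfrak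 h$ is the differential of $z\mapsto R^{-1}.z$ at $z(0)$ and $F^t$ its transpose. Singular locus. $\Lambda_{sing}$ is the set of $(\lambda_{cost},\lambda)$ with $\lambda_{cost}=-1$ and $\lambda=((g,\Lambda),(z,\nu))$ with $g\in SL_2(\mathbb{R})$ arbitrary, $\Lambda=\tfrac32J\lambda_{cost}=-\tfrac32J$, $z=i$, $\nu=0$. The extremal $\lambda$ does not meet $\Lambda_{sing}$ if $(\lambda_{cost},\lambda(t))\notin\Lambda_{sing}$ for all $t\in[0,t_f]$. A bang-bang control is a measurable control taking values in $\{e_1,e_2,e_3\}$; controls are considered up to sets of measure zero, and "finitely many switches" means that the control is piecewise constant with finitely many pieces. *)

theory Defs
  imports "HOL-Analysis.Analysis"
begin

section \<open>Matrices\<close>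

type_synonym mat2 = "real^2^2"

definition SL2 :: "mat2 set" where
  "SL2 = {A. det A = 1}"

definition sl2 :: "mat2 set" where
  "sl2 = {A. trace A = 0}"

definition bracket :: "mat2 \<Rightarrow> mat2 \<Rightarrow> mat2" where
  "bracket A B = A ** B - B ** A"

definition trace_form :: "mat2 \<Rightarrow> mat2 \<Rightarrow> real" where
  "trace_form A B = trace (A ** B)"

text \<open>The type \<^typ>\<open>real^2^2\<close> is not a normed algebra in the library (its \<open>*\<close> is
  componentwise), so \<^const>\<open>exp\<close> is not available for it; this is the exponential series with
  respect to the matrix product.\<close>
definition mat_exp :: "mat2 \<Rightarrow> mat2" where
  "mat_exp A = (\<Sum>n. (1 / fact n) *\<^sub>R (((**) A) ^^ n) (mat 1))"

definition J :: mat2 where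
  "J = vector [vector [0, -1], vector [1, 0]]"

definition R :: mat2 where
  "R = mat_exp ((pi / 3) *\<^sub>R J)"


section \<open>The upper half-plane\<close>

definition mat_act :: "mat2 \<Rightarrow> complex \<Rightarrow> complex" where
  "mat_act A = moebius (of_real (A$1$1)) (of_real (A$1$2)) (of_real (A$2$1)) (of_real (A$2$2))"

definition X :: "complex \<Rightarrow> mat2" where
  "X z = (let x = Re z; y = Im z in
     vector [vector [x / y, - (x^2 / y) - y], vector [1 / y, - (x / y)]])"

definition hstar :: "complex set" where
  "hstar = {z. 0 < Im z \<and> \<bar>Re z\<bar> < 1 / sqrt 3 \<and> (Re z)^2 + (Im z)^2 > 1 / 3}"

definition vec_of_complex :: "complex \<Rightarrow> real^2" where
  "vec_of_complex z = vector [Re z, Im z]"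

definition complex_of_vec :: "real^2 \<Rightarrow> complex" where
  "complex_of_vec v = Complex (v$1) (v$2)"

text \<open>The matrix, in the coordinates \<open>(x, y)\<close>, of the differential at \<open>z\<close> of the action of \<open>A\<close>.\<close>
definition act_differential :: "mat2 \<Rightarrow> complex \<Rightarrow> mat2" where
  "act_differential A z =
     jacobian (vec_of_complex \<circ> mat_act A \<circ> complex_of_vec) (at (vec_of_complex z))"


section \<open>Controls\<close>

text \<open>A control value \<open>(u\<^sub>0, u\<^sub>1, u\<^sub>2)\<close>.\<close>
type_synonym control = "real \<times> real \<times> real"

definition U :: "control set" where
  "U = {(u0, u1, u2). u0 + u1 + u2 = 1 \<and> 0 \<le> u0 \<and> 0 \<le> u1 \<and> 0 \<le> u2}"

definition U_vertices :: "control set" where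
  "U_vertices = {(1, 0, 0), (0, 1, 0), (0, 0, 1)}"

fun ctrl_a :: "control \<Rightarrow> real" where
  "ctrl_a (u0, u1, u2) = (u1 - u2) / sqrt 3"

fun ctrl_b :: "control \<Rightarrow> real" where
  "ctrl_b (u0, u1, u2) = u0 / 3 - 2 * u1 / 3 - 2 * u2 / 3"

fun ctrl_c :: "control \<Rightarrow> real" where
  "ctrl_c (u0, u1, u2) = u0"

definition f1 :: "real \<Rightarrow> real \<Rightarrow> control \<Rightarrow> real" where
  "f1 x y u = (let a = ctrl_a u; b = ctrl_b u; c = ctrl_c u in
     y * (b + 2 * a * x - c * x^2 + c * y^2) / (b + 2 * a * x - c * x^2 - c * y^2))"

definition f2 :: "real \<Rightarrow> real \<Rightarrow> control \<Rightarrow> real" where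
  "f2 x y u = (let a = ctrl_a u; b = ctrl_b u; c = ctrl_c u in
     2 * (a - c * x) * y^2 / (b + 2 * a * x - c * x^2 - c * y^2))"

definition measurable_control :: "real \<Rightarrow> (real \<Rightarrow> control) \<Rightarrow> bool" where
  "measurable_control tf u \<longleftrightarrow>
     u \<in> borel_measurable (lebesgue_on {0..tf}) \<and> (\<forall>t\<in>{0..tf}. u t \<in> U)"

definition bang_bang :: "real \<Rightarrow> (real \<Rightarrow> control) \<Rightarrow> bool" where
  "bang_bang tf u \<longleftrightarrow>
     u \<in> borel_measurable (lebesgue_on {0..tf}) \<and> (\<forall>t\<in>{0..tf}. u t \<in> U_vertices)"

text \<open>Piecewise constant with finitely many pieces; the values at the break points
  are irrelevant.\<close>
definition finitely_many_switches :: "real \<Rightarrow> (real \<Rightarrow> control) \<Rightarrow> bool" where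
  "finitely_many_switches tf u \<longleftrightarrow>
     (\<exists>(n::nat) (\<tau>::nat \<Rightarrow> real). \<tau> 0 = 0 \<and> \<tau> n = tf \<and>
        (\<forall>i<n. \<tau> i < \<tau> (Suc i) \<and> (\<exists>e. \<forall>t\<in>{\<tau> i<..<\<tau> (Suc i)}. u t = e)))"


section \<open>Admissible trajectories\<close>

definition abs_continuous_on :: "real set \<Rightarrow> (real \<Rightarrow> 'a::metric_space) \<Rightarrow> bool" where
  "abs_continuous_on S f \<longleftrightarrow>
     (\<forall>\<epsilon>>0. \<exists>\<delta>>0. \<forall>D :: (real \<times> real) set.
        finite D \<and> (\<forall>(a, b)\<in>D. a \<le> b \<and> {a..b} \<subseteq> S) \<and>
        pairwise (\<lambda>p q. {fst p<..<snd p} \<inter> {fst q<..<snd q} = {}) D \<and>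
        (\<Sum>(a, b)\<in>D. b - a) < \<delta> \<longrightarrow>
        (\<Sum>(a, b)\<in>D. dist (f a) (f b)) < \<epsilon>)"

definition trajectory ::
    "real \<Rightarrow> (real \<Rightarrow> control) \<Rightarrow> (real \<Rightarrow> mat2) \<Rightarrow> (real \<Rightarrow> complex) \<Rightarrow> bool" where
  "trajectory tf u g z \<longleftrightarrow>
     measurable_control tf u \<and>
     (\<forall>t\<in>{0..tf}. g t \<in> SL2 \<and> 0 < Im (z t)) \<and>
     abs_continuous_on {0..tf} (\<lambda>t. (g t, z t)) \<and>
     (AE t in lebesgue_on {0..tf}.
        (z has_vector_derivative
           Complex (f1 (Re (z t)) (Im (z t)) (u t)) (f2 (Re (z t)) (Im (z t)) (u t)))
          (at t within {0..tf}) \<and>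
        (g has_vector_derivative (g t ** X (z t))) (at t within {0..tf}))"

text \<open>The library's \<^const>\<open>homotopic_paths\<close> (fixed endpoints) is for paths on \<open>[0, 1]\<close>,
  hence the rescaling of time.\<close>
definition admissible ::
    "real \<Rightarrow> (real \<Rightarrow> control) \<Rightarrow> (real \<Rightarrow> mat2) \<Rightarrow> (real \<Rightarrow> complex) \<Rightarrow> bool" where
  "admissible tf u g z \<longleftrightarrow>
     0 < tf \<and> trajectory tf u g z \<and>
     z ` {0..tf} \<subseteq> hstar \<and>
     g 0 = mat 1 \<and> g tf = R \<and> z tf = mat_act (matrix_inv R) (z 0) \<and>
     homotopic_paths SL2
       (g \<circ> (\<lambda>s. tf * s))
       ((\<lambda>t. mat_exp ((pi * t / (3 * tf)) *\<^sub>R J)) \<circ> (\<lambda>s. tf * s))"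


section \<open>Pontryagin extremals\<close>

text \<open>A point \<open>((g, \<Lambda>), (z, \<nu>))\<close> of the cotangent bundle of the manifold \<open>M\<close>, with the
  constraints \<open>g \<in> SL2\<close>, \<open>\<Lambda> \<in> sl2\<close>, \<open>Im z > 0\<close> imposed separately.\<close>
type_synonym cotangent = "(mat2 \<times> mat2) \<times> (complex \<times> (real^2))"

definition g_of :: "cotangent \<Rightarrow> mat2" where "g_of p = fst (fst p)"
definition Lambda_of :: "cotangent \<Rightarrow> mat2" where "Lambda_of p = snd (fst p)"
definition z_of :: "cotangent \<Rightarrow> complex" where "z_of p = fst (snd p)"
definition nu_of :: "cotangent \<Rightarrow> real^2" where "nu_of p = snd (snd p)"

fun hamiltonian :: "real \<Rightarrow> cotangent \<Rightarrow> control \<Rightarrow> real" where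
  "hamiltonian lcost ((g, \<Lambda>), (z, \<nu>)) u =
     trace_form \<Lambda> (X z) - 3 / 2 * lcost * trace_form J (X z)
     + \<nu>$1 * f1 (Re z) (Im z) u + \<nu>$2 * f2 (Re z) (Im z) u"

text \<open>For \<open>z \<in> hstar\<close> the supremum is attained: \<open>U\<close> is compact and the denominator of
  \<open>f1\<close> and \<open>f2\<close> is negative for every \<open>u \<in> U\<close>.\<close>
definition hamiltonian_max :: "real \<Rightarrow> cotangent \<Rightarrow> real" where
  "hamiltonian_max lcost p = (SUP u\<in>U. hamiltonian lcost p u)"

fun dH_dx :: "real \<Rightarrow> cotangent \<Rightarrow> control \<Rightarrow> real" where
  "dH_dx lcost ((g, \<Lambda>), (z, \<nu>)) u =
     deriv (\<lambda>x. hamiltonian lcost ((g, \<Lambda>), (Complex x (Im z), \<nu>)) u) (Re z)"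

fun dH_dy :: "real \<Rightarrow> cotangent \<Rightarrow> control \<Rightarrow> real" where
  "dH_dy lcost ((g, \<Lambda>), (z, \<nu>)) u =
     deriv (\<lambda>y. hamiltonian lcost ((g, \<Lambda>), (Complex (Re z) y, \<nu>)) u) (Im z)"

definition lifted_trajectory ::
    "real \<Rightarrow> real \<Rightarrow> (real \<Rightarrow> control) \<Rightarrow> (real \<Rightarrow> cotangent) \<Rightarrow> bool" where
  "lifted_trajectory tf lcost u lam \<longleftrightarrow>
     admissible tf u (g_of \<circ> lam) (z_of \<circ> lam) \<and>
     (\<exists>L. L-lipschitz_on {0..tf} lam) \<and>
     (\<forall>t\<in>{0..tf}. Lambda_of (lam t) \<in> sl2) \<and>
     (AE t in lebesgue_on {0..tf}.
        ((Lambda_of \<circ> lam) has_vector_derivative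
           bracket (Lambda_of (lam t)) (X (z_of (lam t)))) (at t within {0..tf}) \<and>
        ((nu_of \<circ> lam) has_vector_derivative
           vector [- dH_dx lcost (lam t) (u t), - dH_dy lcost (lam t) (u t)])
          (at t within {0..tf}))"

definition pontryagin_extremal ::
    "real \<Rightarrow> real \<Rightarrow> (real \<Rightarrow> control) \<Rightarrow> (real \<Rightarrow> cotangent) \<Rightarrow> bool" where
  "pontryagin_extremal tf lcost u lam \<longleftrightarrow>
     lifted_trajectory tf lcost u lam \<and>
     (AE t in lebesgue_on {0..tf}.
        hamiltonian lcost (lam t) (u t) = hamiltonian_max lcost (lam t) \<and>
        hamiltonian_max lcost (lam t) = 0) \<and>
     (\<forall>t\<in>{0..tf}. (lcost, Lambda_of (lam t), nu_of (lam t)) \<noteq> 0) \<and>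
     lcost \<in> {0, -1} \<and>
     Lambda_of (lam tf) = matrix_inv R ** Lambda_of (lam 0) ** R \<and>
     transpose (act_differential (matrix_inv R) (z_of (lam 0))) *v nu_of (lam tf) = nu_of (lam 0)"

definition Lambda_sing :: "(real \<times> cotangent) set" where
  "Lambda_sing = {(lcost, ((g, \<Lambda>), (z, \<nu>))).
     lcost = -1 \<and> g \<in> SL2 \<and> \<Lambda> = (3 / 2 * lcost) *\<^sub>R J \<and> z = \<i> \<and> \<nu> = 0}"

end

theory Submission
  imports Defs
begin

text \<open>The maximum condition only involves the vertices of the control simplex. For fixed costate the
Hamiltonian is a quotient of two functions that are affine in the control \<open>u\<close>, and its denominator
has constant sign on the star domain. The Hamiltonians of the three vertices, each multiplied by a negative
function, give three switching functions \<open>f\<^sub>i\<close> of time whose combinations with the weights of \<open>u\<close> are the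
numerators, up to sign. The maximum being zero means that all \<open>f\<^sub>i \<ge> 0\<close> and that \<open>f\<^sub>i = 0\<close> wherever the \<open>i\<close>-th weight of the control is positive.
So the control is determined, and is a vertex, as long as only one \<open>f\<^sub>i\<close> vanishes; call the other times
ties. Everything reduces to showing that there are finitely many ties (\<open>finite_ties\<close>), and by
compactness this follows if no time is a limit of ties.

Coordinates. Let \<open>Z\<^sub>u\<close> be the traceless matrix with first row \<open>(a, b)\<close> and second row \<open>(c, - a)\<close>. The
denominator of the Hamiltonian is a multiple of \<open>\<langle>Z\<^sub>u, X\<rangle>\<close>. The matrices \<open>Z\<^sub>i\<close> of the three vertices form a
basis of the traceless matrices, conjugation by \<open>R\<close> permutes them cyclically, and
\<open>[Z\<^sub>i, Z\<^sub>i\<^sub>+\<^sub>1] = \<kappa> (Z\<^sub>i + Z\<^sub>i\<^sub>+\<^sub>1)\<close> with \<open>\<kappa> = 2 / \<surd>3\<close>. With the coordinates \<open>x\<^sub>i = - \<langle>X, Z\<^sub>i\<rangle>\<close> of the point,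
\<open>m\<^sub>i = \<langle>M, Z\<^sub>i\<rangle>\<close> of \<open>M = \<Lambda> - (3/2) \<lambda>\<^sub>c\<^sub>o\<^sub>s\<^sub>t J\<close>, and with the \<open>f\<^sub>i\<close> in place of \<open>\<nu>\<close>, the extremal equations become
polynomial and invariant under the cyclic shift of the indices. Time reversal combined with
\<open>i \<mapsto> - i\<close> is a further symmetry, and transversality says that the final data are the initial data
with shifted indices. These properties are collected in the locale \<open>switching_system\<close>, and
\<open>extremal_imp_switching_system\<close> derives them from the definition of an extremal.

Times at which all \<open>f\<^sub>i\<close> vanish (\<open>triple_zero_right\<close>). The derivative of \<open>f\<^sub>i / x\<^sub>i - f\<^sub>j / x\<^sub>j\<close> is, up to terms
that vanish with \<open>f\<close>, equal to \<open>c\<^sub>i / x\<^sub>i - c\<^sub>j / x\<^sub>j\<close> with \<open>c\<^sub>i = \<langle>[M, X], Z\<^sub>i\<rangle>\<close>, whatever the control is. If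
\<open>M \<noteq> 0\<close>, the ratios \<open>c\<^sub>i / x\<^sub>i\<close> are not all equal and some \<open>f\<^sub>i\<close> becomes positive at once. If \<open>M = 0\<close>, then
\<open>\<lambda>\<^sub>c\<^sub>o\<^sub>s\<^sub>t = - 1\<close>, and since the extremal avoids the singular locus, the \<open>x\<^sub>i\<close> are not all equal; then \<open>M' \<noteq> 0\<close>
and the same argument works to second order.

Intervals on which one \<open>f\<^sub>i\<close> is positive. There the control moves on the edge opposite to \<open>e\<^sub>i\<close>. Along such
an edge the switching function of the edge has derivative a positive multiple of a function \<open>Q\<close>
(\<open>edge_slope\<close>), and \<open>Q - (3/8) \<lambda>\<^sub>c\<^sub>o\<^sub>s\<^sub>t \<xi>\<^sup>2\<close> is constant, where \<open>\<xi>\<close> (\<open>edge_pos\<close>) is strictly increasing. Hence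
either \<open>Q\<close> has finitely many zeros, and by Rolle's theorem ties do not accumulate, or
\<open>\<lambda>\<^sub>c\<^sub>o\<^sub>s\<^sub>t = 0\<close> and \<open>Q = 0\<close> on the whole interval.

Abnormal edges. In the last case an arc consisting of ties satisfies all local conditions, for every
control on the edge. It is excluded by a global argument (\<open>no_abnormal_edge\<close>). One more quantity is
conserved on the arc; depending on its sign, \<open>f\<^sub>i\<close> stays positive forever in the future or
in the past. Say in the future: the arc reaches the final time, continues at the initial time with
shifted index \<open>i + d\<close>, and persists up to its own start. But there \<open>f\<^sub>i\<^sub>+\<^sub>d = 0\<close>, because only \<open>f\<^sub>i\<close> is
positive on the arc.\<close>

section \<open>Lipschitz functions with a derivative almost everywhere\<close>

text \<open>Lipschitz constants are of no interest here; without them the property is closed under sums, products and quotients on compact intervals.\<close>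
definition lipschitzian :: "real set \<Rightarrow> (real \<Rightarrow> real) \<Rightarrow> bool" where
  "lipschitzian S f \<longleftrightarrow> (\<exists>L. L-lipschitz_on S f)"

lemma lipschitzian_subset: "lipschitzian S f \<Longrightarrow> T \<subseteq> S \<Longrightarrow> lipschitzian T f"
  unfolding lipschitzian_def by (meson lipschitz_on_subset)

lemma lipschitzian_continuous_on: "lipschitzian S f \<Longrightarrow> continuous_on S f"
  unfolding lipschitzian_def by (meson lipschitz_on_continuous_on)

lemma lipschitzian_const: "lipschitzian S (\<lambda>t. c)"
  unfolding lipschitzian_def by (blast intro: lipschitz_on_constant)

lemma lipschitzian_id: "lipschitzian S (\<lambda>t. t)"
  unfolding lipschitzian_def by (blast intro: lipschitz_on_id)

lemma lipschitzian_add: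
  "lipschitzian S f \<Longrightarrow> lipschitzian S g \<Longrightarrow> lipschitzian S (\<lambda>t. f t + g t)"
  unfolding lipschitzian_def by (blast intro: lipschitz_on_add)

lemma lipschitzian_diff:
  "lipschitzian S f \<Longrightarrow> lipschitzian S g \<Longrightarrow> lipschitzian S (\<lambda>t. f t - g t)"
  unfolding lipschitzian_def by (blast intro: lipschitz_on_diff)

lemma lipschitzian_minus: "lipschitzian S f \<Longrightarrow> lipschitzian S (\<lambda>t. - f t)"
  unfolding lipschitzian_def by simp

lemma lipschitzian_bounded:
  assumes "lipschitzian {a..b} f"
  obtains K where "K \<ge> 0" "\<And>t. t \<in> {a..b} \<Longrightarrow> \<bar>f t\<bar> \<le> K"
proof -
  have "bounded (f ` {a..b})"
    using assms by (intro compact_imp_bounded compact_continuous_image lipschitzian_continuous_on) auto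
  then obtain K where "\<forall>y\<in>f ` {a..b}. norm y \<le> K"
    using bounded_iff by blast
  then have "\<bar>f t\<bar> \<le> max K 0" if "t \<in> {a..b}" for t
    by (metis image_eqI max.coboundedI1 real_norm_def that)
  then show ?thesis using that[of "max K 0"] by auto
qed

lemma lipschitzian_mult:
  assumes "lipschitzian {a..b} f" "lipschitzian {a..b} g"
  shows "lipschitzian {a..b} (\<lambda>t. f t * g t)"
proof -
  obtain K where K: "K \<ge> 0" "\<And>t. t \<in> {a..b} \<Longrightarrow> \<bar>f t\<bar> \<le> K"
    using assms(1) lipschitzian_bounded by blast
  obtain K' where K': "K' \<ge> 0" "\<And>t. t \<in> {a..b} \<Longrightarrow> \<bar>g t\<bar> \<le> K'"
    using assms(2) lipschitzian_bounded by blast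
  obtain L where L: "L-lipschitz_on {a..b} f" using assms(1) lipschitzian_def by blast
  obtain L' where L': "L'-lipschitz_on {a..b} g" using assms(2) lipschitzian_def by blast
  have "(K * L' + K' * L)-lipschitz_on {a..b} (\<lambda>t. f t * g t)"
  proof (rule lipschitz_onI)
    fix s t assume st: "s \<in> {a..b}" "t \<in> {a..b}"
    have "\<bar>f s * g s - f t * g t\<bar> = \<bar>f s * (g s - g t) + g t * (f s - f t)\<bar>"
      by (simp add: algebra_simps)
    also have "\<dots> \<le> \<bar>f s\<bar> * \<bar>g s - g t\<bar> + \<bar>g t\<bar> * \<bar>f s - f t\<bar>"
      by (metis abs_mult abs_triangle_ineq)
    also have "\<dots> \<le> K * (L' * \<bar>s - t\<bar>) + K' * (L * \<bar>s - t\<bar>)"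
      using K K' st lipschitz_onD[OF L st] lipschitz_onD[OF L' st]
      by (intro add_mono mult_mono) (auto simp: dist_real_def)
    finally show "dist (f s * g s) (f t * g t) \<le> (K * L' + K' * L) * dist s t"
      by (simp add: dist_real_def algebra_simps)
  qed (use K K' lipschitz_on_nonneg[OF L] lipschitz_on_nonneg[OF L'] in auto)
  then show ?thesis unfolding lipschitzian_def by blast
qed

lemma lipschitzian_divide:
  assumes f: "lipschitzian {a..b} f" and g: "lipschitzian {a..b} g"
    and pos: "\<And>t. t \<in> {a..b} \<Longrightarrow> g t > 0"
  shows "lipschitzian {a..b} (\<lambda>t. f t / g t)"
proof (cases "a \<le> b")
  case False then show ?thesis
    unfolding lipschitzian_def by (intro exI[of _ 0]) (auto simp: lipschitz_on_def)
next
  case True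
  obtain t0 where t0: "t0 \<in> {a..b}" "\<And>t. t \<in> {a..b} \<Longrightarrow> g t0 \<le> g t"
    using continuous_attains_inf[OF compact_Icc _ lipschitzian_continuous_on[OF g]] True
    by auto
  define d where "d = g t0"
  have d: "d > 0" using pos t0 d_def by auto
  obtain L where L: "L-lipschitz_on {a..b} g" using g lipschitzian_def by blast
  have "(L / d^2)-lipschitz_on {a..b} (\<lambda>t. 1 / g t)"
  proof (rule lipschitz_onI)
    fix s t assume st: "s \<in> {a..b}" "t \<in> {a..b}"
    have g: "g s \<ge> d" "g t \<ge> d" using st t0 d_def by auto
    then have gg: "g s * g t \<ge> d^2" using d by (simp add: power2_eq_square mult_mono)
    have "dist (1 / g s) (1 / g t) = \<bar>g t - g s\<bar> / (g s * g t)"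
      using g d by (simp add: dist_real_def divide_simps abs_mult)
    also have "\<dots> \<le> \<bar>g t - g s\<bar> / d^2"
      using gg d by (intro divide_left_mono) 
        (auto intro!: mult_pos_pos simp: pos[OF st(1)] pos[OF st(2)] simp del: zero_less_mult_iff)
    also have "\<dots> \<le> L * dist s t / d^2"
      using lipschitz_onD[OF L st] d by (intro divide_right_mono) (auto simp: dist_real_def)
    finally show "dist (1 / g s) (1 / g t) \<le> L / d^2 * dist s t" by simp
  qed (use d lipschitz_on_nonneg[OF L] in auto)
  then have "lipschitzian {a..b} (\<lambda>t. f t * (1 / g t))"
    by (intro lipschitzian_mult f) (auto simp: lipschitzian_def)
  then show ?thesis by simp
qed

lemmas lipschitzian_intros = lipschitzian_const lipschitzian_id lipschitzian_add lipschitzian_diff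
  lipschitzian_minus lipschitzian_mult lipschitzian_divide

lemma lipschitzian_reflect:
  assumes "lipschitzian {0..T} f"
  shows "lipschitzian {0..T} (\<lambda>t. f (T - t))"
proof -
  obtain L where L: "L-lipschitz_on {0..T} f" using assms lipschitzian_def by blast
  have "L-lipschitz_on {0..T} (\<lambda>t. f (T - t))"
  proof (rule lipschitz_onI)
    fix s t assume "s \<in> {0..T}" "t \<in> {0..T}"
    then show "dist (f (T - s)) (f (T - t)) \<le> L * dist s t"
      using lipschitz_onD[OF L, of "T - s" "T - t"] by (auto simp: dist_real_def abs_minus_commute)
  qed (rule lipschitz_on_nonneg[OF L])
  then show ?thesis unfolding lipschitzian_def by blast
qed

lemma negligible_lipschitzian_image:
  assumes "lipschitzian S f" "negligible N" "N \<subseteq> S"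
  shows "negligible (f ` N)"
proof (rule negligible_locally_Lipschitz_image[OF order_refl assms(2)])
  obtain L where L: "L-lipschitz_on S f" using assms lipschitzian_def by blast
  fix t assume "t \<in> N"
  then show "\<exists>V B. open V \<and> t \<in> V \<and> (\<forall>y\<in>N \<inter> V. norm (f y - f t) \<le> B * norm (y - t))"
    using assms(3) lipschitz_on_normD[OF L]
    by (intro exI[of _ UNIV] exI[of _ L]) (auto simp: subset_iff)
qed

text \<open>Suppose \<open>f a > f b\<close>. A Lipschitz function maps null sets to null sets, so some level \<open>c\<close> strictly between
\<open>f b\<close> and \<open>f a\<close> is attained only at times with positive derivative. Right after the last such time \<open>f\<close> is
larger than \<open>c\<close>, so it has to attain \<open>c\<close> once more on the way down to \<open>f b\<close>.\<close>
lemma AE_deriv_pos_imp_le: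
  fixes f :: "real \<Rightarrow> real"
  assumes ab: "a \<le> b" and f: "lipschitzian {a..b} f" and N: "negligible N"
    and D: "\<And>t. t \<in> {a<..<b} - N \<Longrightarrow> \<exists>D>0. (f has_real_derivative D) (at t within {a..b})"
  shows "f a \<le> f b"
proof (rule ccontr)
  assume "\<not> f a \<le> f b"
  then have less: "f b < f a" by simp
  define N' where "N' = insert a (insert b N) \<inter> {a..b}"
  have "negligible N'" unfolding N'_def using N by (intro negligible_Int) auto
  then have "negligible (f ` N')"
    using f by (intro negligible_lipschitzian_image[of "{a..b}"]) (auto simp: N'_def)
  moreover have "\<not> negligible {f b<..<f a}"
    using less open_not_negligible[of "{f b<..<f a}"] by auto
  ultimately obtain c where c: "f b < c" "c < f a" "c \<notin> f ` N'"
    using negligible_subset by (metis greaterThanLessThan_iff subsetI)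
  define S where "S = {t \<in> {a..b}. f t \<in> {c..}}"
  have cont: "continuous_on {a..b} f" using f lipschitzian_continuous_on by blast
  have "S = {a..b} \<inter> f -` {c..}" by (auto simp: S_def)
  then have "closed S" using continuous_closed_preimage[OF cont] by simp
  moreover have "a \<in> S" using c ab by (auto simp: S_def)
  moreover have bdd: "bdd_above S" by (rule bdd_aboveI[of _ b]) (auto simp: S_def)
  ultimately have SS: "Sup S \<in> S" using closed_contains_Sup by blast
  define t where "t = Sup S"
  have t: "t \<in> {a..b}" "f t \<ge> c" using SS by (auto simp: S_def t_def)
  have max: "s \<in> {a..b} \<Longrightarrow> f s \<ge> c \<Longrightarrow> s \<le> t" for s
    using bdd cSup_upper[of s S] by (auto simp: S_def t_def)
  have "f t = c"
  proof -
    have "\<exists>s\<ge>t. s \<le> b \<and> f s = c"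
      using t c by (intro IVT2') (auto intro: continuous_on_subset[OF cont])
    then show ?thesis using max t by (metis atLeastAtMost_iff order.trans order_antisym order_refl)
  qed
  then have "t \<notin> N'" using c by auto
  then have "t \<in> {a<..<b} - N" using t by (auto simp: N'_def)
  then obtain D where D: "D > 0" "(f has_real_derivative D) (at t within {a..b})"
    using assms(4) by blast
  then obtain d where d: "d > 0" "\<And>h. h > 0 \<Longrightarrow> t + h \<in> {a..b} \<Longrightarrow> h < d \<Longrightarrow> f t < f (t + h)"
    using has_real_derivative_pos_inc_right by blast
  define h where "h = min (d / 2) (b - t)"
  have "h > 0" "h < d" "t + h \<in> {a..b}"
    using d \<open>t \<in> {a<..<b} - N\<close> by (auto simp: h_def)
  then have "f (t + h) > c" using d \<open>f t = c\<close> by auto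
  then show False using max[of "t + h"] \<open>h > 0\<close> \<open>t + h \<in> {a..b}\<close> by auto
qed

text \<open>The strict case applies to \<open>f t + \<delta> t\<close> for every \<open>\<delta> > 0\<close>.\<close>
lemma AE_deriv_nonneg_imp_le:
  fixes f :: "real \<Rightarrow> real"
  assumes ab: "a \<le> b" and f: "lipschitzian {a..b} f" and N: "negligible N"
    and D: "\<And>t. t \<in> {a<..<b} - N \<Longrightarrow> \<exists>D\<ge>0. (f has_real_derivative D) (at t within {a..b})"
  shows "f a \<le> f b"
proof (rule field_le_epsilon)
  fix e :: real assume e: "e > 0"
  define d where "d = e / (b - a + 1)"
  have d: "d > 0" using e ab by (auto simp: d_def)
  have "f a + d * a \<le> f b + d * b"
  proof (rule AE_deriv_pos_imp_le[OF ab _ N])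
    fix t assume "t \<in> {a<..<b} - N"
    then obtain D where "D \<ge> 0" "(f has_real_derivative D) (at t within {a..b})" using D by blast
    then show "\<exists>D>0. ((\<lambda>t. f t + d * t) has_real_derivative D) (at t within {a..b})"
      using d by (intro exI[of _ "D + d"]) (auto intro!: derivative_eq_intros)
  qed (intro lipschitzian_add lipschitzian_mult f lipschitzian_const lipschitzian_id)
  then have "f a \<le> f b + d * (b - a)" by (simp add: algebra_simps)
  also have "d * (b - a) \<le> e" using e ab by (simp add: d_def divide_simps)
  finally show "f a \<le> f b + e" by simp
qed

lemma AE_deriv_zero_imp_eq:
  fixes f :: "real \<Rightarrow> real"
  assumes ab: "a \<le> b" and f: "lipschitzian {a..b} f" and N: "negligible N"
    and D: "\<And>t. t \<in> {a<..<b} - N \<Longrightarrow> (f has_real_derivative 0) (at t within {a..b})"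
  shows "f a = f b"
proof (rule antisym)
  show "f a \<le> f b" by (rule AE_deriv_nonneg_imp_le[OF ab f N]) (use D in auto)
  have "- f a \<le> - f b"
    by (rule AE_deriv_nonneg_imp_le[OF ab lipschitzian_minus[OF f] N])
       (use D in \<open>auto intro!: exI[of _ 0] derivative_eq_intros\<close>)
  then show "f b \<le> f a" by simp
qed

lemma AE_deriv_pos_imp_less:
  fixes f :: "real \<Rightarrow> real"
  assumes ab: "a < b" and f: "lipschitzian {a..b} f" and N: "negligible N"
    and D: "\<And>t. t \<in> {a<..<b} - N \<Longrightarrow> \<exists>D>0. (f has_real_derivative D) (at t within {a..b})"
  shows "f a < f b"
proof -
  have mono: "f s \<le> f t" if "a \<le> s" "s \<le> t" "t \<le> b" for s t
  proof (rule AE_deriv_pos_imp_le[OF that(2) _ N])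
    show "lipschitzian {s..t} f" using that by (intro lipschitzian_subset[OF f]) auto
    fix r assume "r \<in> {s<..<t} - N"
    then show "\<exists>D>0. (f has_real_derivative D) (at r within {s..t})"
      using D[of r] that DERIV_subset[of f _ r "{a..b}" "{s..t}"] by auto
  qed
  have "\<not> negligible {a<..<b}" using ab open_not_negligible[of "{a<..<b}"] by auto
  then obtain t where t: "t \<in> {a<..<b} - N" using N negligible_subset by blast
  then obtain D where "D > 0" "(f has_real_derivative D) (at t within {a..b})" using D by blast
  then obtain d where d: "d > 0" "\<And>h. h > 0 \<Longrightarrow> t + h \<in> {a..b} \<Longrightarrow> h < d \<Longrightarrow> f t < f (t + h)"
    using has_real_derivative_pos_inc_right by blast
  define h where "h = min (d / 2) (b - t)"
  have h: "h > 0" "h < d" "t + h \<in> {a..b}" using d t by (auto simp: h_def)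
  have "f a \<le> f t" using mono[of a t] t by auto
  also have "f t < f (t + h)" using d h by auto
  also have "\<dots> \<le> f b" using mono[of "t + h" b] h t by auto
  finally show ?thesis .
qed

text \<open>By the previous lemmas \<open>f\<close> differs from the integral of \<open>g\<close> by a constant. This is how quantities whose
derivative does not depend on the control become continuously differentiable.\<close>
lemma AE_deriv_continuous_imp_deriv:
  fixes f g :: "real \<Rightarrow> real"
  assumes f: "lipschitzian {a..b} f" and g: "continuous_on {a..b} g" and N: "negligible N"
    and D: "\<And>t. t \<in> {a<..<b} - N \<Longrightarrow> (f has_real_derivative g t) (at t within {a..b})"
    and t: "t \<in> {a..b}"
  shows "(f has_real_derivative g t) (at t within {a..b})"
proof -
  define G where "G = (\<lambda>s. integral {a..s} g)"
  have G: "(G has_real_derivative g s) (at s within {a..b})" if "s \<in> {a..b}" for s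
    unfolding G_def by (rule integral_has_real_derivative[OF g that])
  obtain K where K: "\<forall>y\<in>g ` {a..b}. norm y \<le> K"
    using compact_imp_bounded[OF compact_continuous_image[OF g]] bounded_iff by blast
  have "(max K 0)-lipschitz_on {a..b} G"
  proof (rule lipschitz_onI)
    fix x y assume xy: "x \<in> {a..b}" "y \<in> {a..b}"
    have "norm (G x - G y) \<le> max K 0 * norm (x - y)"
    proof (rule field_differentiable_bound[OF _ _ _ xy])
      show "\<And>z. z \<in> {a..b} \<Longrightarrow> norm (g z) \<le> max K 0"
        by (meson K image_eqI max.coboundedI1)
    qed (use G in auto)
    then show "dist (G x) (G y) \<le> max K 0 * dist x y" by (simp add: dist_norm)
  qed auto
  then have G_lip: "lipschitzian {a..b} G" unfolding lipschitzian_def by blast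
  have eq: "f a - G a = f s - G s" if s: "s \<in> {a..b}" for s
  proof (rule AE_deriv_zero_imp_eq[OF _ _ N, where f = "\<lambda>t. f t - G t"])
    show "a \<le> s" using s by auto
    show "lipschitzian {a..s} (\<lambda>t. f t - G t)"
      using s by (intro lipschitzian_subset[OF lipschitzian_diff[OF f G_lip]]) auto
    fix r assume r: "r \<in> {a<..<s} - N"
    have "((\<lambda>t. f t - G t) has_real_derivative g r - g r) (at r within {a..b})"
      using r s by (intro DERIV_diff D G) auto
    then show "((\<lambda>t. f t - G t) has_real_derivative 0) (at r within {a..s})"
      using s by (auto intro: DERIV_subset)
  qed
  have "((\<lambda>s. G s + (f a - G a)) has_real_derivative g t) (at t within {a..b})"
    using G[OF t] by (auto intro!: derivative_eq_intros)
  then show ?thesis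
  proof (rule has_field_derivative_transform_within[OF _ zero_less_one t])
    fix s assume "s \<in> {a..b}"
    then show "G s + (f a - G a) = f s" using eq[of s] by simp
  qed
qed

section \<open>Cyclic coordinates on the traceless matrices\<close>
lemma index3_simps [simp]:
  "(i::3) + 1 + 1 = i + 2" "(i::3) + 1 + 2 = i" "(i::3) + 2 + 1 = i" "(i::3) + 2 + 2 = i + 1"
  using exhaust_3[of i] by auto

lemma index3_cases: "(k::3) = i \<or> k = i + 1 \<or> k = i + 2"
  using exhaust_3[of i] exhaust_3[of k] by auto

lemma UNIV_index3: "(UNIV :: 3 set) = {i, i + 1, i + 2}"
  using index3_cases[of _ i] by auto

lemma index3_distinct [simp]: "(i::3) \<noteq> i + 1" "(i::3) \<noteq> i + 2" "(i::3) + 1 \<noteq> i + 2"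
  using exhaust_3[of i] by auto

lemma sum_index3: "(\<Sum>k\<in>UNIV. g k) = g i + g (i + 1) + g (i + (2::3))"
  for g :: "3 \<Rightarrow> 'a::comm_monoid_add"
  unfolding UNIV_index3[of i] by (simp add: add.assoc)

lemma minus_index3: "- (i::3) + 1 = - (i + 2)" "- (i::3) + 2 = - (i + 1)"
  using exhaust_3[of i] by auto

text \<open>A traceless matrix \<open>A\<close> is represented by \<open>a\<^sub>i = \<langle>A, Z\<^sub>i\<rangle>\<close>, where \<open>Z\<^sub>1\<close>, \<open>Z\<^sub>2\<close>, \<open>Z\<^sub>0\<close> belong to the control vertices
\<open>e\<^sub>1\<close>, \<open>e\<^sub>2\<close>, \<open>e\<^sub>3\<close>. The type of indices is \<open>3\<close>, whose arithmetic is modulo 3. If \<open>P = - (\<Sum>k. p\<^sub>k Z\<^sub>k)\<close>, then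
\<open>control_ad \<kappa> p a\<close> represents \<open>[P, A]\<close>.\<close>
definition control_ad :: "real \<Rightarrow> (3 \<Rightarrow> real) \<Rightarrow> (3 \<Rightarrow> real) \<Rightarrow> 3 \<Rightarrow> real" where
  "control_ad \<kappa> p x i = \<kappa> * (p (i + 2) * (x i + x (i + 2)) - p (i + 1) * (x i + x (i + 1)))"

text \<open>The matrix \<open>X\<close> of a point is represented by \<open>x\<^sub>i = - \<langle>X, Z\<^sub>i\<rangle>\<close>, with the opposite sign, so that all
\<open>x\<^sub>i\<close> are positive on the star domain. This is \<open>[M, X]\<close> for the matrix \<open>M\<close> with coordinates \<open>m\<close>.\<close>
definition point_ad :: "real \<Rightarrow> (3 \<Rightarrow> real) \<Rightarrow> (3 \<Rightarrow> real) \<Rightarrow> 3 \<Rightarrow> real" where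
  "point_ad \<kappa> x m i = 3 * \<kappa> / 4 * ((x i + x (i + 1)) * (m i + m (i + 2)) - (x i + x (i + 2)) * (m i + m (i + 1)))"

text \<open>The trace form \<open>\<langle>M, X\<rangle>\<close>. The Gram matrix of the \<open>Z\<^sub>i\<close> has the entries \<open>2/3\<close> on the diagonal and \<open>- 2/3\<close> elsewhere; the
diagonal of its inverse is zero.\<close>
definition pairing :: "(3 \<Rightarrow> real) \<Rightarrow> (3 \<Rightarrow> real) \<Rightarrow> real" where
  "pairing m x = 3 / 4 * (\<Sum>i\<in>UNIV. m i * (x (i + 1) + x (i + 2)))"

text \<open>Along an extremal the \<open>f\<^sub>i\<close> are the coordinates of a matrix \<open>\<Omega>\<close> with
\<open>\<Omega>' = [P, \<Omega>] + h [P, X] + [M, X] + h' X\<close>, where \<open>h = \<langle>M, X\<rangle>\<close> has derivative \<open>h' = \<langle>M, [P, X]\<rangle>\<close>.\<close>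
definition f_rate where
  "f_rate \<kappa> p x m f i = control_ad \<kappa> p f i - pairing m x * control_ad \<kappa> p x i
     - x i * (\<Sum>k\<in>UNIV. p k * point_ad \<kappa> x m k) + point_ad \<kappa> x m i"

text \<open>This represents \<open>[\<Lambda>, X]\<close>, written with \<open>\<Lambda> = M + (3/2) \<lambda>\<^sub>c\<^sub>o\<^sub>s\<^sub>t J\<close>; all coordinates of \<open>J = Z\<^sub>1 + Z\<^sub>2 + Z\<^sub>0\<close> are \<open>- 2/3\<close>.\<close>
definition m_rate where
  "m_rate \<kappa> lc x m i = point_ad \<kappa> x m i + 3 / 2 * \<kappa> * lc * (x (i + 2) - x (i + 1))"

lemma pairing_eq: "pairing m x = 3 / 4 * (m i * (x (i + 1) + x (i + 2))
    + m (i + 1) * (x i + x (i + 2)) + m (i + 2) * (x i + x (i + 1)))"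
  unfolding pairing_def sum_index3[of _ i] index3_simps by (simp add: algebra_simps)

lemma pairing_shift: "pairing (\<lambda>i. g (i + c)) (\<lambda>i. h (i + c)) = pairing g h"
proof -
  have ix: "k + 1 + c = k + c + 1" "k + 2 + c = k + c + 2" for k :: 3 by (simp_all add: add_ac)
  show ?thesis unfolding pairing_eq[of "\<lambda>i. g (i + c)" _ 0] pairing_eq[of g h "0 + c"] ix ..
qed

lemma pairing_uminus: "pairing (\<lambda>i. g (- i)) (\<lambda>i. h (- i)) = pairing g h"
proof -
  have n: "- (1::3) = 2" "- (2::3) = 1" "- (0::3) = 0" "0 + (1::3) = 1" "0 + (2::3) = 2" by auto
  show ?thesis unfolding pairing_eq[where i=0] n by (simp add: algebra_simps)
qed

text \<open>This is \<open>\<langle>[M, X], X\<rangle> = 0\<close>, from the invariance of the trace form.\<close>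
lemma pairing_point_ad: "pairing (point_ad \<kappa> x m) x = 0"
  unfolding pairing_eq[where i=0] point_ad_def index3_simps by (simp add: field_simps)

text \<open>Invariance of the trace form again: \<open>\<langle>M, [P, X]\<rangle> = - \<langle>P, [M, X]\<rangle>\<close>.\<close>
lemma pairing_control_ad:
  "pairing m (control_ad \<kappa> p x) = (\<Sum>k\<in>UNIV. p k * point_ad \<kappa> x m k)"
  unfolding pairing_eq[where i=0] point_ad_def control_ad_def sum_index3[of _ 0] index3_simps
  by (simp add: field_simps)

text \<open>If all the ratios \<open>c\<^sub>i / x\<^sub>i\<close> were equal, then \<open>[M, X]\<close> would be a multiple of \<open>X\<close>. It is orthogonal to
\<open>X\<close> and \<open>\<langle>X, X\<rangle> \<noteq> 0\<close>, so \<open>[M, X] = 0\<close>, and \<open>M\<close> is a multiple of \<open>X\<close>. The assumption \<open>\<langle>M, X\<rangle> = 0\<close> leaves \<open>M = 0\<close>.\<close>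
lemma exists_point_ad_increasing:
  fixes x m :: "3 \<Rightarrow> real"
  assumes \<kappa>: "\<kappa> > 0" and x: "\<And>i. x i > 0" and orth: "pairing m x = 0" and m: "m k \<noteq> 0"
  shows "\<exists>i j. x j * point_ad \<kappa> x m i - x i * point_ad \<kappa> x m j > 0"
proof (rule ccontr)
  assume "\<not> ?thesis"
  then have le: "x j * point_ad \<kappa> x m i \<le> x i * point_ad \<kappa> x m j" for i j by (force simp: not_less)
  then have eq: "x j * point_ad \<kappa> x m i = x i * point_ad \<kappa> x m j" for i j
    using antisym by blast
  have pos: "pairing x x > 0"
    unfolding pairing_eq[where i=0] using x[of 0] x[of 1] x[of 2] by (simp add: add_pos_pos)
  have c0: "point_ad \<kappa> x m j = 0" for j
  proof -
    have "point_ad \<kappa> x m j * pairing x x = x j * pairing (point_ad \<kappa> x m) x"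
      unfolding pairing_eq[where i=0]
      using eq[of j 0] eq[of j 1] eq[of j 2] by simp algebra
    then show ?thesis using pos pairing_point_ad[of \<kappa> x m] by simp
  qed
  have num: "(3::3) = 0" "(4::3) = 1" by auto
  define \<eta> where "\<eta> = (m 2 + m 0) / (x 2 + x 0)"
  have x23: "x 2 + x 0 > 0" using x by (simp add: add_pos_pos)
  have M1: "m 2 + m 0 = \<eta> * (x 2 + x 0)" using x23 by (simp add: \<eta>_def)
  have "(x 1 + x 2) * (m 1 + m 0) = (x 1 + x 0) * (m 1 + m 2)"
       "(x 2 + x 0) * (m 2 + m 1) = (x 2 + x 1) * (m 2 + m 0)"
       "(x 0 + x 1) * (m 0 + m 2) = (x 0 + x 2) * (m 0 + m 1)"
    using c0[of 1] c0[of 2] c0[of 0] \<kappa> by (simp_all add: point_ad_def num)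
  then have "(x 2 + x 0) * (m 2 + m 1) = (x 2 + x 0) * (\<eta> * (x 2 + x 1))"
       "(x 2 + x 0) * (m 0 + m 1) = (x 2 + x 0) * (\<eta> * (x 0 + x 1))"
    unfolding M1 add.commute[of "m 0" "m 2"] by (auto simp: mult_ac add.commute)
  then have "m 2 + m 1 = \<eta> * (x 2 + x 1)" "m 0 + m 1 = \<eta> * (x 0 + x 1)"
    using x23 by (simp_all del: distrib_left_numeral)
  then have "m 1 = \<eta> * x 1" "m 2 = \<eta> * x 2" "m 0 = \<eta> * x 0"
    using M1 by (simp_all add: algebra_simps)
  then have m_eq: "m i = \<eta> * x i" for i using index3_cases[of i 0] by auto
  have "pairing m x = \<eta> * pairing x x"
    unfolding pairing_eq[where i=0] m_eq by (simp add: algebra_simps)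
  then have "\<eta> = 0" using orth pos by simp
  then show False using m m_eq by simp
qed

section \<open>The control on an edge of the simplex\<close>
text \<open>The next five functions belong to the edge opposite to the vertex \<open>i\<close>. For \<open>i = 1\<close> they are familiar
expressions in the half-plane coordinates, because \<open>Z\<^sub>2\<close> and \<open>Z\<^sub>0\<close> span the upper triangular matrices:
the width of the point is \<open>4 / (3 y)\<close>, \<open>edge_pos\<close> is \<open>\<surd>3 x\<close>, \<open>edge_switch\<close> is \<open>\<kappa> y \<nu>\<^sub>2\<close>, \<open>edge_slope\<close> is \<open>(3/4) \<langle>M, B\<rangle>\<close> for the
nilpotent matrix \<open>B\<close> with rows \<open>(x, - x\<^sup>2)\<close> and \<open>(1, - x)\<close>, and \<open>edge_charge\<close> is \<open>\<kappa> \<langle>M, [E, B]\<rangle>\<close>, where \<open>E\<close> is the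
matrix unit in the upper right corner. A width is a trace form with the nilpotent
matrix \<open>Z\<^sub>i\<^sub>+\<^sub>1 + Z\<^sub>i\<^sub>+\<^sub>2\<close>, which is orthogonal to the edge.\<close>
definition width :: "(3 \<Rightarrow> real) \<Rightarrow> 3 \<Rightarrow> real" where
  "width x i = x (i + 1) + x (i + 2)"

definition edge_switch where
  "edge_switch x f i = (x (i + 2) * f (i + 1) - x (i + 1) * f (i + 2)) / width x i"

definition edge_slope where
  "edge_slope x m i = (width x i * pairing m x - width m i) / (width x i)^2"

definition edge_pos where
  "edge_pos x i = (x (i + 2) - x (i + 1)) / width x i"

definition edge_charge where
  "edge_charge x m i = m (i + 1) - m (i + 2) + width m i * edge_pos x i"

lemma point_ad_add_edge:
  "point_ad \<kappa> x m (i + 1) + point_ad \<kappa> x m (i + 2)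
   = 3 * \<kappa> / 4 * (width x i * (m (i + 1) - m (i + 2)) + width m i * (x (i + 2) - x (i + 1)))"
  unfolding point_ad_def width_def index3_simps by (simp add: algebra_simps)

text \<open>The quadratic relation is \<open>det X = 1\<close>. It eliminates the terms of mixed degree, so that the control
enters the derivatives below only through \<open>p\<^sub>i\<^sub>+\<^sub>1 x\<^sub>i\<^sub>+\<^sub>1 + p\<^sub>i\<^sub>+\<^sub>2 x\<^sub>i\<^sub>+\<^sub>2\<close>, which is 1.\<close>
lemma point_ad_edge:
  assumes quad: "x i * x (i + 1) + x (i + 1) * x (i + 2) + x (i + 2) * x i = 4 / 3"
  shows "x (i + 2) * point_ad \<kappa> x m (i + 1) - x (i + 1) * point_ad \<kappa> x m (i + 2)
       = \<kappa> * (width x i * pairing m x - 2 * width m i)" (is ?A)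
    and "width x i * point_ad \<kappa> x m (i + 1) - \<kappa> * width x i * pairing m x + 2 * \<kappa> * width m i
       = x (i + 1) * (point_ad \<kappa> x m (i + 1) + point_ad \<kappa> x m (i + 2))" (is ?B)
    and "width x i * point_ad \<kappa> x m (i + 2) + \<kappa> * width x i * pairing m x - 2 * \<kappa> * width m i
       = x (i + 2) * (point_ad \<kappa> x m (i + 1) + point_ad \<kappa> x m (i + 2))" (is ?C)
proof -
  have q: "\<kappa> * width m i * (4 / 3)
      = \<kappa> * width m i * (x i * x (i + 1) + x (i + 1) * x (i + 2) + x (i + 2) * x i)"
    by (simp only: quad)
  have A: ?A
    using q unfolding point_ad_def width_def pairing_eq[of _ _ i] index3_simps
    by (simp add: field_simps)
  show ?A by (rule A)
  show ?B using A unfolding width_def by (simp add: algebra_simps)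
  show ?C using A unfolding width_def by (simp add: algebra_simps)
qed

context
  fixes i :: 3 and p x m f :: "3 \<Rightarrow> real" and \<kappa> lc :: real
  assumes pi: "p i = 0" and px: "p (i + 1) * x (i + 1) + p (i + 2) * x (i + 2) = 1"
    and quad: "x i * x (i + 1) + x (i + 1) * x (i + 2) + x (i + 2) * x i = 4 / 3"
    and w: "width x i > 0"
begin

lemma control_ad_edge:
  "control_ad \<kappa> p g (i + 1) = - \<kappa> * p (i + 2) * (g (i + 1) + g (i + 2))"
  "control_ad \<kappa> p g (i + 2) = \<kappa> * p (i + 1) * (g (i + 1) + g (i + 2))"
  using pi unfolding control_ad_def index3_simps by (simp_all add: algebra_simps)

lemma width_control_ad_edge: "width (control_ad \<kappa> p x) i = \<kappa> * width x i * (p (i + 1) - p (i + 2))"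
  unfolding width_def control_ad_edge by (simp add: algebra_simps)

text \<open>The left-hand sides of this lemma and the next two are the derivatives of \<open>edge_switch\<close>, \<open>edge_pos\<close> and
\<open>edge_slope\<close> as the quotient rule produces them.\<close>
lemma edge_switch_deriv_identity:
  assumes "p (i + 1) * f (i + 1) = 0" "p (i + 2) * f (i + 2) = 0"
  shows "((control_ad \<kappa> p x (i + 2) * f (i + 1) + x (i + 2) * f_rate \<kappa> p x m f (i + 1)
      - (control_ad \<kappa> p x (i + 1) * f (i + 2) + x (i + 1) * f_rate \<kappa> p x m f (i + 2))) * width x i
     - (x (i + 2) * f (i + 1) - x (i + 1) * f (i + 2)) * width (control_ad \<kappa> p x) i) / (width x i)^2
     = 2 * \<kappa> * width x i * edge_slope x m i"
proof -
  let ?w = "width x i" and ?h = "pairing m x"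
  have pf: "p (i + 1) * (f (i + 1) * z) = 0" "p (i + 2) * (f (i + 2) * z) = 0" for z
    using assms by auto
  have 1: "x (i + 2) * control_ad \<kappa> p x (i + 1) - x (i + 1) * control_ad \<kappa> p x (i + 2) = - \<kappa> * ?w"
  proof -
    have "x (i + 2) * control_ad \<kappa> p x (i + 1) - x (i + 1) * control_ad \<kappa> p x (i + 2)
      = - \<kappa> * ?w * (p (i + 1) * x (i + 1) + p (i + 2) * x (i + 2))"
      unfolding control_ad_edge width_def by (simp add: algebra_simps)
    then show ?thesis using px by simp
  qed
  have 2: "(control_ad \<kappa> p x (i + 2) * f (i + 1) - control_ad \<kappa> p x (i + 1) * f (i + 2)
      + x (i + 2) * control_ad \<kappa> p f (i + 1) - x (i + 1) * control_ad \<kappa> p f (i + 2)) * ?w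
     = (x (i + 2) * f (i + 1) - x (i + 1) * f (i + 2)) * width (control_ad \<kappa> p x) i"
    unfolding control_ad_edge width_control_ad_edge width_def using assms by (auto simp: algebra_simps)
  have "(control_ad \<kappa> p x (i + 2) * f (i + 1) + x (i + 2) * f_rate \<kappa> p x m f (i + 1)
      - (control_ad \<kappa> p x (i + 1) * f (i + 2) + x (i + 1) * f_rate \<kappa> p x m f (i + 2))) * ?w
     - (x (i + 2) * f (i + 1) - x (i + 1) * f (i + 2)) * width (control_ad \<kappa> p x) i
    = - ?h * (x (i + 2) * control_ad \<kappa> p x (i + 1) - x (i + 1) * control_ad \<kappa> p x (i + 2)) * ?w
      + (x (i + 2) * point_ad \<kappa> x m (i + 1) - x (i + 1) * point_ad \<kappa> x m (i + 2)) * ?w"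
    unfolding f_rate_def using 2 by (simp add: algebra_simps)
  also have "\<dots> = 2 * \<kappa> * ?w * (?w * ?h - width m i)"
    unfolding 1 point_ad_edge(1)[OF quad] by (simp add: algebra_simps)
  finally show ?thesis using w by (simp add: edge_slope_def power2_eq_square)
qed

lemma edge_pos_deriv_identity:
  "((control_ad \<kappa> p x (i + 2) - control_ad \<kappa> p x (i + 1)) * width x i
     - (x (i + 2) - x (i + 1)) * width (control_ad \<kappa> p x) i) / (width x i)^2 = 2 * \<kappa> / width x i"
proof -
  have "(control_ad \<kappa> p x (i + 2) - control_ad \<kappa> p x (i + 1)) * width x i
     - (x (i + 2) - x (i + 1)) * width (control_ad \<kappa> p x) i
    = 2 * \<kappa> * width x i * (p (i + 1) * x (i + 1) + p (i + 2) * x (i + 2))"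
    unfolding control_ad_edge width_control_ad_edge width_def by (simp add: algebra_simps)
  then show ?thesis using w px by (simp add: power2_eq_square)
qed

lemma edge_slope_deriv_identity:
  "((width (control_ad \<kappa> p x) i * pairing m x + width x i * (\<Sum>k\<in>UNIV. p k * point_ad \<kappa> x m k)
       - width (m_rate \<kappa> lc x m) i) * (width x i)^2
     - (width x i * pairing m x - width m i) * (2 * width x i * width (control_ad \<kappa> p x) i)) / ((width x i)^2)^2
     = 3 / 2 * \<kappa> * lc * edge_pos x i / width x i"
proof -
  let ?w = "width x i" and ?h = "pairing m x" and ?M = "width m i"
  let ?p = "p (i + 1)" and ?q = "p (i + 2)" and ?c = "point_ad \<kappa> x m (i + 1)" and ?d = "point_ad \<kappa> x m (i + 2)"
  have "?w * (?p * ?c + ?q * ?d) - \<kappa> * ?w * (?p - ?q) * ?h + 2 * \<kappa> * (?p - ?q) * ?M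
     = ?p * (?w * ?c - \<kappa> * ?w * ?h + 2 * \<kappa> * ?M) + ?q * (?w * ?d + \<kappa> * ?w * ?h - 2 * \<kappa> * ?M)"
    by (simp add: algebra_simps)
  also have "\<dots> = (?p * x (i + 1) + ?q * x (i + 2)) * (?c + ?d)"
    unfolding point_ad_edge(2,3)[OF quad] by (simp add: algebra_simps)
  also have "\<dots> = ?c + ?d" using px by simp
  finally have 1: "?w * (?p * ?c + ?q * ?d) - \<kappa> * ?w * (?p - ?q) * ?h + 2 * \<kappa> * (?p - ?q) * ?M = ?c + ?d" .
  have 2: "width (m_rate \<kappa> lc x m) i = ?c + ?d - 3 / 2 * \<kappa> * lc * (x (i + 2) - x (i + 1))"
    unfolding width_def m_rate_def index3_simps by (simp add: field_simps)
  have "(\<kappa> * ?w * (?p - ?q) * ?h + ?w * (?p * ?c + ?q * ?d) - width (m_rate \<kappa> lc x m) i) * ?w^2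
     - (?w * ?h - ?M) * (2 * ?w * (\<kappa> * ?w * (?p - ?q)))
    = ?w^2 * ((?w * (?p * ?c + ?q * ?d) - \<kappa> * ?w * (?p - ?q) * ?h + 2 * \<kappa> * (?p - ?q) * ?M)
        - width (m_rate \<kappa> lc x m) i)"
    by (simp add: algebra_simps power2_eq_square)
  also have "\<dots> = ?w^2 * (3 / 2 * \<kappa> * lc * (x (i + 2) - x (i + 1)))"
    unfolding 1 2 by simp
  finally have 3: "(\<kappa> * ?w * (?p - ?q) * ?h + ?w * (?p * ?c + ?q * ?d) - width (m_rate \<kappa> lc x m) i) * ?w^2
     - (?w * ?h - ?M) * (2 * ?w * (\<kappa> * ?w * (?p - ?q)))
     = ?w^2 * (3 / 2 * \<kappa> * lc * (x (i + 2) - x (i + 1)))" .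
  have s: "(\<Sum>k\<in>UNIV. p k * point_ad \<kappa> x m k) = ?p * ?c + ?q * ?d"
    unfolding sum_index3[of _ i] using pi by simp
  show ?thesis
    unfolding width_control_ad_edge s 3 edge_pos_def using w by (simp add: power2_eq_square)
qed

text \<open>The left-hand side is the derivative of \<open>edge_charge\<close> in the abnormal case, where \<open>m\<close> evolves by \<open>point_ad\<close> alone.\<close>
lemma edge_charge_deriv_identity:
  "point_ad \<kappa> x m (i + 1) - point_ad \<kappa> x m (i + 2) + width (point_ad \<kappa> x m) i * edge_pos x i
     + width m i * (2 * \<kappa> / width x i) = 2 * \<kappa> * width x i * edge_slope x m i"
proof -
  let ?c = "point_ad \<kappa> x m (i + 1)" and ?d = "point_ad \<kappa> x m (i + 2)"
  have "(?c - ?d) * width x i + (?c + ?d) * (x (i + 2) - x (i + 1))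
      = 2 * (x (i + 2) * ?c - x (i + 1) * ?d)"
    unfolding width_def by (simp add: algebra_simps)
  then have "(?c - ?d) * width x i + (?c + ?d) * (x (i + 2) - x (i + 1)) + 2 * \<kappa> * width m i
      = 2 * \<kappa> * (width x i * pairing m x - width m i)"
    unfolding point_ad_edge(1)[OF quad] by (simp add: algebra_simps)
  then have "((?c - ?d) * width x i + (?c + ?d) * (x (i + 2) - x (i + 1)) + 2 * \<kappa> * width m i) / width x i
      = 2 * \<kappa> * (width x i * pairing m x - width m i) / width x i" by simp
  then show ?thesis using w
    unfolding edge_pos_def edge_slope_def width_def[of "point_ad \<kappa> x m"]
    by (simp add: add_divide_distrib power2_eq_square mult_ac)
qed

end

section \<open>The switching system\<close>
lemma has_real_derivative_reflect:
  fixes F :: "real \<Rightarrow> real"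
  assumes "(F has_real_derivative D) (at (T - t) within {0..T})"
  shows "((\<lambda>t. F (T - t)) has_real_derivative - D) (at t within {0..T})"
proof -
  have "(\<lambda>t. T - t) ` {0..T} = {0..T}"
    by (auto simp: image_iff intro!: bexI[of _ "T - _"])
  then have "(F has_real_derivative D) (at (T - t) within (\<lambda>t. T - t) ` {0..T})" using assms by simp
  moreover have "((\<lambda>t. T - t) has_real_derivative - 1) (at t within {0..T})"
    by (auto intro!: derivative_eq_intros)
  ultimately show ?thesis
    using DERIV_image_chain[of F D "\<lambda>t. T - t" t "{0..T}" "-1"] by (simp add: o_def)
qed

text \<open>The Pontryagin system in cyclic coordinates. The \<open>p\<^sub>i\<close> are the weights of the control divided by the denominator of
the Hamiltonian, so that \<open>\<Sum>p\<^sub>i x\<^sub>i = 1\<close>; the assumption \<open>p_f\<close> says that the control maximizes. The assumption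
\<open>constraint\<close> expresses that the covector \<open>\<nu>\<close> has only two components although there are three
switching functions. The last assumption is the nontriviality condition together with the avoidance of the singular locus,
where all \<open>x\<^sub>i\<close> are equal.\<close>
locale switching_system =
  fixes T \<kappa> lc :: real and x m f p :: "real \<Rightarrow> 3 \<Rightarrow> real" and d :: 3 and N :: "real set"
  assumes T: "0 < T" and \<kappa>: "0 < \<kappa>" and d: "d \<noteq> 0" and N: "negligible N"
    and lip: "lipschitzian {0..T} (\<lambda>t. x t i)" "lipschitzian {0..T} (\<lambda>t. m t i)"
      "lipschitzian {0..T} (\<lambda>t. f t i)"
    and x_pos: "t \<in> {0..T} \<Longrightarrow> 0 < x t i"
    and f_nonneg: "t \<in> {0..T} \<Longrightarrow> 0 \<le> f t i"
    and f_min: "t \<in> {0..T} \<Longrightarrow> \<exists>i. f t i = 0"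
    and quad: "t \<in> {0..T} \<Longrightarrow> x t i * x t (i + 1) + x t (i + 1) * x t (i + 2) + x t (i + 2) * x t i = 4 / 3"
    and constraint: "t \<in> {0..T} \<Longrightarrow> pairing (f t) (x t) = - 2 * pairing (m t) (x t)"
    and p_nonneg: "t \<in> {0..T} - N \<Longrightarrow> 0 \<le> p t i"
    and p_x: "t \<in> {0..T} - N \<Longrightarrow> (\<Sum>i\<in>UNIV. p t i * x t i) = 1"
    and p_f: "t \<in> {0..T} - N \<Longrightarrow> (\<Sum>i\<in>UNIV. p t i * f t i) = 0"
    and x_deriv: "t \<in> {0..T} - N \<Longrightarrow>
      ((\<lambda>t. x t i) has_real_derivative control_ad \<kappa> (p t) (x t) i) (at t within {0..T})"
    and m_deriv: "t \<in> {0..T} - N \<Longrightarrow>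
      ((\<lambda>t. m t i) has_real_derivative m_rate \<kappa> lc (x t) (m t) i) (at t within {0..T})"
    and f_deriv: "t \<in> {0..T} - N \<Longrightarrow>
      ((\<lambda>t. f t i) has_real_derivative f_rate \<kappa> (p t) (x t) (m t) (f t) i) (at t within {0..T})"
    and periodic: "x T i = x 0 (i + d)" "m T i = m 0 (i + d)" "f T i = f 0 (i + d)"
    and nonsing: "t \<in> {0..T} \<Longrightarrow> (\<And>i. f t i = 0) \<Longrightarrow> (\<And>i. m t i = 0) \<Longrightarrow>
      lc \<noteq> 0 \<and> (\<exists>i. x t i \<noteq> x t (i + 1))"
begin

text \<open>Time reversal changes the sign of all derivatives. The reflection \<open>i \<mapsto> - i\<close> exchanges the two cyclic neighbours of
an index and changes the sign of all brackets.\<close>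
lemma reversed:
  "switching_system T \<kappa> lc (\<lambda>t i. x (T - t) (- i)) (\<lambda>t i. m (T - t) (- i))
     (\<lambda>t i. f (T - t) (- i)) (\<lambda>t i. p (T - t) (- i)) d ((\<lambda>t. T - t) ` N)"
proof -
  have control_ad: "control_ad \<kappa> (\<lambda>i. q (- i)) (\<lambda>i. g (- i)) i = - control_ad \<kappa> q g (- i)" for q g i
    unfolding control_ad_def minus_index3 by (simp add: algebra_simps)
  have cr: "point_ad \<kappa> (\<lambda>i. q (- i)) (\<lambda>i. g (- i)) i = - point_ad \<kappa> q g (- i)" for q g i
    unfolding point_ad_def minus_index3 by (simp add: algebra_simps)
  have sum_minus: "(\<Sum>i\<in>UNIV. g (- i)) = (\<Sum>i\<in>UNIV. g i)" for g :: "3 \<Rightarrow> real"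
    by (rule sum.reindex_bij_witness[of _ uminus uminus]) auto
  have md: "m_rate \<kappa> lc (\<lambda>i. q (- i)) (\<lambda>i. g (- i)) i = - m_rate \<kappa> lc q g (- i)" for q g i
    unfolding m_rate_def cr minus_index3 by (simp add: algebra_simps)
  have fd: "f_rate \<kappa> (\<lambda>i. q (- i)) (\<lambda>i. y (- i)) (\<lambda>i. n (- i)) (\<lambda>i. g (- i)) i
      = - f_rate \<kappa> q y n g (- i)" for q y n g i
    unfolding f_rate_def cr control_ad pairing_uminus
    using sum_minus[of "\<lambda>i. q i * point_ad \<kappa> y n i"] by (simp add: sum_negf algebra_simps)
  have refl: "T - t \<in> {0..T} - N" if "t \<in> {0..T} - (\<lambda>t. T - t) ` N" for t
    using that by (auto simp: image_iff)
  have refl0: "T - t \<in> {0..T}" if "t \<in> {0..T}" for t using that by auto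
  show ?thesis
  proof
    show "negligible ((\<lambda>t. T - t) ` N)"
      using N by (intro negligible_lipschitzian_image[of UNIV])
        (auto intro: lipschitzian_diff lipschitzian_const lipschitzian_id)
    show "lipschitzian {0..T} (\<lambda>t. x (T - t) (- i))" "lipschitzian {0..T} (\<lambda>t. m (T - t) (- i))"
      "lipschitzian {0..T} (\<lambda>t. f (T - t) (- i))" for i
      by (intro lipschitzian_reflect lip)+
    fix t i
    {
      assume t: "t \<in> {0..T}"
      show "0 < x (T - t) (- i)" "0 \<le> f (T - t) (- i)" using t x_pos f_nonneg by auto
      show "\<exists>i. f (T - t) (- i) = 0" using f_min[OF refl0[OF t]] by (metis minus_minus)
      show "x (T - t) (- i) * x (T - t) (- (i + 1)) + x (T - t) (- (i + 1)) * x (T - t) (- (i + 2))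
         + x (T - t) (- (i + 2)) * x (T - t) (- i) = 4 / 3"
      proof -
        have "a * c + c * b + b * a = 4 / 3 \<Longrightarrow> a * b + b * c + c * a = 4 / 3" for a b c :: real
          by (simp add: algebra_simps)
        then show ?thesis using quad[OF refl0[OF t], of "- i"] unfolding minus_index3 by blast
      qed
      show "pairing (\<lambda>i. f (T - t) (- i)) (\<lambda>i. x (T - t) (- i))
          = - 2 * pairing (\<lambda>i. m (T - t) (- i)) (\<lambda>i. x (T - t) (- i))"
        unfolding pairing_uminus using constraint[OF refl0[OF t]] .
      assume "\<And>i. f (T - t) (- i) = 0" "\<And>i. m (T - t) (- i) = 0"
      then have "lc \<noteq> 0 \<and> (\<exists>i. x (T - t) i \<noteq> x (T - t) (i + 1))"
        by (intro nonsing refl0 t) (metis minus_minus)+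
      then obtain i where "lc \<noteq> 0" "x (T - t) i \<noteq> x (T - t) (i + 1)" by blast
      then show "lc \<noteq> 0 \<and> (\<exists>i. x (T - t) (- i) \<noteq> x (T - t) (- (i + 1)))"
        by (intro conjI exI[of _ "- (i + 1)"]) (auto simp: add.commute)
    next
      assume "t \<in> {0..T} - (\<lambda>t. T - t) ` N"
      note t = refl[OF this]
      show "0 \<le> p (T - t) (- i)" using p_nonneg[OF t] .
      show "(\<Sum>i\<in>UNIV. p (T - t) (- i) * x (T - t) (- i)) = 1"
        using p_x[OF t] sum_minus[of "\<lambda>i. p (T - t) i * x (T - t) i"] by simp
      show "(\<Sum>i\<in>UNIV. p (T - t) (- i) * f (T - t) (- i)) = 0"
        using p_f[OF t] sum_minus[of "\<lambda>i. p (T - t) i * f (T - t) i"] by simp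
      show "((\<lambda>t. x (T - t) (- i)) has_real_derivative
          control_ad \<kappa> (\<lambda>i. p (T - t) (- i)) (\<lambda>i. x (T - t) (- i)) i) (at t within {0..T})"
        unfolding control_ad by (rule has_real_derivative_reflect[OF x_deriv[OF t]])
      show "((\<lambda>t. m (T - t) (- i)) has_real_derivative
          m_rate \<kappa> lc (\<lambda>i. x (T - t) (- i)) (\<lambda>i. m (T - t) (- i)) i) (at t within {0..T})"
        unfolding md by (rule has_real_derivative_reflect[OF m_deriv[OF t]])
      show "((\<lambda>t. f (T - t) (- i)) has_real_derivative f_rate \<kappa> (\<lambda>i. p (T - t) (- i))
          (\<lambda>i. x (T - t) (- i)) (\<lambda>i. m (T - t) (- i)) (\<lambda>i. f (T - t) (- i)) i) (at t within {0..T})"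
        unfolding fd by (rule has_real_derivative_reflect[OF f_deriv[OF t]])
    }
    show "x (T - T) (- i) = x (T - 0) (- (i + d))" "m (T - T) (- i) = m (T - 0) (- (i + d))"
      "f (T - T) (- i) = f (T - 0) (- (i + d))"
      using periodic[of "- (i + d)"] by simp_all
  qed (use T \<kappa> d in auto)
qed

lemma lipschitzian_point_ad: "lipschitzian {0..T} (\<lambda>t. point_ad \<kappa> (x t) (m t) i)"
  unfolding point_ad_def by (intro lipschitzian_intros lip)

lemma lipschitzian_pairing: "lipschitzian {0..T} (\<lambda>t. pairing (m t) (x t))"
  unfolding pairing_eq[where i=0] by (intro lipschitzian_intros lip)

lemma lipschitzian_width: "lipschitzian {0..T} (\<lambda>t. width (x t) i)" "lipschitzian {0..T} (\<lambda>t. width (m t) i)"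
  unfolding width_def by (intro lipschitzian_intros lip)+

lemma width_pos: "t \<in> {0..T} \<Longrightarrow> 0 < width (x t) i"
  unfolding width_def using x_pos by (simp add: add_pos_pos)

lemma lipschitzian_edge:
  "lipschitzian {0..T} (\<lambda>t. edge_switch (x t) (f t) i)"
  "lipschitzian {0..T} (\<lambda>t. edge_slope (x t) (m t) i)"
  "lipschitzian {0..T} (\<lambda>t. edge_pos (x t) i)"
  "lipschitzian {0..T} (\<lambda>t. edge_charge (x t) (m t) i)"
proof -
  show pos: "lipschitzian {0..T} (\<lambda>t. edge_pos (x t) i)"
    unfolding edge_pos_def by (intro lipschitzian_intros lip lipschitzian_width width_pos)
  show "lipschitzian {0..T} (\<lambda>t. edge_switch (x t) (f t) i)"
    unfolding edge_switch_def by (intro lipschitzian_intros lip lipschitzian_width width_pos)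
  show "lipschitzian {0..T} (\<lambda>t. edge_slope (x t) (m t) i)"
    unfolding edge_slope_def power2_eq_square
    by (intro lipschitzian_intros lip lipschitzian_width lipschitzian_pairing mult_pos_pos width_pos)
  show "lipschitzian {0..T} (\<lambda>t. edge_charge (x t) (m t) i)"
    unfolding edge_charge_def by (intro lipschitzian_intros lip lipschitzian_width pos)
qed

lemma width_deriv:
  assumes "t \<in> {0..T} - N"
  shows "((\<lambda>t. width (x t) i) has_real_derivative width (control_ad \<kappa> (p t) (x t)) i) (at t within {0..T})"
    and "((\<lambda>t. width (m t) i) has_real_derivative width (m_rate \<kappa> lc (x t) (m t)) i) (at t within {0..T})"
  unfolding width_def by (intro DERIV_add x_deriv m_deriv assms)+

lemma pairing_m_rate: "pairing (m_rate \<kappa> lc y n) y = 0"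
proof -
  have "pairing (m_rate \<kappa> lc y n) y = pairing (point_ad \<kappa> y n) y"
    unfolding pairing_eq[where i=0] m_rate_def index3_simps by (simp add: field_simps)
  then show ?thesis by (simp add: pairing_point_ad)
qed

text \<open>Only the variation of \<open>X\<close> contributes, since \<open>\<langle>[\<Lambda>, X], X\<rangle> = 0\<close>.\<close>
lemma pairing_deriv:
  assumes t: "t \<in> {0..T} - N"
  shows "((\<lambda>t. pairing (m t) (x t)) has_real_derivative
    (\<Sum>k\<in>UNIV. p t k * point_ad \<kappa> (x t) (m t) k)) (at t within {0..T})"
proof -
  have "((\<lambda>t. pairing (m t) (x t)) has_real_derivative
    (pairing (m_rate \<kappa> lc (x t) (m t)) (x t) + pairing (m t) (control_ad \<kappa> (p t) (x t)))) (at t within {0..T})"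
    unfolding pairing_eq[where i=0]
    by (rule derivative_eq_intros x_deriv[OF t] m_deriv[OF t] refl)+ (simp add: algebra_simps)
  then show ?thesis by (simp add: pairing_m_rate pairing_control_ad)
qed

text \<open>The terms \<open>p\<^sub>k f\<^sub>k\<close> are nonnegative and add up to zero, so each of them vanishes.\<close>
lemma edge_controls:
  assumes t: "t \<in> {0..T} - N" and pos: "0 < f t i"
  shows "p t i = 0" "p t (i + 1) * f t (i + 1) = 0" "p t (i + 2) * f t (i + 2) = 0"
    "p t (i + 1) * x t (i + 1) + p t (i + 2) * x t (i + 2) = 1"
proof -
  have "0 \<le> p t k * f t k" for k using p_nonneg[OF t] f_nonneg t by simp
  then have z: "p t k * f t k = 0" for k
    using p_f[OF t] by (simp add: sum_nonneg_eq_0_iff)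
  then show "p t i = 0" "p t (i + 1) * f t (i + 1) = 0" "p t (i + 2) * f t (i + 2) = 0"
    using z[of i] z[of "i + 1"] z[of "i + 2"] pos by auto
  then show "p t (i + 1) * x t (i + 1) + p t (i + 2) * x t (i + 2) = 1"
    using p_x[OF t] by (simp add: sum_index3[of _ i])
qed

lemma edge_derivs:
  assumes t: "t \<in> {0..T} - N" and pos: "0 < f t i"
  shows "((\<lambda>t. edge_switch (x t) (f t) i) has_real_derivative
      2 * \<kappa> * width (x t) i * edge_slope (x t) (m t) i) (at t within {0..T})"
    and "((\<lambda>t. edge_pos (x t) i) has_real_derivative 2 * \<kappa> / width (x t) i) (at t within {0..T})"
    and "((\<lambda>t. edge_slope (x t) (m t) i) has_real_derivative
      3 / 2 * \<kappa> * lc * edge_pos (x t) i / width (x t) i) (at t within {0..T})"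
    and "lc = 0 \<Longrightarrow> ((\<lambda>t. edge_charge (x t) (m t) i) has_real_derivative
      2 * \<kappa> * width (x t) i * edge_slope (x t) (m t) i) (at t within {0..T})"
proof -
  note e = edge_controls[OF t pos]
  have t': "t \<in> {0..T}" using t by simp
  note w = width_pos[OF t', of i] and q = quad[OF t', of i]
  note identities = edge_switch_deriv_identity[OF e(1) e(4) q w e(2,3)]
    edge_pos_deriv_identity[OF e(1) e(4) q w] edge_slope_deriv_identity[OF e(1) e(4) q w]
    edge_charge_deriv_identity[OF e(1) e(4) q w]
  have w0: "width (x t) i \<noteq> 0" using w by simp
  show "((\<lambda>t. edge_switch (x t) (f t) i) has_real_derivative
      2 * \<kappa> * width (x t) i * edge_slope (x t) (m t) i) (at t within {0..T})"
    unfolding edge_switch_def identities(1)[symmetric]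
    by (rule derivative_eq_intros x_deriv[OF t] f_deriv[OF t] width_deriv[OF t] refl w0)+
       (simp add: power2_eq_square algebra_simps)
  show pos_d: "((\<lambda>t. edge_pos (x t) i) has_real_derivative 2 * \<kappa> / width (x t) i) (at t within {0..T})"
    unfolding edge_pos_def identities(2)[symmetric]
    by (rule derivative_eq_intros x_deriv[OF t] width_deriv[OF t] refl w0
        | simp add: power2_eq_square)+
  show "((\<lambda>t. edge_slope (x t) (m t) i) has_real_derivative
      3 / 2 * \<kappa> * lc * edge_pos (x t) i / width (x t) i) (at t within {0..T})"
    unfolding identities(3)[where m = "m t" and lc = lc, symmetric]
    unfolding edge_slope_def
    by (rule derivative_eq_intros pairing_deriv[OF t] width_deriv[OF t] refl
        | simp add: w0 power2_eq_square algebra_simps)+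
  assume lc: "lc = 0"
  have md: "m_rate \<kappa> lc (x t) (m t) = point_ad \<kappa> (x t) (m t)" unfolding m_rate_def lc by simp
  show "((\<lambda>t. edge_charge (x t) (m t) i) has_real_derivative
      2 * \<kappa> * width (x t) i * edge_slope (x t) (m t) i) (at t within {0..T})"
    unfolding identities(4)[where m = "m t", symmetric] edge_charge_def
    by (rule derivative_eq_intros pos_d width_deriv[OF t] m_deriv[OF t] refl)+
       (simp add: md algebra_simps)
qed

section \<open>Motion along an edge\<close>

context
  fixes a b :: real and i :: 3
  assumes ab: "0 \<le> a" "a < b" "b \<le> T" and pos: "\<And>t. t \<in> {a<..<b} \<Longrightarrow> 0 < f t i"
begin

lemma edge_upgrade:
  assumes F: "lipschitzian {0..T} F" and g: "continuous_on {0..T} g"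
    and D: "\<And>t. t \<in> {0..T} - N \<Longrightarrow> 0 < f t i \<Longrightarrow> (F has_real_derivative g t) (at t within {0..T})"
    and t: "t \<in> {a..b}"
  shows "(F has_real_derivative g t) (at t within {a..b})"
proof (rule AE_deriv_continuous_imp_deriv[OF _ _ N _ t])
  have sub: "{a..b} \<subseteq> {0..T}" using ab by auto
  show "lipschitzian {a..b} F" "continuous_on {a..b} g"
    by (rule lipschitzian_subset[OF F sub], rule continuous_on_subset[OF g sub])
  fix s assume s: "s \<in> {a<..<b} - N"
  then have "s \<in> {0..T} - N" "0 < f s i" using sub pos by auto
  then show "(F has_real_derivative g s) (at s within {a..b})"
    using D DERIV_subset sub by blast
qed

lemma edge_derivs_everywhere:
  assumes t: "t \<in> {a..b}"
  shows "((\<lambda>t. edge_switch (x t) (f t) i) has_real_derivative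
      2 * \<kappa> * width (x t) i * edge_slope (x t) (m t) i) (at t within {a..b})"
    and "((\<lambda>t. edge_pos (x t) i) has_real_derivative 2 * \<kappa> / width (x t) i) (at t within {a..b})"
    and "((\<lambda>t. edge_slope (x t) (m t) i) has_real_derivative
      3 / 2 * \<kappa> * lc * edge_pos (x t) i / width (x t) i) (at t within {a..b})"
    and "lc = 0 \<Longrightarrow> ((\<lambda>t. edge_charge (x t) (m t) i) has_real_derivative
      2 * \<kappa> * width (x t) i * edge_slope (x t) (m t) i) (at t within {a..b})"
proof -
  note c = lipschitzian_continuous_on[OF lipschitzian_width(1)]
    lipschitzian_continuous_on[OF lipschitzian_edge(2)] lipschitzian_continuous_on[OF lipschitzian_edge(3)]
  have w: "\<forall>t\<in>{0..T}. width (x t) i \<noteq> 0" using width_pos by (metis less_irrefl)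
  have cont: "continuous_on {0..T} (\<lambda>t. 2 * \<kappa> * width (x t) i * edge_slope (x t) (m t) i)"
    "continuous_on {0..T} (\<lambda>t. 2 * \<kappa> / width (x t) i)"
    "continuous_on {0..T} (\<lambda>t. 3 / 2 * \<kappa> * lc * edge_pos (x t) i / width (x t) i)"
    by (intro continuous_intros c w)+
  show "((\<lambda>t. edge_switch (x t) (f t) i) has_real_derivative
      2 * \<kappa> * width (x t) i * edge_slope (x t) (m t) i) (at t within {a..b})"
    by (rule edge_upgrade[OF lipschitzian_edge(1) cont(1) edge_derivs(1) t])
  show "((\<lambda>t. edge_pos (x t) i) has_real_derivative 2 * \<kappa> / width (x t) i) (at t within {a..b})"
    by (rule edge_upgrade[OF lipschitzian_edge(3) cont(2) edge_derivs(2) t])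
  show "((\<lambda>t. edge_slope (x t) (m t) i) has_real_derivative
      3 / 2 * \<kappa> * lc * edge_pos (x t) i / width (x t) i) (at t within {a..b})"
    by (rule edge_upgrade[OF lipschitzian_edge(2) cont(3) edge_derivs(3) t])
  assume lc: "lc = 0"
  show "((\<lambda>t. edge_charge (x t) (m t) i) has_real_derivative
      2 * \<kappa> * width (x t) i * edge_slope (x t) (m t) i) (at t within {a..b})"
    by (rule edge_upgrade[OF lipschitzian_edge(4) cont(1) edge_derivs(4)[OF _ _ lc] t])
qed

lemma edge_first_integral:
  assumes "s \<in> {a..b}" "t \<in> {a..b}"
  shows "edge_slope (x s) (m s) i - 3 / 8 * lc * (edge_pos (x s) i)^2
       = edge_slope (x t) (m t) i - 3 / 8 * lc * (edge_pos (x t) i)^2"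
proof (rule has_field_derivative_zero_constant[THEN exE, of "{a..b}"
    "\<lambda>t. edge_slope (x t) (m t) i - 3 / 8 * lc * (edge_pos (x t) i)^2"])
  fix r assume r: "r \<in> {a..b}"
  show "((\<lambda>t. edge_slope (x t) (m t) i - 3 / 8 * lc * (edge_pos (x t) i)^2) has_real_derivative 0)
      (at r within {a..b})"
    by (rule derivative_eq_intros edge_derivs_everywhere[OF r] refl)+ (simp add: field_simps)
qed (use assms in auto)

lemma edge_pos_strict_mono:
  assumes st: "s \<in> {a..b}" "t \<in> {a..b}" "s < t"
  shows "edge_pos (x s) i < edge_pos (x t) i"
proof (rule DERIV_pos_imp_increasing_open[OF st(3)])
  fix r assume r: "s < r" "r < t"
  then have "r \<in> {a<..<b}" using st by auto
  then have "((\<lambda>t. edge_pos (x t) i) has_real_derivative 2 * \<kappa> / width (x r) i) (at r)"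
    using edge_derivs_everywhere(2)[of r] by (simp add: at_within_Icc_at)
  moreover have "2 * \<kappa> / width (x r) i > 0" using width_pos[of r] \<kappa> ab \<open>r \<in> {a<..<b}\<close> by simp
  ultimately show "\<exists>y. ((\<lambda>t. edge_pos (x t) i) has_real_derivative y) (at r) \<and> 0 < y" by blast
next
  show "continuous_on {s..t} (\<lambda>t. edge_pos (x t) i)"
    using st ab by (intro continuous_on_subset[OF lipschitzian_continuous_on[OF lipschitzian_edge(3)]]) auto
qed

lemma edge_switch_Rolle:
  assumes st: "s \<in> {a..b}" "t \<in> {a..b}" "s < t" and eq: "edge_switch (x s) (f s) i = edge_switch (x t) (f t) i"
  obtains r where "s < r" "r < t" "edge_slope (x r) (m r) i = 0"
proof -
  have "\<exists>z>s. z < t \<and> (\<lambda>h. h * (2 * \<kappa> * width (x z) i * edge_slope (x z) (m z) i)) = (\<lambda>v. 0)"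
  proof (rule Rolle_deriv[OF st(3) eq])
    show "continuous_on {s..t} (\<lambda>t. edge_switch (x t) (f t) i)"
      using st ab by (intro continuous_on_subset[OF lipschitzian_continuous_on[OF lipschitzian_edge(1)]]) auto
    fix r assume r: "s < r" "r < t"
    then have "r \<in> {a<..<b}" using st by auto
    then have "((\<lambda>t. edge_switch (x t) (f t) i) has_real_derivative
        2 * \<kappa> * width (x r) i * edge_slope (x r) (m r) i) (at r)"
      using edge_derivs_everywhere(1)[of r] by (simp add: at_within_Icc_at)
    then show "((\<lambda>t. edge_switch (x t) (f t) i) has_derivative
        (\<lambda>h. h * (2 * \<kappa> * width (x r) i * edge_slope (x r) (m r) i))) (at r)"
      by (simp add: has_field_derivative_def mult_commute_abs)
  qed
  then obtain z where z: "s < z" "z < t" "(\<lambda>h::real. h * (2 * \<kappa> * width (x z) i * edge_slope (x z) (m z) i)) = (\<lambda>v. 0)"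
    by blast
  then have "1 * (2 * \<kappa> * width (x z) i * edge_slope (x z) (m z) i) = (0::real)" by metis
  moreover have "width (x z) i > 0" using z st ab by (intro width_pos) auto
  ultimately show ?thesis using that[OF z(1,2)] \<kappa> by simp
qed

text \<open>In the normal case the first integral prescribes the square of \<open>edge_pos\<close> at the zeros of the slope, and \<open>edge_pos\<close> is injective.
In the abnormal case the slope itself is constant.\<close>
lemma edge_slope_zeros:
  "(lc = 0 \<and> (\<forall>t\<in>{a..b}. edge_slope (x t) (m t) i = 0)) \<or>
   finite {t \<in> {a..b}. edge_slope (x t) (m t) i = 0}"
proof (cases "lc = 0")
  case True
  then have eq: "edge_slope (x t) (m t) i = edge_slope (x a) (m a) i" if "t \<in> {a..b}" for t
    using edge_first_integral[OF that, of a] ab by auto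
  then show ?thesis using True
  proof (cases "edge_slope (x a) (m a) i = 0")
    case False
    then have "edge_slope (x t) (m t) i \<noteq> 0" if "t \<in> {a..b}" for t
      by (subst eq[OF that])
    then have "{t \<in> {a..b}. edge_slope (x t) (m t) i = 0} = {}" by blast
    then have "finite {t \<in> {a..b}. edge_slope (x t) (m t) i = 0}" by (simp only: finite.emptyI)
    then show ?thesis ..
  qed (use eq in metis)
next
  case False
  let ?Z = "{t \<in> {a..b}. edge_slope (x t) (m t) i = 0}" and ?\<xi> = "\<lambda>t. edge_pos (x t) i"
  define c where "c = - 8 / (3 * lc) * (edge_slope (x a) (m a) i - 3 / 8 * lc * (?\<xi> a)^2)"
  have "(?\<xi> t)^2 = c" if "t \<in> ?Z" for t
  proof -
    have "edge_slope (x a) (m a) i - 3 / 8 * lc * (?\<xi> a)^2 = - 3 / 8 * lc * (?\<xi> t)^2"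
      using edge_first_integral[of a t] that ab by simp
    then show ?thesis using False by (simp only: c_def) simp
  qed
  then have "?\<xi> t \<in> {sqrt c, - sqrt c}" if "t \<in> ?Z" for t
  proof -
    have "sqrt c = \<bar>?\<xi> t\<bar>" using \<open>\<And>t. t \<in> ?Z \<Longrightarrow> (?\<xi> t)^2 = c\<close>[OF that] real_sqrt_abs by metis
    then show ?thesis by (simp add: abs_if)
  qed
  then have "?\<xi> ` ?Z \<subseteq> {sqrt c, - sqrt c}" by blast
  then have "finite (?\<xi> ` ?Z)" by (rule finite_subset) auto
  moreover have "inj_on ?\<xi> ?Z"
  proof (rule linorder_inj_onI)
    fix s t assume "s < t" "s \<in> ?Z" "t \<in> ?Z"
    then show "?\<xi> s \<noteq> ?\<xi> t" using edge_pos_strict_mono[of s t] by auto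
  qed auto
  ultimately show ?thesis using finite_imageD by blast
qed

end

definition tie :: "real \<Rightarrow> bool" where
  "tie t \<longleftrightarrow> (\<exists>i j. i \<noteq> j \<and> f t i = 0 \<and> f t j = 0)"

text \<open>Of the two remaining switching functions one vanishes, by the maximum condition; the numerator of \<open>edge_switch\<close> then
tests whether the other one does.\<close>
lemma tie_edge:
  assumes t: "t \<in> {0..T}" and pos: "0 < f t i"
  shows "tie t \<longleftrightarrow> f t (i + 1) = 0 \<and> f t (i + 2) = 0"
    and "tie t \<longleftrightarrow> edge_switch (x t) (f t) i = 0"
proof -
  have d: "k \<noteq> j \<Longrightarrow> f t k = 0 \<Longrightarrow> f t j = 0 \<Longrightarrow> f t (i + 1) = 0 \<and> f t (i + 2) = 0" for j k
    using index3_cases[of j i] index3_cases[of k i] pos by auto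
  show 1: "tie t \<longleftrightarrow> f t (i + 1) = 0 \<and> f t (i + 2) = 0"
    unfolding tie_def using d by (metis index3_distinct(3))
  obtain k where k: "f t k = 0" using f_min[OF t] by blast
  then have "k = i + 1 \<or> k = i + 2" using index3_cases[of k i] pos by auto
  then show "tie t \<longleftrightarrow> edge_switch (x t) (f t) i = 0"
    using k x_pos[OF t, of "i + 1"] x_pos[OF t, of "i + 2"] width_pos[OF t, of i]
    unfolding 1 edge_switch_def by auto
qed

section \<open>Abnormal edges\<close>

text \<open>At a tie the matrix \<open>\<Omega>\<close> of the switching functions is orthogonal to the edge, hence determined by one number, which the
constraint expresses through \<open>M\<close>.\<close>
lemma width_f_edge:
  assumes t: "t \<in> {0..T}" and "f t (i + 1) = 0" "f t (i + 2) = 0" "edge_slope (x t) (m t) i = 0"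
  shows "f t i * (width (x t) i)^2 = - 8 / 3 * width (m t) i"
proof -
  have w: "width (x t) i > 0" by (rule width_pos[OF t])
  have "3 / 4 * f t i * width (x t) i = - 2 * pairing (m t) (x t)"
    using constraint[OF t] assms unfolding pairing_eq[of "f t" _ i] by (simp add: width_def)
  moreover have "width (x t) i * pairing (m t) (x t) = width (m t) i"
    using assms(4) w by (simp add: edge_slope_def)
  ultimately have "3 / 4 * f t i * width (x t) i * width (x t) i = - 2 * width (m t) i"
    by (simp add: algebra_simps)
  then show ?thesis by (simp add: power2_eq_square)
qed

text \<open>As long as \<open>f\<^sub>i > 0\<close>, the arc consists of ties, the slope remains zero and the charge is conserved, and by \<open>width_f_edge\<close> the sign of \<open>f\<^sub>i\<close> is opposite to
the sign of the width of \<open>m\<close>. The derivative of that width has the sign of the charge, so a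
nonpositive charge keeps the width of \<open>m\<close> below its negative initial value, and \<open>f\<^sub>i\<close> cannot reach zero.\<close>
lemma abnormal_edge_persists:
  assumes s: "s \<in> {0..T}" and lc: "lc = 0" and pos: "0 < f s i" and tie: "tie s"
    and slope: "edge_slope (x s) (m s) i = 0" and charge: "edge_charge (x s) (m s) i \<le> 0"
    and t: "t \<in> {s..T}"
  shows "0 < f t i \<and> tie t \<and> edge_slope (x t) (m t) i = 0 \<and> edge_charge (x t) (m t) i \<le> 0"
proof -
  have cont: "continuous_on {s..T} (\<lambda>t. f t i)"
    using s by (intro continuous_on_subset[OF lipschitzian_continuous_on[OF lip(3)]]) auto
  \<comment> \<open>The conclusion at the end point \<open>r\<close> uses positivity of \<open>f\<^sub>i\<close> only before \<open>r\<close>; this makes a first zero impossible.\<close>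
  have step: "0 < f r i \<and> tie r \<and> edge_slope (x r) (m r) i = 0 \<and> edge_charge (x r) (m r) i \<le> 0"
    if r: "r \<in> {s<..T}" and fpos: "\<And>q. q \<in> {s<..<r} \<Longrightarrow> 0 < f q i" for r
  proof -
    have sr: "0 \<le> s" "s < r" "r \<le> T" using s r by auto
    have rT: "r \<in> {0..T}" using sr by auto
    have sl: "edge_slope (x q) (m q) i = 0" if q: "q \<in> {s..r}" for q
      using edge_first_integral[OF sr fpos q, of s] slope lc sr by auto
    have const: "F q = F s"
      if "\<And>q. q \<in> {s..r} \<Longrightarrow> (F has_real_derivative
        2 * \<kappa> * width (x q) i * edge_slope (x q) (m q) i) (at q within {s..r})" "q \<in> {s..r}" for F q
    proof -
      have "(F has_real_derivative 0) (at q within {s..r})" if "q \<in> {s..r}" for q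
        using \<open>\<And>q. q \<in> {s..r} \<Longrightarrow> (F has_real_derivative _) _\<close>[OF that] sl[OF that] by simp
      then obtain c where "\<And>q. q \<in> {s..r} \<Longrightarrow> F q = c"
        using has_field_derivative_zero_constant[of "{s..r}" F] by auto
      then show ?thesis using that(2) sr by auto
    qed
    have sw: "edge_switch (x q) (f q) i = 0" if "q \<in> {s..r}" for q
      using const[OF edge_derivs_everywhere(1)[OF sr fpos] that] tie_edge(2)[OF s pos] tie by auto
    have rh: "edge_charge (x q) (m q) i \<le> 0" if "q \<in> {s..r}" for q
      using const[OF edge_derivs_everywhere(4)[OF sr fpos _ lc] that] charge by auto
    have fq: "f q (i + 1) = 0 \<and> f q (i + 2) = 0" if "q \<in> {s<..<r}" for q
      using that sr sw[of q] tie_edge[of q i] fpos[OF that] by auto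
    have cl: "closure {s<..<r} = {s..r}" using sr by simp
    \<comment> \<open>At \<open>r\<close> itself the sign of \<open>f\<^sub>i\<close> is not yet known, so this is a limit of earlier ties.\<close>
    have fz: "f r k = 0" if "k = i + 1 \<or> k = i + 2" for k
    proof (rule continuous_constant_on_closure[of "{s<..<r}" "\<lambda>t. f t k"])
      show "continuous_on (closure {s<..<r}) (\<lambda>t. f t k)"
        unfolding cl using sr by (intro continuous_on_subset[OF lipschitzian_continuous_on[OF lip(3)]]) auto
    qed (use fq that cl sr in auto)
    have "- width (m s) i \<le> - width (m r) i"
    proof (rule AE_deriv_nonneg_imp_le[OF _ _ N, where f = "\<lambda>t. - width (m t) i"])
      show "lipschitzian {s..r} (\<lambda>t. - width (m t) i)"
        using sr by (intro lipschitzian_subset[OF lipschitzian_minus[OF lipschitzian_width(2)]]) auto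
      fix q assume q: "q \<in> {s<..<r} - N"
      then have q': "q \<in> {0..T} - N" using sr by auto
      have "width (x q) i * edge_charge (x q) (m q) i
          = width (x q) i * (m q (i + 1) - m q (i + 2)) + width (m q) i * (x q (i + 2) - x q (i + 1))"
        using width_pos[of q i] q' by (simp add: edge_charge_def edge_pos_def distrib_left)
      moreover have md: "m_rate \<kappa> lc (x q) (m q) = point_ad \<kappa> (x q) (m q)"
        by (simp add: m_rate_def lc fun_eq_iff)
      ultimately have "width (m_rate \<kappa> lc (x q) (m q)) i = 3 * \<kappa> / 4 * (width (x q) i * edge_charge (x q) (m q) i)"
        using point_ad_add_edge[of \<kappa> "x q" "m q" i]
        unfolding md width_def[of "point_ad \<kappa> (x q) (m q)"] by simp
      also have "\<dots> \<le> 0" using rh[of q] q width_pos[of q i] \<kappa> q'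
        by (intro mult_nonneg_nonpos) auto
      finally show "\<exists>D\<ge>0. ((\<lambda>t. - width (m t) i) has_real_derivative D) (at q within {s..r})"
        using width_deriv(2)[OF q', of i] sr
        by (intro exI[of _ "- width (m_rate \<kappa> lc (x q) (m q)) i"] conjI DERIV_minus)
           (auto intro: DERIV_subset)
    qed (use sr in auto)
    moreover have "width (m s) i < 0"
    proof -
      have "0 < f s i * (width (x s) i)^2" using pos width_pos[OF s, of i] by simp
      also have "\<dots> = - 8 / 3 * width (m s) i"
        using width_f_edge[OF s _ _ slope] tie_edge(1)[OF s pos] tie by auto
      finally show ?thesis by simp
    qed
    ultimately have "f r i * (width (x r) i)^2 > 0" using width_f_edge[OF rT _ _ sl[of r]] fz sr by simp
    then have "f r i > 0" using f_nonneg[OF rT, of i] by (cases "f r i = 0") auto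
    then show ?thesis using fz tie_edge(1)[OF rT] sl[of r] rh[of r] sr by auto
  qed
  have "0 < f r i" if r: "r \<in> {s..T}" for r
  proof (rule ccontr)
    assume "\<not> 0 < f r i"
    then have fr: "f r i \<le> 0" by simp
    define S where "S = {q \<in> {s..r}. f q i \<le> 0}"
    have "S = {s..r} \<inter> (\<lambda>t. f t i) -` {..0}" by (auto simp: S_def)
    then have "closed S" using continuous_closed_preimage[OF continuous_on_subset[OF cont, of "{s..r}"]] r by auto
    moreover have "r \<in> S" using fr r by (auto simp: S_def)
    moreover have bdd: "bdd_below S" by (rule bdd_belowI[of _ s]) (auto simp: S_def)
    ultimately have S: "Inf S \<in> S" using closed_contains_Inf by blast
    have "Inf S \<noteq> s" using S pos by (auto simp: S_def)
    moreover have "Inf S \<in> {s..r}" using S by (auto simp: S_def)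
    ultimately have I: "Inf S \<in> {s<..T}" "Inf S \<le> r" using r by auto
    have "0 < f q i" if q: "q \<in> {s<..<Inf S}" for q
    proof (rule ccontr)
      assume "\<not> 0 < f q i"
      then have "q \<in> S" using q I by (auto simp: S_def)
      then show False using cInf_lower[OF _ bdd, of q] q by auto
    qed
    then have "0 < f (Inf S) i" using step[OF I(1)] by blast
    then show False using S by (auto simp: S_def)
  qed
  then show ?thesis using step[of t] t pos tie slope charge by (cases "t = s") auto
qed

end

context switching_system
begin

text \<open>The arc persists up to \<open>T\<close>, reappears at time \<open>0\<close> with index \<open>i + d\<close> by periodicity, and persists from there up to \<open>t\<close>. So
\<open>f\<^sub>i\<^sub>+\<^sub>d\<close> is positive at \<open>t\<close>, where the tie only leaves \<open>f\<^sub>i\<close> positive.\<close>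
lemma no_abnormal_edge_nonpos:
  assumes t: "t \<in> {0..T}" and lc: "lc = 0" and pos: "0 < f t i" and tie: "tie t"
    and slope: "edge_slope (x t) (m t) i = 0" and charge: "edge_charge (x t) (m t) i \<le> 0"
  shows False
proof -
  have T0: "T \<in> {t..T}" "0 \<in> {0..T}" "T \<in> {0..T}" using t T by auto
  note pT = abnormal_edge_persists[OF t lc pos tie slope charge T0(1)]
  have ends: "x T = (\<lambda>k. x 0 (k + d))" "m T = (\<lambda>k. m 0 (k + d))" "f T = (\<lambda>k. f 0 (k + d))"
    using periodic by auto
  have ix: "k + 1 + d = k + d + 1" "k + 2 + d = k + d + 2" for k by (simp_all add: add_ac)
  have w: "width (\<lambda>k. g (k + d)) i = width g (i + d)" for g unfolding width_def ix by simp
  have e: "edge_slope (x T) (m T) i = edge_slope (x 0) (m 0) (i + d)"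
    "edge_charge (x T) (m T) i = edge_charge (x 0) (m 0) (i + d)"
    unfolding ends edge_slope_def edge_charge_def edge_pos_def w pairing_shift ix by simp_all
  have "tie 0" using pT unfolding tie_def ends
    by (metis add_right_cancel)
  then have "0 < f t (i + d)"
    using abnormal_edge_persists[OF T0(2) lc, of "i + d" t] pT t periodic(3)[of i] e by simp
  moreover have "f t (i + d) = 0"
    using tie tie_edge(1)[OF t pos] index3_cases[of "i + d" i] d by auto
  ultimately show False by simp
qed

end

text \<open>Reversal turns a positive charge into a negative one.\<close>
lemma (in switching_system) no_abnormal_edge:
  assumes t: "t \<in> {0..T}" and lc: "lc = 0" and pos: "0 < f t i" and tie: "tie t"
    and slope: "edge_slope (x t) (m t) i = 0"
  shows False
proof (cases "edge_charge (x t) (m t) i \<le> 0")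
  case True then show False using no_abnormal_edge_nonpos assms by blast
next
  case False
  interpret rev: switching_system T \<kappa> lc "\<lambda>t i. x (T - t) (- i)" "\<lambda>t i. m (T - t) (- i)"
    "\<lambda>t i. f (T - t) (- i)" "\<lambda>t i. p (T - t) (- i)" d "(\<lambda>t. T - t) ` N"
    by (rule reversed)
  have ix: "- (- i + 1) = i + 2" "- (- i + 2) = i + 1" unfolding minus_index3 by simp_all
  have w: "width (\<lambda>i. g (- i)) (- i) = width g i" for g
    unfolding width_def ix by simp
  have "rev.tie (T - t)" using tie unfolding tie_def rev.tie_def by simp (metis minus_minus)
  moreover have "edge_slope (\<lambda>i. x (T - (T - t)) (- i)) (\<lambda>i. m (T - (T - t)) (- i)) (- i) = 0"
    using slope unfolding edge_slope_def w pairing_uminus by simp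
  moreover have "edge_charge (\<lambda>i. x (T - (T - t)) (- i)) (\<lambda>i. m (T - (T - t)) (- i)) (- i)
      = - edge_charge (x t) (m t) i"
    unfolding edge_charge_def edge_pos_def w ix by (simp add: algebra_simps diff_divide_distrib)
  ultimately show False
    using rev.no_abnormal_edge_nonpos[of "T - t" "- i"] t lc pos False by auto
qed

section \<open>Ties are isolated\<close>

context switching_system
begin

text \<open>Near \<open>a\<close> the slope has no zeros, except in the abnormal case. By Rolle's theorem two ties enclose such a zero, so at most one tie
is that close to \<open>a\<close>.\<close>
lemma edge_ties_isolated:
  assumes ab: "0 \<le> a" "a < b" "b \<le> T" and pos: "\<And>t. t \<in> {a<..<b} \<Longrightarrow> 0 < f t i"
  shows "\<exists>e>0. \<forall>t\<in>{a<..<a + e}. t < b \<longrightarrow> \<not> tie t"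
proof (cases "finite {t \<in> {a..b}. edge_slope (x t) (m t) i = 0}")
  case True
  then have "finite ({t \<in> {a..b}. edge_slope (x t) (m t) i = 0} - {a})" by simp
  then obtain e where e: "e > 0" "\<And>t. t \<in> {t \<in> {a..b}. edge_slope (x t) (m t) i = 0} - {a} \<Longrightarrow> e \<le> dist a t"
    using finite_set_avoid[of "{t \<in> {a..b}. edge_slope (x t) (m t) i = 0} - {a}" a] by blast
  have unique: False if "s \<in> {a<..<a + e}" "t \<in> {a<..<a + e}" "s < t" "t < b" "tie s" "tie t" for s t
  proof -
    note st = that
    have mem: "s \<in> {a..b}" "t \<in> {a..b}" using st by auto
    have "edge_switch (x q) (f q) i = 0" if q: "q \<in> {a<..<b}" "tie q" for q
      using q tie_edge(2)[of q i] pos[of q] ab by auto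
    then have eq: "edge_switch (x s) (f s) i = edge_switch (x t) (f t) i" using st by auto
    obtain r where "s < r" "r < t" "edge_slope (x r) (m r) i = 0"
      by (rule edge_switch_Rolle[OF ab pos mem \<open>s < t\<close> eq])
    then show False using e(2)[of r] that by (auto simp: dist_real_def)
  qed
  show ?thesis
  proof (cases "\<exists>s\<in>{a<..<a + e}. s < b \<and> tie s")
    case True
    then obtain s where s: "s \<in> {a<..<a + e}" "s < b" "tie s" by blast
    show ?thesis
    proof (intro exI[of _ "s - a"] conjI ballI impI notI)
      fix t assume "t \<in> {a<..<a + (s - a)}" "t < b" "tie t"
      then show False using unique[of t s] s by auto
    qed (use s in auto)
  qed (use e in auto)
next
  case False
  then have lc: "lc = 0" and z: "\<forall>t\<in>{a..b}. edge_slope (x t) (m t) i = 0"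
    using edge_slope_zeros[OF ab pos] False by blast+
  have "\<not> tie t" if "t \<in> {a<..<b}" for t
    using no_abnormal_edge[of t i] that lc z pos[OF that] ab by auto
  then show ?thesis using ab by (intro exI[of _ "b - a"]) auto
qed

lemma uniform_bound:
  obtains K where "K \<ge> 1" "\<And>t i. t \<in> {0..T} \<Longrightarrow> x t i \<le> K" "\<And>t i. t \<in> {0..T} - N \<Longrightarrow> p t i \<le> K"
proof -
  have "\<exists>K\<ge>0. \<forall>t\<in>{0..T}. x t i \<le> K \<and> 1 / x t i \<le> K" for i
  proof -
    obtain K where K: "K \<ge> 0" "\<And>t. t \<in> {0..T} \<Longrightarrow> \<bar>x t i\<bar> \<le> K" using lipschitzian_bounded[OF lip(1)] by blast
    have "lipschitzian {0..T} (\<lambda>t. 1 / x t i)" by (intro lipschitzian_intros lip x_pos)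
    then obtain K' where K': "K' \<ge> 0" "\<And>t. t \<in> {0..T} \<Longrightarrow> \<bar>1 / x t i\<bar> \<le> K'"
      using lipschitzian_bounded by blast
    have "x t i \<le> K + K' \<and> 1 / x t i \<le> K + K'" if "t \<in> {0..T}" for t
      using K(2)[OF that] K'(2)[OF that] K(1) K'(1) by linarith
    then show ?thesis using K(1) K'(1) by (intro exI[of _ "K + K'"]) auto
  qed
  then obtain B where B: "\<And>i. B i \<ge> 0" "\<And>i t. t \<in> {0..T} \<Longrightarrow> x t i \<le> B i \<and> 1 / x t i \<le> B i" by metis
  define K where "K = 1 + (\<Sum>i\<in>UNIV. B i)"
  have BK: "B i \<le> K" for i
    using member_le_sum[of i UNIV B] B(1) by (simp add: K_def)
  show ?thesis
  proof
    show "K \<ge> 1" using B(1) by (simp add: K_def sum_nonneg)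
    show "t \<in> {0..T} \<Longrightarrow> x t i \<le> K" for t i using B(2) BK order_trans by blast
    fix t i assume t: "t \<in> {0..T} - N"
    have "p t i * x t i \<le> (\<Sum>i\<in>UNIV. p t i * x t i)"
      using p_nonneg[OF t] x_pos t by (intro member_le_sum mult_nonneg_nonneg) (auto intro: less_imp_le)
    then have "p t i * x t i \<le> 1" using p_x[OF t] by simp
    then have "p t i \<le> 1 / x t i" using x_pos[of t i] t by (simp add: field_simps)
    then show "p t i \<le> K" using B(2)[of t i] BK[of i] t by auto
  qed
qed

text \<open>In \<open>x\<^sub>j f\<^sub>i - x\<^sub>i f\<^sub>j\<close> the term \<open>x\<^sub>i (\<Sum>k. p\<^sub>k c\<^sub>k)\<close> of the derivatives cancels. All other terms that involve the control
contain a switching function or the drift \<open>\<langle>M, X\<rangle>\<close>, which by \<open>constraint\<close> is a combination of switching functions as well. So the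
derivative is known up to a multiple of the size of \<open>f\<close>, uniformly in the control.\<close>
lemma switch_deriv_bounds:
  obtains C where "C \<ge> 0"
    "\<And>t i j e. t \<in> {0..T} - N \<Longrightarrow> (\<And>k. f t k \<le> e) \<Longrightarrow>
      \<exists>D \<ge> x t j * point_ad \<kappa> (x t) (m t) i - x t i * point_ad \<kappa> (x t) (m t) j - C * e.
        ((\<lambda>t. x t j * f t i - x t i * f t j) has_real_derivative D) (at t within {0..T})"
    "\<And>t i e c. t \<in> {0..T} - N \<Longrightarrow> (\<And>k. f t k \<le> e) \<Longrightarrow> (\<And>k. \<bar>point_ad \<kappa> (x t) (m t) k\<bar> \<le> c) \<Longrightarrow>
      \<bar>f_rate \<kappa> (p t) (x t) (m t) (f t) i\<bar> \<le> C * (e + c)"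
proof -
  obtain K where K: "K \<ge> 1" "\<And>t i. t \<in> {0..T} \<Longrightarrow> x t i \<le> K" "\<And>t i. t \<in> {0..T} - N \<Longrightarrow> p t i \<le> K"
    using uniform_bound by blast
  have K0: "K \<ge> 0" using K by simp
  have rot_le: "\<bar>control_ad \<kappa> (p t) g i\<bar> \<le> 4 * \<kappa> * K * e"
    if t: "t \<in> {0..T} - N" and g: "\<And>k. 0 \<le> g k" "\<And>k. g k \<le> e" for t g i e
  proof -
    have 1: "0 \<le> p t k * (g i + g l)" "p t k * (g i + g l) \<le> K * (2 * e)" for k l
    proof -
      have "0 \<le> g i + g l" "g i + g l \<le> 2 * e" using g(1)[of i] g(1)[of l] g(2)[of i] g(2)[of l] by auto
      then show "0 \<le> p t k * (g i + g l)" "p t k * (g i + g l) \<le> K * (2 * e)"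
        using p_nonneg[OF t, of k] K(3)[OF t, of k] K0 by (auto intro!: mult_mono)
    qed
    have "\<bar>p t (i + 2) * (g i + g (i + 2)) - p t (i + 1) * (g i + g (i + 1))\<bar> \<le> 4 * K * e"
      using 1[of "i + 2" "i + 2"] 1[of "i + 1" "i + 1"] by linarith
    then have "\<kappa> * \<bar>p t (i + 2) * (g i + g (i + 2)) - p t (i + 1) * (g i + g (i + 1))\<bar> \<le> \<kappa> * (4 * K * e)"
      using \<kappa> by (intro mult_left_mono) auto
    then show ?thesis using \<kappa> by (simp add: control_ad_def abs_mult mult_ac)
  qed
  have pair_le: "\<bar>pairing (m t) (x t)\<bar> \<le> 3 * K * e"
    if t: "t \<in> {0..T}" and e: "\<And>k. f t k \<le> e" for t e
  proof -
    have 1: "0 \<le> f t i * (x t k + x t l)" "f t i * (x t k + x t l) \<le> e * (2 * K)" for i k l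
    proof -
      have "0 \<le> x t k + x t l" "x t k + x t l \<le> 2 * K"
        using x_pos[OF t, of k] x_pos[OF t, of l] K(2)[OF t, of k] K(2)[OF t, of l] by auto
      then show "0 \<le> f t i * (x t k + x t l)" "f t i * (x t k + x t l) \<le> e * (2 * K)"
        using f_nonneg[OF t, of i] e[of i] by (auto intro!: mult_mono)
    qed
    have "0 \<le> pairing (f t) (x t) \<and> pairing (f t) (x t) \<le> 3 / 4 * (3 * (e * (2 * K)))"
      unfolding pairing_eq[where i=0]
      using 1[of 0 "0 + 1" "0 + 2"] 1[of "0 + 1" 0 "0 + 2"] 1[of "0 + 2" 0 "0 + 1"] by argo
    moreover have "0 \<le> e * K" using order_trans[OF f_nonneg[OF t] e] K0 by (rule mult_nonneg_nonneg)
    moreover have "6 * K * e = 6 * (e * K)" "3 / 4 * (3 * (e * (2 * K))) = 9 / 2 * (e * K)" by simp_all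
    ultimately have "0 \<le> pairing (f t) (x t) \<and> pairing (f t) (x t) \<le> 6 * K * e"
      by linarith
    then show ?thesis using constraint[OF t] by linarith
  qed
  have e0: "0 \<le> e" if "t \<in> {0..T}" "\<And>k. f t k \<le> e" for t e
    using f_nonneg[OF that(1)] that(2) order_trans by blast
  \<comment> \<open>The constants collect the bounds of the individual terms of the two derivatives.\<close>
  define A where "A = 2 * K * (4 * \<kappa> * K) + 2 * K * (3 * K * (4 * \<kappa> * K * K)) + 2 * (4 * \<kappa> * K * K)"
  define B where "B = 4 * \<kappa> * K + 3 * K * (4 * \<kappa> * K * K) + 3 * K * K + 1"
  have AB: "A \<ge> 0" "B \<ge> 0" using K0 \<kappa> by (auto simp: A_def B_def)
  show ?thesis
  proof (rule that[of "A + B"])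
    show "A + B \<ge> 0" using AB by simp
  next
    fix t i j e assume t: "t \<in> {0..T} - N" and e: "\<And>k. f t k \<le> e"
    have t': "t \<in> {0..T}" using t by simp
    note xp = less_imp_le[OF x_pos[OF t']] and fn = f_nonneg[OF t'] and xK = K(2)[OF t'] and ee = e0[OF t' e]
    let ?h = "pairing (m t) (x t)"
    let ?r = "\<lambda>i. control_ad \<kappa> (p t) (f t) i" and ?q = "\<lambda>i. control_ad \<kappa> (p t) (x t) i"
    have r: "\<bar>?r k\<bar> \<le> 4 * \<kappa> * K * e" for k by (rule rot_le[OF t fn e])
    have q: "\<bar>?q k\<bar> \<le> 4 * \<kappa> * K * K" for k by (rule rot_le[OF t xp xK])
    have h: "\<bar>?h\<bar> \<le> 3 * K * e" by (rule pair_le[OF t' e])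
    define D where "D = x t j * f_rate \<kappa> (p t) (x t) (m t) (f t) i + ?q j * f t i
        - (x t i * f_rate \<kappa> (p t) (x t) (m t) (f t) j + ?q i * f t j)"
    have D: "((\<lambda>t. x t j * f t i - x t i * f t j) has_real_derivative D) (at t within {0..T})"
      unfolding D_def
      by (rule derivative_eq_intros x_deriv[OF t] f_deriv[OF t] refl)+ (simp add: algebra_simps)
    have D_eq: "D = x t j * point_ad \<kappa> (x t) (m t) i - x t i * point_ad \<kappa> (x t) (m t) j
        + (x t j * ?r i - x t i * ?r j - x t j * (?h * ?q i) + x t i * (?h * ?q j) + ?q j * f t i - ?q i * f t j)"
      unfolding D_def f_rate_def by (simp add: algebra_simps)
    have b1: "\<bar>x t k * ?r l\<bar> \<le> K * (4 * \<kappa> * K * e)" for k l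
      unfolding abs_mult using xp[of k] xK[of k] r[of l] K0 by (intro mult_mono) auto
    have b2: "\<bar>x t k * (?h * ?q l)\<bar> \<le> K * (3 * K * e * (4 * \<kappa> * K * K))" for k l
      unfolding abs_mult using xp[of k] xK[of k] q[of l] h K0 ee by (intro mult_mono mult_nonneg_nonneg) auto
    have b3: "\<bar>?q l * f t k\<bar> \<le> 4 * \<kappa> * K * K * e" for k l
      unfolding abs_mult using q[of l] fn[of k] e[of k] K0 \<kappa> by (intro mult_mono) auto
    have "x t j * ?r i - x t i * ?r j - x t j * (?h * ?q i) + x t i * (?h * ?q j) + ?q j * f t i - ?q i * f t j
       \<ge> - (A * e)"
      using b1[of j i] b1[of i j] b2[of j i] b2[of i j] b3[of j i] b3[of i j]
      unfolding A_def by (simp add: algebra_simps)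
    moreover have "A * e \<le> (A + B) * e" using AB ee by (simp add: mult_right_mono)
    ultimately show "\<exists>D \<ge> x t j * point_ad \<kappa> (x t) (m t) i - x t i * point_ad \<kappa> (x t) (m t) j - (A + B) * e.
        ((\<lambda>t. x t j * f t i - x t i * f t j) has_real_derivative D) (at t within {0..T})"
      using D by (intro exI[of _ D]) (auto simp: D_eq)
  next
    fix t i e c assume t: "t \<in> {0..T} - N" and e: "\<And>k. f t k \<le> e"
      and c: "\<And>k. \<bar>point_ad \<kappa> (x t) (m t) k\<bar> \<le> c"
    have t': "t \<in> {0..T}" using t by simp
    note xp = less_imp_le[OF x_pos[OF t']] and fn = f_nonneg[OF t'] and xK = K(2)[OF t'] and ee = e0[OF t' e]
    have cc: "0 \<le> c" using c[of 0] by linarith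
    let ?S = "\<Sum>k\<in>UNIV. p t k * point_ad \<kappa> (x t) (m t) k" and ?h = "pairing (m t) (x t)"
    have r: "\<bar>control_ad \<kappa> (p t) (f t) i\<bar> \<le> 4 * \<kappa> * K * e" by (rule rot_le[OF t fn e])
    have q: "\<bar>control_ad \<kappa> (p t) (x t) i\<bar> \<le> 4 * \<kappa> * K * K" by (rule rot_le[OF t xp xK])
    have h: "\<bar>?h\<bar> \<le> 3 * K * e" by (rule pair_le[OF t' e])
    have hq: "\<bar>?h * control_ad \<kappa> (p t) (x t) i\<bar> \<le> 3 * K * e * (4 * \<kappa> * K * K)"
      unfolding abs_mult using q h K0 ee by (intro mult_mono) auto
    have "\<bar>p t k * point_ad \<kappa> (x t) (m t) k\<bar> \<le> K * c" for k
      unfolding abs_mult using p_nonneg[OF t, of k] K(3)[OF t, of k] c[of k] K0 by (intro mult_mono) auto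
    then have "(\<Sum>k\<in>UNIV. \<bar>p t k * point_ad \<kappa> (x t) (m t) k\<bar>) \<le> of_nat (card (UNIV :: 3 set)) * (K * c)"
      by (intro sum_bounded_above)
    then have "\<bar>?S\<bar> \<le> 3 * (K * c)"
      by (intro order_trans[OF sum_abs]) (simp del: abs_mult)
    then have S: "\<bar>x t i * ?S\<bar> \<le> K * (3 * (K * c))"
      unfolding abs_mult using xp[of i] xK[of i] K0 by (intro mult_mono) auto
    have "\<bar>f_rate \<kappa> (p t) (x t) (m t) (f t) i\<bar>
        \<le> 4 * \<kappa> * K * e + 3 * K * e * (4 * \<kappa> * K * K) + K * (3 * (K * c)) + c"
      unfolding f_rate_def using r hq S c[of i] by linarith
    also have "\<dots> \<le> B * (e + c)"
    proof -
      have "0 \<le> (3 * K * K + 1) * e" "0 \<le> (4 * \<kappa> * K + 3 * K * (4 * \<kappa> * K * K)) * c"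
        using ee cc K0 \<kappa> by auto
      then show ?thesis unfolding B_def by (simp add: algebra_simps)
    qed
    also have "\<dots> \<le> (A + B) * (e + c)" using AB ee cc by (intro mult_right_mono) auto
    finally show "\<bar>f_rate \<kappa> (p t) (x t) (m t) (f t) i\<bar> \<le> (A + B) * (e + c)" .
  qed
qed

text \<open>For a suitable pair \<open>i\<close>, \<open>j\<close> the function \<open>x\<^sub>j f\<^sub>i - x\<^sub>i f\<^sub>j\<close> is strictly increasing right after \<open>t\<^sub>0\<close>, which makes \<open>f\<^sub>i\<close> positive.
Its derivative is \<open>w\<close> up to a multiple of the size of \<open>f\<close>. If \<open>M \<noteq> 0\<close> at \<open>t\<^sub>0\<close>, then \<open>w\<close> is positive at \<open>t\<^sub>0\<close> while \<open>f\<close> is small.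
If \<open>M = 0\<close> at \<open>t\<^sub>0\<close>, then \<open>w\<close> grows linearly in \<open>t - t\<^sub>0\<close>, with slope given by the derivative of \<open>M\<close>, while \<open>f\<close>
is only quadratic.\<close>
lemma triple_zero_right:
  assumes t0: "t0 \<in> {0..<T}" and z: "\<And>i. f t0 i = 0"
  shows "\<exists>i b. t0 < b \<and> b \<le> T \<and> (\<forall>t\<in>{t0<..<b}. 0 < f t i)"
proof -
  have t0': "t0 \<in> {0..T}" using t0 by auto
  define w where "w = (\<lambda>i j t. x t j * point_ad \<kappa> (x t) (m t) i - x t i * point_ad \<kappa> (x t) (m t) j)"
  have w_lip: "lipschitzian {0..T} (w i j)" for i j
    unfolding w_def by (intro lipschitzian_intros lip lipschitzian_point_ad)
  obtain C where C: "C \<ge> 0"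
    "\<And>t i j e. t \<in> {0..T} - N \<Longrightarrow> (\<And>k. f t k \<le> e) \<Longrightarrow>
      \<exists>D \<ge> w i j t - C * e.
        ((\<lambda>t. x t j * f t i - x t i * f t j) has_real_derivative D) (at t within {0..T})"
    "\<And>t i e c. t \<in> {0..T} - N \<Longrightarrow> (\<And>k. f t k \<le> e) \<Longrightarrow> (\<And>k. \<bar>point_ad \<kappa> (x t) (m t) k\<bar> \<le> c) \<Longrightarrow>
      \<bar>f_rate \<kappa> (p t) (x t) (m t) (f t) i\<bar> \<le> C * (e + c)"
    using switch_deriv_bounds unfolding w_def by blast
  have near: "\<exists>L\<ge>0. \<forall>t\<in>{0..T}. \<forall>i. \<bar>g t i - g t0 i\<bar> \<le> L * \<bar>t - t0\<bar>"
    if g: "\<And>i. lipschitzian {0..T} (\<lambda>t. g t i)" for g :: "real \<Rightarrow> 3 \<Rightarrow> real"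
  proof -
    obtain L where L: "\<And>i. (L i)-lipschitz_on {0..T} (\<lambda>t. g t i)"
      using g unfolding lipschitzian_def by metis
    have Lsum: "L i \<le> (\<Sum>i\<in>UNIV. L i)" for i
      using member_le_sum[of i UNIV L] lipschitz_on_nonneg[OF L] by auto
    have "\<bar>g t i - g t0 i\<bar> \<le> (\<Sum>i\<in>UNIV. L i) * \<bar>t - t0\<bar>" if "t \<in> {0..T}" for t i
      using lipschitz_onD[OF L[of i] that t0'] mult_right_mono[OF Lsum[of i], of "\<bar>t - t0\<bar>"]
      by (auto simp: dist_real_def)
    moreover have "0 \<le> (\<Sum>i\<in>UNIV. L i)" using lipschitz_on_nonneg[OF L] by (simp add: sum_nonneg)
    ultimately show ?thesis by blast
  qed
  have f_near: "\<exists>L\<ge>0. \<forall>t\<in>{t0..T}. \<forall>i. f t i \<le> L * (t - t0)"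
  proof -
    obtain L where L: "L \<ge> 0" "\<And>t i. t \<in> {0..T} \<Longrightarrow> \<bar>f t i - f t0 i\<bar> \<le> L * \<bar>t - t0\<bar>"
      using near[of f, OF lip(3)] by blast
    have "f t i \<le> L * (t - t0)" if t: "t \<in> {t0..T}" for t i
      using L(2)[of t i] t t0 z[of i] by simp
    then show ?thesis using L(1) by blast
  qed
  \<comment> \<open>Here \<open>e\<close> is any bound of the switching functions to the right of \<open>t\<^sub>0\<close>.\<close>
  have main: "\<exists>b. t0 < b \<and> b \<le> T \<and> (\<forall>t\<in>{t0<..<b}. 0 < f t i)"
    if e: "\<And>t k. t \<in> {t0..T} \<Longrightarrow> f t k \<le> e t" and w: "\<forall>\<^sub>F t in at_right t0. 0 < w i j t - C * e t" for e i j
  proof -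
    obtain b0 where b0: "b0 > t0" "\<And>t. t0 < t \<Longrightarrow> t < b0 \<Longrightarrow> 0 < w i j t - C * e t"
      using w unfolding eventually_at_right_field by blast
    define b where "b = min b0 T"
    have b: "t0 < b" "b \<le> T" "b \<le> b0" using b0 t0 by (auto simp: b_def)
    have "0 < f t i" if t: "t \<in> {t0<..<b}" for t
    proof -
      have sub: "{t0..t} \<subseteq> {0..T}" using t b t0 by auto
      have "x t0 j * f t0 i - x t0 i * f t0 j < x t j * f t i - x t i * f t j"
      proof (rule AE_deriv_pos_imp_less[OF _ _ N, where f = "\<lambda>t. x t j * f t i - x t i * f t j"])
        show "lipschitzian {t0..t} (\<lambda>t. x t j * f t i - x t i * f t j)"
          by (rule lipschitzian_subset[OF _ sub]) (intro lipschitzian_intros lip)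
        fix s assume s: "s \<in> {t0<..<t} - N"
        then have s': "s \<in> {0..T} - N" "s \<in> {t0..T}" using sub t b by auto
        obtain D where D: "D \<ge> w i j s - C * e s"
          "((\<lambda>t. x t j * f t i - x t i * f t j) has_real_derivative D) (at s within {0..T})"
          using C(2)[OF s'(1) e[OF s'(2)]] by blast
        moreover have "D > 0" using b0(2)[of s] D(1) s t b by auto
        ultimately show "\<exists>D>0. ((\<lambda>t. x t j * f t i - x t i * f t j) has_real_derivative D) (at s within {t0..t})"
          using DERIV_subset[OF _ sub] by blast
      qed (use t in auto)
      then have "0 < x t j * f t i - x t i * f t j" using z by simp
      moreover have "0 \<le> x t i * f t j" using x_pos[of t i] f_nonneg[of t j] sub t by auto
      ultimately have "0 < x t j * f t i" by linarith
      then show ?thesis using x_pos[of t j] sub t by (auto simp: zero_less_mult_iff)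
    qed
    then show ?thesis using b by blast
  qed
  have at_right_le: "at_right t0 \<le> at t0 within {0..T}"
  proof -
    have "at_right t0 = at t0 within {t0..T}" using t0 by (simp add: at_within_Icc_at_right)
    also have "\<dots> \<le> at t0 within {0..T}" using t0 by (intro at_le) auto
    finally show ?thesis .
  qed
  have tend: "(g \<longlongrightarrow> g t0) (at_right t0)" if "lipschitzian {0..T} g" for g
  proof -
    have "(g \<longlongrightarrow> g t0) (at t0 within {0..T})"
      using lipschitzian_continuous_on[OF that] t0' by (simp add: continuous_on_def)
    then show ?thesis using at_right_le tendsto_mono by blast
  qed
  have pair0: "pairing (m t0) (x t0) = 0"
    using constraint[OF t0'] z unfolding pairing_eq[of "f t0" _ 0] by simp
  show ?thesis
  proof (cases "\<forall>i. m t0 i = 0")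
    case False
    then obtain k where "m t0 k \<noteq> 0" by blast
    then obtain i j where ij: "w i j t0 > 0"
      using exists_point_ad_increasing[OF \<kappa> x_pos[OF t0'] pair0] unfolding w_def by blast
    obtain L where L: "\<And>t i. t \<in> {t0..T} \<Longrightarrow> f t i \<le> L * (t - t0)" using f_near by blast
    have "((\<lambda>t. w i j t - C * (L * (t - t0))) \<longlongrightarrow> w i j t0 - C * (L * (t0 - t0))) (at_right t0)"
      by (intro tendsto_intros tend w_lip)
    then have "\<forall>\<^sub>F t in at_right t0. 0 < w i j t - C * (L * (t - t0))"
      using ij by (intro order_tendstoD(1)) auto
    then show ?thesis using main[OF L] by blast
  next
    case True
    then have m0: "\<And>i. m t0 i = 0" by blast
    have lc: "lc \<noteq> 0" and "\<exists>i. x t0 i \<noteq> x t0 (i + 1)" using nonsing[OF t0' z m0] by auto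
    then obtain i0 where i0: "x t0 i0 \<noteq> x t0 (i0 + 1)" by blast
    \<comment> \<open>The derivative of \<open>m\<close> at \<open>t\<^sub>0\<close>, a multiple of \<open>[J, X]\<close>.\<close>
    define \<mu> where "\<mu> = (\<lambda>i. 3 / 2 * \<kappa> * lc * (x t0 (i + 2) - x t0 (i + 1)))"
    have m_rate0: "m_rate \<kappa> lc (x t0) (m t0) i = \<mu> i" for i
      unfolding m_rate_def \<mu>_def point_ad_def using m0 by simp
    have "\<mu> (i0 + 2) \<noteq> 0"
      using i0 lc \<kappa> unfolding \<mu>_def index3_simps by simp
    moreover have "pairing \<mu> (x t0) = 0"
      unfolding pairing_eq[where i=0] \<mu>_def index3_simps by (simp add: field_simps)
    ultimately obtain i j where ij:
      "x t0 j * point_ad \<kappa> (x t0) \<mu> i - x t0 i * point_ad \<kappa> (x t0) \<mu> j > 0"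
      using exists_point_ad_increasing[of \<kappa> "x t0" \<mu>, OF \<kappa> x_pos[OF t0']] by blast
    have m_diff: "((\<lambda>t. m t k / (t - t0)) \<longlongrightarrow> \<mu> k) (at_right t0)" for k
    proof -
      have "lipschitzian {0..T} (\<lambda>t. m_rate \<kappa> lc (x t) (m t) k)"
        unfolding m_rate_def by (intro lipschitzian_intros lip lipschitzian_point_ad)
      then have "((\<lambda>t. m t k) has_real_derivative m_rate \<kappa> lc (x t0) (m t0) k) (at t0 within {0..T})"
        using m_deriv by (intro AE_deriv_continuous_imp_deriv[OF lip(2) _ N _ t0'] lipschitzian_continuous_on) auto
      then have "((\<lambda>t. (m t k - m t0 k) / (t - t0)) \<longlongrightarrow> \<mu> k) (at t0 within {0..T})"
        unfolding m_rate0 has_field_derivative_iff .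
      then show ?thesis using at_right_le tendsto_mono m0 by fastforce
    qed
    have w_div: "((\<lambda>t. w i j t / (t - t0)) \<longlongrightarrow>
        x t0 j * point_ad \<kappa> (x t0) \<mu> i - x t0 i * point_ad \<kappa> (x t0) \<mu> j) (at_right t0)"
    proof -
      have "w i j t / (t - t0) = x t j * point_ad \<kappa> (x t) (\<lambda>k. m t k / (t - t0)) i
          - x t i * point_ad \<kappa> (x t) (\<lambda>k. m t k / (t - t0)) j" for t
      proof -
        have "point_ad \<kappa> (x t) (\<lambda>k. m t k / (t - t0)) l = point_ad \<kappa> (x t) (m t) l / (t - t0)" for l
          unfolding point_ad_def by (simp add: add_divide_distrib diff_divide_distrib algebra_simps)
        then show ?thesis unfolding w_def by (simp add: diff_divide_distrib)
      qed
      moreover have "((\<lambda>t. x t j * point_ad \<kappa> (x t) (\<lambda>k. m t k / (t - t0)) i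
          - x t i * point_ad \<kappa> (x t) (\<lambda>k. m t k / (t - t0)) j) \<longlongrightarrow>
        x t0 j * point_ad \<kappa> (x t0) \<mu> i - x t0 i * point_ad \<kappa> (x t0) \<mu> j) (at_right t0)"
        unfolding point_ad_def by (intro tendsto_intros tend lip m_diff)
      ultimately show ?thesis by simp
    qed
    obtain L where L: "L \<ge> 0" "\<And>t i. t \<in> {t0..T} \<Longrightarrow> f t i \<le> L * (t - t0)" using f_near by blast
    obtain L' where L': "L' \<ge> 0" "\<And>t i. t \<in> {0..T} \<Longrightarrow>
        \<bar>point_ad \<kappa> (x t) (m t) i - point_ad \<kappa> (x t0) (m t0) i\<bar> \<le> L' * \<bar>t - t0\<bar>"
      using near[of "\<lambda>t. point_ad \<kappa> (x t) (m t)", OF lipschitzian_point_ad] by blast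
    have c0: "point_ad \<kappa> (x t0) (m t0) i = 0" for i unfolding point_ad_def using m0 by simp
    \<comment> \<open>The derivative of \<open>f\<close> is bounded by \<open>B (t - t\<^sub>0)\<close>, because \<open>f\<close> and \<open>c\<close> are Lipschitz and vanish at \<open>t\<^sub>0\<close>.\<close>
    define B where "B = C * (L + L')"
    have B: "B \<ge> 0" using C(1) L(1) L'(1) by (simp add: B_def)
    have f2: "f t k \<le> B * (t - t0)^2" if t: "t \<in> {t0..T}" for t k
    proof -
      have sub: "{t0..t} \<subseteq> {0..T}" using t t0 by auto
      have "B * (t0 - t0)^2 - f t0 k \<le> B * (t - t0)^2 - f t k"
      proof (rule AE_deriv_nonneg_imp_le[OF _ _ N, where f = "\<lambda>t. B * (t - t0)^2 - f t k"])
        show "lipschitzian {t0..t} (\<lambda>t. B * (t - t0)^2 - f t k)"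
          unfolding power2_eq_square by (rule lipschitzian_subset[OF _ sub]) (intro lipschitzian_intros lip)
        fix s assume s: "s \<in> {t0<..<t} - N"
        then have s': "s \<in> {0..T} - N" "s \<in> {t0..T}" using sub t by auto
        have "\<bar>f_rate \<kappa> (p s) (x s) (m s) (f s) k\<bar> \<le> C * (L * (s - t0) + L' * (s - t0))"
          using L(2)[OF s'(2)] L'(2)[of s] s' c0 by (intro C(3)[OF s'(1)]) auto
        also have "\<dots> = B * (s - t0)" by (simp add: B_def algebra_simps)
        also have "\<dots> \<le> 2 * B * (s - t0)" using B s' by (simp add: mult_right_mono)
        finally have le: "f_rate \<kappa> (p s) (x s) (m s) (f s) k \<le> 2 * B * (s - t0)" by linarith
        have "((\<lambda>t. B * (t - t0)^2 - f t k) has_real_derivative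
            2 * B * (s - t0) - f_rate \<kappa> (p s) (x s) (m s) (f s) k) (at s within {t0..t})"
          by (rule derivative_eq_intros DERIV_subset[OF f_deriv[OF s'(1)] sub] refl)+ simp
        then show "\<exists>D\<ge>0. ((\<lambda>t. B * (t - t0)^2 - f t k) has_real_derivative D) (at s within {t0..t})"
          using le by (intro exI[of _ "2 * B * (s - t0) - f_rate \<kappa> (p s) (x s) (m s) (f s) k"]) auto
      qed (use t in auto)
      then show ?thesis using z by simp
    qed
    have "((\<lambda>t. w i j t / (t - t0) - C * (B * (t - t0))) \<longlongrightarrow>
        x t0 j * point_ad \<kappa> (x t0) \<mu> i - x t0 i * point_ad \<kappa> (x t0) \<mu> j - C * (B * (t0 - t0))) (at_right t0)"
      by (intro tendsto_intros w_div)
    then have "\<forall>\<^sub>F t in at_right t0. 0 < w i j t / (t - t0) - C * (B * (t - t0))"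
      using ij by (intro order_tendstoD(1)) auto
    then have "\<forall>\<^sub>F t in at_right t0. 0 < w i j t - C * (B * (t - t0)^2)"
      using eventually_at_right_less[of t0]
    proof eventually_elim
      case (elim t)
      have "0 < (t - t0) * (w i j t / (t - t0) - C * (B * (t - t0)))" using elim by simp
      also have "\<dots> = w i j t - C * (B * (t - t0)^2)"
        using elim by (simp add: right_diff_distrib power2_eq_square)
      finally show ?case .
    qed
    then show ?thesis using main[OF f2] by blast
  qed
qed

lemma ties_right_isolated:
  assumes t0: "t0 \<in> {0..<T}"
  shows "\<exists>e>0. \<forall>t\<in>{t0<..<t0 + e}. t \<le> T \<longrightarrow> \<not> tie t"
proof -
  have t0': "t0 \<in> {0..T}" using t0 by auto
  have "\<exists>i b. t0 < b \<and> b \<le> T \<and> (\<forall>t\<in>{t0<..<b}. 0 < f t i)"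
  proof (cases "\<forall>i. f t0 i = 0")
    case True then show ?thesis using triple_zero_right[OF t0] by blast
  next
    case False
    then obtain i where i: "0 < f t0 i" using f_nonneg[OF t0'] by (metis less_eq_real_def)
    have "continuous_on {0..T} (\<lambda>t. f t i)" using lipschitzian_continuous_on[OF lip(3)] .
    then obtain e where e: "e > 0" "\<And>t. t \<in> {0..T} \<Longrightarrow> dist t t0 < e \<Longrightarrow> dist (f t i) (f t0 i) < f t0 i"
      using i t0' unfolding continuous_on_iff by meson
    have "0 < f t i" if "t \<in> {t0<..<min T (t0 + e)}" for t
      using e(2)[of t] that t0 by (auto simp: dist_real_def)
    then show ?thesis using e t0 by (intro exI[of _ i] exI[of _ "min T (t0 + e)"]) auto
  qed
  then obtain i b where b: "t0 < b" "b \<le> T" "\<And>t. t \<in> {t0<..<b} \<Longrightarrow> 0 < f t i" by blast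
  obtain e where "e > 0" "\<And>t. t \<in> {t0<..<t0 + e} \<Longrightarrow> t < b \<Longrightarrow> \<not> tie t"
    using edge_ties_isolated[OF _ b] t0 by auto
  then show ?thesis using b by (intro exI[of _ "min e (b - t0)"]) auto
qed

end

lemma (in switching_system) finite_ties: "finite {t \<in> {0..T}. tie t}"
proof (rule ccontr)
  assume inf: "infinite {t \<in> {0..T}. tie t}"
  then obtain t0 where t0: "t0 \<in> {0..T}" "t0 islimpt {t \<in> {0..T}. tie t}"
    using Heine_Borel_imp_Bolzano_Weierstrass[OF compact_Icc[of 0 T] inf] by blast
  interpret rev: switching_system T \<kappa> lc "\<lambda>t i. x (T - t) (- i)" "\<lambda>t i. m (T - t) (- i)"
    "\<lambda>t i. f (T - t) (- i)" "\<lambda>t i. p (T - t) (- i)" d "(\<lambda>t. T - t) ` N"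
    by (rule reversed)
  have rev_tie: "tie t \<Longrightarrow> rev.tie (T - t)" for t
    unfolding tie_def rev.tie_def by simp (metis minus_minus)
  have "\<exists>e>0. \<forall>t. t0 < t \<longrightarrow> t < t0 + e \<longrightarrow> t \<le> T \<longrightarrow> \<not> tie t"
  proof (cases "t0 = T")
    case False
    then have "t0 \<in> {0..<T}" using t0 by auto
    from ties_right_isolated[OF this] show ?thesis by (metis greaterThanLessThan_iff)
  qed (intro exI[of _ 1], auto)
  then obtain e where e: "e > 0" "\<And>t. t0 < t \<Longrightarrow> t < t0 + e \<Longrightarrow> t \<le> T \<Longrightarrow> \<not> tie t" by blast
  have "\<exists>e>0. \<forall>t. T - t0 < t \<longrightarrow> t < T - t0 + e \<longrightarrow> t \<le> T \<longrightarrow> \<not> rev.tie t"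
  proof (cases "t0 = 0")
    case False
    then have "T - t0 \<in> {0..<T}" using t0 by auto
    from rev.ties_right_isolated[OF this] show ?thesis by (metis greaterThanLessThan_iff)
  qed (intro exI[of _ 1], auto)
  then obtain e' where e': "e' > 0" "\<And>t. T - t0 < t \<Longrightarrow> t < T - t0 + e' \<Longrightarrow> t \<le> T \<Longrightarrow> \<not> rev.tie t"
    by blast
  obtain t where t: "t \<in> {0..T}" "tie t" "t \<noteq> t0" "dist t t0 < min e e'"
    using t0(2) e(1) e'(1) unfolding islimpt_approachable
    by (metis (no_types, lifting) mem_Collect_eq min_less_iff_conj)
  show False
  proof (cases "t0 < t")
    case True then show False using e(2)[of t] t by (auto simp: dist_real_def)
  next
    case False then show False using e'(2)[of "T - t"] rev_tie[OF t(2)] t by (auto simp: dist_real_def)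
  qed
qed

section \<open>The Hamiltonian in cyclic coordinates\<close>
definition kap :: real where "kap = 2 / sqrt 3"

lemma kap_pos: "0 < kap" by (simp add: kap_def)

lemma kap_squared: "kap * kap = 4 / 3" "kap * (kap * a) = 4 / 3 * a"
  by (simp_all add: kap_def)

lemma divide_sqrt3: "a / sqrt 3 = a * kap / 2" by (simp add: kap_def)

lemma index3_numerals: "(3::3) = 0" "(4::3) = 1" by auto

lemma index3_exhaust: "i = 1 \<or> i = 2 \<or> i = (0::3)"
  using exhaust_3[of i] by auto

text \<open>The numbers \<open>- \<langle>X z, Z\<^sub>i\<rangle>\<close>. They are \<open>- 1 / y\<close> times the denominator of \<open>f\<^sub>1\<close> and \<open>f\<^sub>2\<close> at the vertices, and the
star domain is the set where all three are positive.\<close>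
definition height :: "complex \<Rightarrow> 3 \<Rightarrow> real" where
  "height z i = (if i = 1 then ((Re z)^2 + (Im z)^2 - 1 / 3) / Im z
    else if i = 2 then (2 / 3 - kap * Re z) / Im z else (2 / 3 + kap * Re z) / Im z)"

text \<open>The vector field \<open>(f\<^sub>1, f\<^sub>2)\<close> of a vertex, multiplied by its height. It generates a one-parameter group of isometries
of the half-plane, which is why it is a quadratic polynomial in \<open>z\<close>.\<close>
definition killing_field :: "complex \<Rightarrow> 3 \<Rightarrow> complex" where
  "killing_field z i = (if i = 1 then z^2 - 1 / 3
    else if i = 2 then 2 / 3 - of_real kap * z else 2 / 3 + of_real kap * z)"

definition killing_field_deriv :: "complex \<Rightarrow> 3 \<Rightarrow> complex" where
  "killing_field_deriv z i = (if i = 1 then 2 * z else if i = 2 then - of_real kap else of_real kap)"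

definition height_x :: "complex \<Rightarrow> 3 \<Rightarrow> real" where
  "height_x z i = (if i = 1 then 2 * Re z / Im z else if i = 2 then - kap / Im z else kap / Im z)"

definition height_y :: "complex \<Rightarrow> 3 \<Rightarrow> real" where
  "height_y z i = (if i = 1 then 1 - ((Re z)^2 - 1 / 3) / (Im z)^2
    else if i = 2 then - (2 / 3 - kap * Re z) / (Im z)^2 else - (2 / 3 + kap * Re z) / (Im z)^2)"

text \<open>The coordinates \<open>\<langle>M, Z\<^sub>i\<rangle>\<close> of a traceless matrix.\<close>
definition dual :: "mat2 \<Rightarrow> 3 \<Rightarrow> real" where
  "dual M i = (if i = 1 then M$1$2 + M$2$1 / 3
    else if i = 2 then kap * M$1$1 - 2 / 3 * M$2$1 else - kap * M$1$1 - 2 / 3 * M$2$1)"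

definition reduced :: "real \<Rightarrow> mat2 \<Rightarrow> mat2" where
  "reduced lc \<Lambda> = \<Lambda> - (3 / 2 * lc) *\<^sub>R J"

text \<open>The part \<open>\<langle>M, X\<rangle>\<close> of the Hamiltonian that is independent of the control.\<close>
definition drift :: "mat2 \<Rightarrow> complex \<Rightarrow> real" where
  "drift M z = (2 * M$1$1 * Re z + M$1$2 - M$2$1 * ((Re z)^2 + (Im z)^2)) / Im z"

text \<open>Minus the Hamiltonian at the vertex \<open>i\<close>, multiplied by the height; on the star domain it is nonnegative if and only if
that Hamiltonian is nonpositive.\<close>
definition switch :: "mat2 \<Rightarrow> complex \<Rightarrow> real^2 \<Rightarrow> 3 \<Rightarrow> real" where
  "switch M z \<nu> i = - (height z i * drift M z + \<nu>$1 * Re (killing_field z i) + \<nu>$2 * Im (killing_field z i))"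

fun weight :: "control \<Rightarrow> 3 \<Rightarrow> real" where
  "weight (u0, u1, u2) i = (if i = 1 then u0 else if i = 2 then u1 else u2)"

definition vertex :: "3 \<Rightarrow> control" where
  "vertex i = (if i = 1 then (1, 0, 0) else if i = 2 then (0, 1, 0) else (0, 0, 1))"

lemma sum3: "(\<Sum>k\<in>UNIV. g k) = g 1 + g 2 + g (0::3)" for g :: "3 \<Rightarrow> 'a::comm_monoid_add"
  unfolding sum_index3[of g 1] by (simp add: add.assoc index3_numerals)

lemma J_nth [simp]: "J$1$1 = 0" "J$1$2 = -1" "J$2$1 = 1" "J$2$2 = 0"
  by (simp_all add: J_def)

lemma X_nth [simp]: "X z$1$1 = Re z / Im z" "X z$1$2 = - ((Re z)^2 / Im z) - Im z"
  "X z$2$1 = 1 / Im z" "X z$2$2 = - (Re z / Im z)"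
  by (simp_all add: X_def Let_def)

lemma reduced_nth: "reduced lc \<Lambda>$1$1 = \<Lambda>$1$1" "reduced lc \<Lambda>$1$2 = \<Lambda>$1$2 + 3 / 2 * lc"
  "reduced lc \<Lambda>$2$1 = \<Lambda>$2$1 - 3 / 2 * lc" "reduced lc \<Lambda>$2$2 = \<Lambda>$2$2"
  by (simp_all add: reduced_def)

lemma sl2_nth: "\<Lambda> \<in> sl2 \<Longrightarrow> \<Lambda>$2$2 = - \<Lambda>$1$1"
  by (simp add: sl2_def trace_def sum_2)

lemma drift_eq: "\<Lambda> \<in> sl2 \<Longrightarrow> Im z > 0 \<Longrightarrow>
    trace_form \<Lambda> (X z) - 3 / 2 * lc * trace_form J (X z) = drift (reduced lc \<Lambda>) z"
  by (simp add: trace_form_def trace_def matrix_matrix_mult_def sum_2 drift_def reduced_nth sl2_nth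
      field_simps power2_eq_square kap_squared divide_sqrt3)

text \<open>This is \<open>det (X z) = 1\<close>.\<close>
lemma height_quad:
  assumes "Im z > 0"
  shows "height z i * height z (i + 1) + height z (i + 1) * height z (i + 2) + height z (i + 2) * height z i = 4 / 3"
proof -
  have "height z 1 * height z 2 + height z 2 * height z 0 + height z 0 * height z 1 = 4 / 3"
    using assms by (simp add: height_def field_simps power2_eq_square kap_squared divide_sqrt3)
  then show ?thesis using index3_exhaust[of i] by (auto simp: algebra_simps index3_numerals)
qed

lemma drift_eq_pairing:
  assumes "Im z > 0"
  shows "drift M z = pairing (dual M) (height z)"
  unfolding pairing_eq[where i=0] drift_def dual_def height_def
  using assms by (simp add: field_simps power2_eq_square kap_squared divide_sqrt3)

lemma f1_f2_eq:
  assumes z: "Im z > 0" and u: "(\<Sum>i\<in>UNIV. weight u i * height z i) \<noteq> 0"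
  shows "f1 (Re z) (Im z) u = (\<Sum>i\<in>UNIV. weight u i * Re (killing_field z i)) / (\<Sum>i\<in>UNIV. weight u i * height z i)"
    and "f2 (Re z) (Im z) u = (\<Sum>i\<in>UNIV. weight u i * Im (killing_field z i)) / (\<Sum>i\<in>UNIV. weight u i * height z i)"
proof -
  obtain u0 u1 u2 where uu: "u = (u0, u1, u2)" by (cases u) auto
  let ?S = "\<Sum>i\<in>UNIV. weight u i * height z i"
  let ?D = "ctrl_b u + 2 * ctrl_a u * Re z - ctrl_c u * (Re z)^2 - ctrl_c u * (Im z)^2"
  have D: "?D = - Im z * ?S"
    using z unfolding sum3 uu height_def by (simp add: field_simps power2_eq_square kap_squared divide_sqrt3)
  have 1: "ctrl_b u + 2 * ctrl_a u * Re z - ctrl_c u * (Re z)^2 + ctrl_c u * (Im z)^2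
      = - (\<Sum>i\<in>UNIV. weight u i * Re (killing_field z i))"
    unfolding sum3 uu killing_field_def by (simp add: field_simps power2_eq_square kap_squared divide_sqrt3)
  have 2: "2 * (ctrl_a u - ctrl_c u * Re z) * Im z = - (\<Sum>i\<in>UNIV. weight u i * Im (killing_field z i))"
    unfolding sum3 uu killing_field_def by (simp add: field_simps power2_eq_square kap_squared divide_sqrt3)
  show "f1 (Re z) (Im z) u = (\<Sum>i\<in>UNIV. weight u i * Re (killing_field z i)) / ?S"
    unfolding f1_def Let_def 1 D using z u by (simp add: field_simps)
  have "f2 (Re z) (Im z) u = (2 * (ctrl_a u - ctrl_c u * Re z) * Im z) * Im z / ?D"
    by (simp add: f2_def Let_def power2_eq_square mult_ac)
  also have "\<dots> = (\<Sum>i\<in>UNIV. weight u i * Im (killing_field z i)) / ?S"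
    unfolding 2 D using z u by (simp add: field_simps)
  finally show "f2 (Re z) (Im z) u = (\<Sum>i\<in>UNIV. weight u i * Im (killing_field z i)) / ?S" .
qed

lemma hamiltonian_eq:
  assumes z: "Im z > 0" and \<Lambda>: "\<Lambda> \<in> sl2" and u: "(\<Sum>i\<in>UNIV. weight u i * height z i) \<noteq> 0"
  shows "hamiltonian lc ((g, \<Lambda>), (z, \<nu>)) u
    = - (\<Sum>i\<in>UNIV. weight u i * switch (reduced lc \<Lambda>) z \<nu> i) / (\<Sum>i\<in>UNIV. weight u i * height z i)"
proof -
  let ?S = "\<Sum>i\<in>UNIV. weight u i * height z i" and ?F = "drift (reduced lc \<Lambda>) z"
  have "- (\<Sum>i\<in>UNIV. weight u i * switch (reduced lc \<Lambda>) z \<nu> i)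
      = ?S * ?F + \<nu>$1 * (\<Sum>i\<in>UNIV. weight u i * Re (killing_field z i))
        + \<nu>$2 * (\<Sum>i\<in>UNIV. weight u i * Im (killing_field z i))"
    unfolding sum3 switch_def by (simp add: algebra_simps)
  then show ?thesis using u
    by (simp add: drift_eq[OF \<Lambda> z, simplified] f1_f2_eq[OF z u] add_divide_distrib)
qed

lemma height_pos:
  assumes "z \<in> hstar"
  shows "0 < height z i"
proof -
  have y: "0 < Im z" and x: "\<bar>Re z\<bar> < 1 / sqrt 3" and r: "(Re z)^2 + (Im z)^2 > 1 / 3"
    using assms by (auto simp: hstar_def)
  have "kap * \<bar>Re z\<bar> < kap * (1 / sqrt 3)" using x kap_pos by (intro mult_strict_left_mono) auto
  also have "kap * (1 / sqrt 3) = 2 / 3" by (simp add: kap_def)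
  finally have "\<bar>kap * Re z\<bar> < 2 / 3" using kap_pos by (simp add: abs_mult)
  then have "kap * Re z < 2 / 3" "- (kap * Re z) < 2 / 3" by linarith+
  then show ?thesis using y r by (simp add: height_def)
qed

lemma weight_height_pos:
  assumes u: "u \<in> U" and z: "z \<in> hstar"
  shows "0 < (\<Sum>i\<in>UNIV. weight u i * height z i)"
proof -
  obtain u0 u1 u2 where uu: "u = (u0, u1, u2)" by (cases u) auto
  have "0 \<le> weight u i" for i using u by (simp add: U_def uu)
  then have "0 \<le> weight u i * height z i" for i using height_pos[OF z, of i] by simp
  moreover have "\<exists>i. weight u i * height z i \<noteq> 0"
  proof (rule ccontr)
    assume "\<not> ?thesis"
    then have "weight u i = 0" for i using height_pos[OF z, of i] by (metis less_irrefl mult_eq_0_iff)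
    from this[of 1] this[of 2] this[of 0] show False using u by (simp add: U_def uu)
  qed
  ultimately show ?thesis
    by (metis (no_types, lifting) UNIV_I finite order_le_less sum_nonneg sum_nonneg_eq_0_iff)
qed

text \<open>The sign of the bracket: \<open>[Z\<^sub>k, Z\<^sub>i] = \<kappa> cyc_sign i k (Z\<^sub>i + Z\<^sub>k)\<close>.\<close>
definition cyc_sign :: "3 \<Rightarrow> 3 \<Rightarrow> real" where
  "cyc_sign i k = (if k = i + 2 then 1 else if k = i + 1 then - 1 else 0)"

lemma cyc_sign_simps [simp]: "cyc_sign i i = 0" "cyc_sign i (i + 1) = - 1" "cyc_sign i (i + 2) = 1"
  by (simp_all add: cyc_sign_def)

lemma control_ad_cyc_sign: "control_ad \<kappa> p x i = (\<Sum>k\<in>UNIV. p k * (\<kappa> * cyc_sign i k * (x i + x k)))"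
  unfolding control_ad_def sum_index3[of _ i] cyc_sign_simps by (simp add: algebra_simps)

lemma cyc_sign_values: "cyc_sign 1 2 = - 1" "cyc_sign 2 0 = - 1" "cyc_sign 0 1 = - 1"
  "cyc_sign 2 1 = 1" "cyc_sign 0 2 = 1" "cyc_sign 1 0 = 1"
  by (simp_all add: cyc_sign_def)

text \<open>This lemma, \<open>killing_field_bracket\<close> and \<open>drift_flow\<close> translate the brackets of the \<open>Z\<^sub>i\<close> to the half-plane: they differentiate
functions of \<open>X\<close> along the Killing fields.\<close>
lemma height_flow:
  assumes "Im z > 0"
  shows "height_x z i * Re (killing_field z k) + height_y z i * Im (killing_field z k)
      = kap * cyc_sign i k * (height z i + height z k)"
  using index3_exhaust[of i] index3_exhaust[of k] assms
  by (elim disjE) (simp_all add: height_x_def height_y_def killing_field_def height_def cyc_sign_values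
      field_simps power2_eq_square kap_squared divide_sqrt3)

lemma killing_field_bracket:
  "killing_field_deriv z k * killing_field z i - killing_field_deriv z i * killing_field z k
    = - (of_real kap * of_real (cyc_sign i k) * (killing_field z i + killing_field z k))"
proof -
  have s: "complex_of_real kap * complex_of_real kap = 4 / 3"
    "complex_of_real kap * (complex_of_real kap * a) = 4 / 3 * a" for a
    using arg_cong[OF kap_squared(1), of complex_of_real] by (simp_all add: mult.assoc[symmetric])
  show ?thesis
    using index3_exhaust[of i] index3_exhaust[of k]
    by (elim disjE) (simp_all add: killing_field_deriv_def killing_field_def cyc_sign_values s
      field_simps power2_eq_square kap_squared divide_sqrt3)
qed

section \<open>The adjoint equations\<close>
definition drift_x :: "mat2 \<Rightarrow> complex \<Rightarrow> real" where
  "drift_x M z = (2 * M$1$1 - 2 * M$2$1 * Re z) / Im z"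

definition drift_y :: "mat2 \<Rightarrow> complex \<Rightarrow> real" where
  "drift_y M z = - (2 * M$1$1 * Re z + M$1$2 - M$2$1 * (Re z)^2) / (Im z)^2 - M$2$1"

lemma drift_flow:
  assumes "Im z > 0"
  shows "drift_x M z * Re (killing_field z k) + drift_y M z * Im (killing_field z k) = point_ad kap (height z) (dual M) k"
  using index3_exhaust[of k] assms
  by (elim disjE) (simp_all add: drift_x_def drift_y_def killing_field_def height_def dual_def point_ad_def index3_numerals
      field_simps power2_eq_square kap_squared)

lemma drift_bracket:
  assumes "\<Lambda> \<in> sl2" "Im z > 0"
  shows "drift (bracket \<Lambda> (X z)) z = 0"
  using assms by (simp add: drift_def bracket_def matrix_matrix_mult_def sum_2 sl2_nth field_simps power2_eq_square)

lemma dual_bracket: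
  assumes "\<Lambda> \<in> sl2" "Im z > 0"
  shows "dual (bracket \<Lambda> (X z)) i = m_rate kap lc (height z) (dual (reduced lc \<Lambda>)) i"
  using index3_exhaust[of i] assms
  by (elim disjE) (simp_all add: m_rate_def point_ad_def dual_def height_def reduced_nth bracket_def index3_numerals
      matrix_matrix_mult_def sum_2 sl2_nth field_simps power2_eq_square kap_squared)

lemma killing_field_height: "Im z > 0 \<Longrightarrow>
    height z 1 * (killing_field z 2 + killing_field z 0) + height z 2 * (killing_field z 0 + killing_field z 1)
      + height z 0 * (killing_field z 1 + killing_field z 2) = 0"
  by (simp add: complex_eq_iff killing_field_def height_def field_simps power2_eq_square kap_squared)

text \<open>The Killing fields at \<open>z\<close> satisfy a linear relation, since three vectors in the plane are dependent; its coefficients are the widths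
of the point.\<close>
lemma switch_constraint:
  assumes "Im z > 0"
  shows "pairing (switch M z \<nu>) (height z) = - 2 * pairing (dual M) (height z)"
proof -
  have "pairing (switch M z \<nu>) (height z)
     = - (drift M z * pairing (height z) (height z))
       - 3 / 4 * (\<nu>$1 * Re (height z 1 * (killing_field z 2 + killing_field z 0) + height z 2 * (killing_field z 0 + killing_field z 1)
            + height z 0 * (killing_field z 1 + killing_field z 2))
         + \<nu>$2 * Im (height z 1 * (killing_field z 2 + killing_field z 0) + height z 2 * (killing_field z 0 + killing_field z 1)
            + height z 0 * (killing_field z 1 + killing_field z 2)))"
    unfolding pairing_eq[where i=0] switch_def by (simp add: algebra_simps)
  also have "\<dots> = - (drift M z * pairing (height z) (height z))"
    unfolding killing_field_height[OF assms] by simp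
  also have "pairing (height z) (height z) = 2"
    using height_quad[OF assms, of 0] unfolding pairing_eq[where i=0] by (simp add: algebra_simps)
  finally show ?thesis unfolding drift_eq_pairing[OF assms] by simp
qed

context
  fixes z :: "real \<Rightarrow> complex" and S :: "real set" and t a b :: real
  assumes re: "((\<lambda>t. Re (z t)) has_real_derivative a) (at t within S)"
    and im: "((\<lambda>t. Im (z t)) has_real_derivative b) (at t within S)"
    and pos: "Im (z t) > 0"
begin

lemma height_along:
  "((\<lambda>t. height (z t) i) has_real_derivative height_x (z t) i * a + height_y (z t) i * b) (at t within S)"
proof -
  have nz: "Im (z t) \<noteq> 0" using pos by simp
  have idx: "((2::3) = 1) = False" "((0::3) = 1) = False" "((0::3) = 2) = False" by simp_all
  consider "i = 1" | "i = 2" | "i = 0" using index3_exhaust by blast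
  then show ?thesis
    by cases (simp_all only: height_def height_x_def height_y_def idx if_True if_False refl,
      (rule re im derivative_eq_intros refl nz)+,
      use nz in \<open>simp add: field_simps power2_eq_square\<close>,
      (rule re im derivative_eq_intros refl nz)+,
      use nz in \<open>simp add: field_simps power2_eq_square\<close>,
      (rule re im derivative_eq_intros refl nz)+,
      use nz in \<open>simp add: field_simps power2_eq_square\<close>)
qed

lemma killing_field_along:
  "((\<lambda>t. Re (killing_field (z t) i)) has_real_derivative Re (killing_field_deriv (z t) i * Complex a b)) (at t within S)"
  "((\<lambda>t. Im (killing_field (z t) i)) has_real_derivative Im (killing_field_deriv (z t) i * Complex a b)) (at t within S)"
proof -
  have "(z has_vector_derivative Complex a b) (at t within S)"
    unfolding has_vector_derivative_complex_iff using re im by simp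
  then have "((\<lambda>t. killing_field (z t) i) has_vector_derivative killing_field_deriv (z t) i * Complex a b) (at t within S)"
    using index3_exhaust[of i] unfolding killing_field_def killing_field_deriv_def power2_eq_square
    by (elim disjE) (auto intro!: derivative_eq_intros simp: algebra_simps)
  then show "((\<lambda>t. Re (killing_field (z t) i)) has_real_derivative Re (killing_field_deriv (z t) i * Complex a b)) (at t within S)"
    "((\<lambda>t. Im (killing_field (z t) i)) has_real_derivative Im (killing_field_deriv (z t) i * Complex a b)) (at t within S)"
    unfolding has_vector_derivative_complex_iff by auto
qed

context
  fixes M :: "real \<Rightarrow> mat2" and M' :: mat2 and \<nu> :: "real \<Rightarrow> real^2" and \<nu>1 \<nu>2 :: real
  assumes M: "\<And>i j. ((\<lambda>t. M t $ i $ j) has_real_derivative M' $ i $ j) (at t within S)"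
    and nu1: "((\<lambda>t. \<nu> t $ 1) has_real_derivative \<nu>1) (at t within S)"
    and nu2: "((\<lambda>t. \<nu> t $ 2) has_real_derivative \<nu>2) (at t within S)"
begin

lemma drift_along:
  "((\<lambda>t. drift (M t) (z t)) has_real_derivative
     drift_x (M t) (z t) * a + drift_y (M t) (z t) * b + drift M' (z t)) (at t within S)"
proof -
  have nz: "Im (z t) \<noteq> 0" using pos by simp
  show ?thesis unfolding drift_def drift_x_def drift_y_def
    by (rule re im M derivative_eq_intros refl nz)+
       (use nz in \<open>simp add: field_simps power2_eq_square\<close>)
qed

lemma switch_along:
  "((\<lambda>t. switch (M t) (z t) (\<nu> t) i) has_real_derivative
     - ((height_x (z t) i * a + height_y (z t) i * b) * drift (M t) (z t)
        + height (z t) i * (drift_x (M t) (z t) * a + drift_y (M t) (z t) * b + drift M' (z t))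
        + \<nu>1 * Re (killing_field (z t) i) + \<nu> t $ 1 * Re (killing_field_deriv (z t) i * Complex a b)
        + \<nu>2 * Im (killing_field (z t) i) + \<nu> t $ 2 * Im (killing_field_deriv (z t) i * Complex a b))) (at t within S)"
  unfolding switch_def
  by (rule derivative_eq_intros height_along drift_along killing_field_along nu1 nu2 refl)+
     (simp add: algebra_simps)

end

end

definition switch_x :: "mat2 \<Rightarrow> complex \<Rightarrow> real^2 \<Rightarrow> 3 \<Rightarrow> real" where
  "switch_x M z \<nu> i = - (height_x z i * drift M z + height z i * drift_x M z
     + \<nu>$1 * Re (killing_field_deriv z i) + \<nu>$2 * Im (killing_field_deriv z i))"

definition switch_y :: "mat2 \<Rightarrow> complex \<Rightarrow> real^2 \<Rightarrow> 3 \<Rightarrow> real" where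
  "switch_y M z \<nu> i = - (height_y z i * drift M z + height z i * drift_y M z
     - \<nu>$1 * Im (killing_field_deriv z i) + \<nu>$2 * Re (killing_field_deriv z i))"

lemma switch_partial:
  assumes "Im z > 0"
  shows "((\<lambda>x. height (Complex x (Im z)) i) has_real_derivative height_x z i) (at (Re z))"
    and "((\<lambda>y. height (Complex (Re z) y) i) has_real_derivative height_y z i) (at (Im z))"
    and "((\<lambda>x. switch M (Complex x (Im z)) \<nu> i) has_real_derivative switch_x M z \<nu> i) (at (Re z))"
    and "((\<lambda>y. switch M (Complex (Re z) y) \<nu> i) has_real_derivative switch_y M z \<nu> i) (at (Im z))"
proof -
  have f0: "drift 0 z = 0" by (simp add: drift_def)
  show "((\<lambda>x. height (Complex x (Im z)) i) has_real_derivative height_x z i) (at (Re z))"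
    using height_along[of "\<lambda>x. Complex x (Im z)" 1 "Re z" UNIV 0 i] assms by simp
  show "((\<lambda>y. height (Complex (Re z) y) i) has_real_derivative height_y z i) (at (Im z))"
    using height_along[of "\<lambda>y. Complex (Re z) y" 0 "Im z" UNIV 1 i] assms by simp
  show "((\<lambda>x. switch M (Complex x (Im z)) \<nu> i) has_real_derivative switch_x M z \<nu> i) (at (Re z))"
    using switch_along[of "\<lambda>x. Complex x (Im z)" 1 "Re z" UNIV 0 "\<lambda>_. M" 0 "\<lambda>_. \<nu>" 0 0 i] assms
    by (simp add: switch_x_def f0)
  show "((\<lambda>y. switch M (Complex (Re z) y) \<nu> i) has_real_derivative switch_y M z \<nu> i) (at (Im z))"
    using switch_along[of "\<lambda>y. Complex (Re z) y" 0 "Im z" UNIV 1 "\<lambda>_. M" 0 "\<lambda>_. \<nu>" 0 0 i] assms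
    by (simp add: switch_y_def f0)
qed

text \<open>The Hamiltonian is a quotient whose numerator vanishes at the control, so only the derivative of the numerator survives.\<close>
lemma dH_eq:
  assumes z: "Im z > 0" and \<Lambda>: "\<Lambda> \<in> sl2" and u: "(\<Sum>i\<in>UNIV. weight u i * height z i) \<noteq> 0"
    and max: "(\<Sum>i\<in>UNIV. weight u i * switch (reduced lc \<Lambda>) z \<nu> i) = 0"
  shows "dH_dx lc ((g, \<Lambda>), (z, \<nu>)) u
      = - (\<Sum>i\<in>UNIV. weight u i * switch_x (reduced lc \<Lambda>) z \<nu> i) / (\<Sum>i\<in>UNIV. weight u i * height z i)"
    and "dH_dy lc ((g, \<Lambda>), (z, \<nu>)) u
      = - (\<Sum>i\<in>UNIV. weight u i * switch_y (reduced lc \<Lambda>) z \<nu> i) / (\<Sum>i\<in>UNIV. weight u i * height z i)"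
proof -
  let ?M = "reduced lc \<Lambda>"
  have main: "deriv (\<lambda>s. hamiltonian lc ((g, \<Lambda>), (c s, \<nu>)) u) s0
      = - (\<Sum>i\<in>UNIV. weight u i * w i) / (\<Sum>i\<in>UNIV. weight u i * height z i)"
    if c: "c s0 = z" "isCont (\<lambda>s. Im (c s)) s0"
      and hd: "\<And>i. ((\<lambda>s. height (c s) i) has_real_derivative v i) (at s0)"
      and sd: "\<And>i. ((\<lambda>s. switch ?M (c s) \<nu> i) has_real_derivative w i) (at s0)" for c s0 v w
  proof (rule DERIV_imp_deriv)
    let ?S = "\<lambda>s. \<Sum>i\<in>UNIV. weight u i * height (c s) i"
    let ?N = "\<lambda>s. \<Sum>i\<in>UNIV. weight u i * switch ?M (c s) \<nu> i"
    have S: "(?S has_real_derivative (\<Sum>i\<in>UNIV. weight u i * v i)) (at s0)"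
      by (intro DERIV_sum DERIV_cmult hd)
    have N: "(?N has_real_derivative (\<Sum>i\<in>UNIV. weight u i * w i)) (at s0)"
      by (intro DERIV_sum DERIV_cmult sd)
    have quot: "((\<lambda>s. - ?N s / ?S s) has_real_derivative
        - (\<Sum>i\<in>UNIV. weight u i * w i) / (\<Sum>i\<in>UNIV. weight u i * height z i)) (at s0)"
      by (rule derivative_eq_intros S N refl)+ (use c(1) u max in \<open>simp_all\<close>)
    have "\<forall>\<^sub>F s in nhds s0. ?S s \<noteq> 0"
    proof -
      have "?S s0 \<noteq> 0" using u c(1) by simp
      then show ?thesis
        using tendsto_imp_eventually_ne[OF DERIV_isCont[OF S, unfolded isCont_def], of 0]
        by (simp add: eventually_nhds_conv_at)
    qed
    moreover have "\<forall>\<^sub>F s in nhds s0. Im (c s) > 0"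
    proof -
      have "((\<lambda>s. Im (c s)) \<longlongrightarrow> Im z) (at s0)" using c by (simp add: isCont_def)
      then have "\<forall>\<^sub>F s in at s0. Im (c s) > 0" using z by (rule order_tendstoD)
      then show ?thesis using z c(1) by (simp add: eventually_nhds_conv_at)
    qed
    ultimately have ev: "\<forall>\<^sub>F s in nhds s0. hamiltonian lc ((g, \<Lambda>), (c s, \<nu>)) u = - ?N s / ?S s"
      by eventually_elim (rule hamiltonian_eq[OF _ \<Lambda>])
    show "((\<lambda>s. hamiltonian lc ((g, \<Lambda>), (c s, \<nu>)) u) has_real_derivative
        - (\<Sum>i\<in>UNIV. weight u i * w i) / (\<Sum>i\<in>UNIV. weight u i * height z i)) (at s0)"
      by (rule iffD2[OF DERIV_cong_ev[OF refl ev refl] quot])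
  qed
  show "dH_dx lc ((g, \<Lambda>), (z, \<nu>)) u
      = - (\<Sum>i\<in>UNIV. weight u i * switch_x (reduced lc \<Lambda>) z \<nu> i) / (\<Sum>i\<in>UNIV. weight u i * height z i)"
    unfolding dH_dx.simps
    by (rule main[of "\<lambda>x. Complex x (Im z)" "Re z"]) (auto intro!: switch_partial[OF z] continuous_intros)
  show "dH_dy lc ((g, \<Lambda>), (z, \<nu>)) u
      = - (\<Sum>i\<in>UNIV. weight u i * switch_y (reduced lc \<Lambda>) z \<nu> i) / (\<Sum>i\<in>UNIV. weight u i * height z i)"
    unfolding dH_dy.simps
    by (rule main[of "\<lambda>y. Complex (Re z) y" "Im z"]) (auto intro!: switch_partial[OF z] continuous_intros)
qed

lemma cyc_sign_antisym: "cyc_sign k i = - cyc_sign i k"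
  using index3_exhaust[of i] index3_exhaust[of k] by (auto simp: cyc_sign_def)

text \<open>The left-hand side is the derivative of the switching function when \<open>z\<close> moves by the controlled vector field and \<open>\<nu>\<close> by the
adjoint equation. It is linear in \<open>p\<close>. The coefficient \<open>V k\<close> of \<open>p\<^sub>k\<close> is a Poisson bracket of the
switching functions \<open>i\<close> and \<open>k\<close>, up to a contribution of the momentum, and follows from the three bracket relations.\<close>
lemma switch_flow:
  assumes z: "Im z > 0" and px: "(\<Sum>k\<in>UNIV. p k * height z k) = 1"
    and a: "a = (\<Sum>k\<in>UNIV. p k * Re (killing_field z k))" and b: "b = (\<Sum>k\<in>UNIV. p k * Im (killing_field z k))"
    and n1: "\<nu>1 = (\<Sum>k\<in>UNIV. p k * switch_x M z \<nu> k)" and n2: "\<nu>2 = (\<Sum>k\<in>UNIV. p k * switch_y M z \<nu> k)"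
  shows "- ((height_x z i * a + height_y z i * b) * drift M z
        + height z i * (drift_x M z * a + drift_y M z * b)
        + \<nu>1 * Re (killing_field z i) + \<nu>$1 * Re (killing_field_deriv z i * Complex a b)
        + \<nu>2 * Im (killing_field z i) + \<nu>$2 * Im (killing_field_deriv z i * Complex a b))
     = f_rate kap p (height z) (dual M) (switch M z \<nu>) i"
proof -
  let ?h = "drift M z" and ?c = "point_ad kap (height z) (dual M)" and ?f = "switch M z \<nu>"
  let ?K = "killing_field z" and ?K' = "killing_field_deriv z"
  define V where "V k = - ((height_x z i * Re (?K k) + height_y z i * Im (?K k)) * ?h
        + height z i * (drift_x M z * Re (?K k) + drift_y M z * Im (?K k))
        + switch_x M z \<nu> k * Re (?K i) + \<nu>$1 * Re (?K' i * ?K k)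
        + switch_y M z \<nu> k * Im (?K i) + \<nu>$2 * Im (?K' i * ?K k))" for k
  have V: "V k = kap * cyc_sign i k * (?f i + ?f k) - ?h * (kap * cyc_sign i k * (height z i + height z k))
      - height z i * ?c k + height z k * ?c i" for k
  proof -
    have "switch_x M z \<nu> k * Re (?K i) + switch_y M z \<nu> k * Im (?K i)
      = - (?h * (height_x z k * Re (?K i) + height_y z k * Im (?K i))
          + height z k * (drift_x M z * Re (?K i) + drift_y M z * Im (?K i))
          + \<nu>$1 * Re (?K' k * ?K i) + \<nu>$2 * Im (?K' k * ?K i))"
      unfolding switch_x_def switch_y_def by (simp add: algebra_simps)
    also have "\<dots> = - (?h * (kap * cyc_sign k i * (height z k + height z i)) + height z k * ?c i
          + \<nu>$1 * Re (?K' k * ?K i) + \<nu>$2 * Im (?K' k * ?K i))"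
      unfolding height_flow[OF z] drift_flow[OF z] ..
    finally have 1: "switch_x M z \<nu> k * Re (?K i) + switch_y M z \<nu> k * Im (?K i)
      = - (?h * (kap * cyc_sign k i * (height z k + height z i)) + height z k * ?c i
          + \<nu>$1 * Re (?K' k * ?K i) + \<nu>$2 * Im (?K' k * ?K i))" .
    \<comment> \<open>The Lie bracket of two Killing fields.\<close>
    have 2: "Re (?K' k * ?K i) - Re (?K' i * ?K k) = - (kap * cyc_sign i k * (Re (?K i) + Re (?K k)))"
      "Im (?K' k * ?K i) - Im (?K' i * ?K k) = - (kap * cyc_sign i k * (Im (?K i) + Im (?K k)))"
      using killing_field_bracket[of z k i] by (simp_all add: complex_eq_iff)
    have "V k = - (kap * cyc_sign i k * (height z i + height z k) * ?h + height z i * ?c k)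
       - (switch_x M z \<nu> k * Re (?K i) + switch_y M z \<nu> k * Im (?K i))
       - \<nu>$1 * Re (?K' i * ?K k) - \<nu>$2 * Im (?K' i * ?K k)"
      unfolding V_def height_flow[OF z] drift_flow[OF z] by (simp add: algebra_simps)
    also have "\<dots> = - 2 * (kap * cyc_sign i k * (height z i + height z k) * ?h) - height z i * ?c k + height z k * ?c i
       + \<nu>$1 * (Re (?K' k * ?K i) - Re (?K' i * ?K k)) + \<nu>$2 * (Im (?K' k * ?K i) - Im (?K' i * ?K k))"
      unfolding 1 cyc_sign_antisym[of k i] by (simp add: algebra_simps)
    also have "\<dots> = kap * cyc_sign i k * (?f i + ?f k) - ?h * (kap * cyc_sign i k * (height z i + height z k))
      - height z i * ?c k + height z k * ?c i"
      unfolding 2 switch_def by (simp add: algebra_simps)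
    finally show ?thesis .
  qed
  have "- ((height_x z i * a + height_y z i * b) * drift M z
        + height z i * (drift_x M z * a + drift_y M z * b)
        + \<nu>1 * Re (killing_field z i) + \<nu>$1 * Re (killing_field_deriv z i * Complex a b)
        + \<nu>2 * Im (killing_field z i) + \<nu>$2 * Im (killing_field_deriv z i * Complex a b)) = (\<Sum>k\<in>UNIV. p k * V k)"
    unfolding V_def a b n1 n2 sum3 by (simp add: algebra_simps)
  also have "\<dots> = control_ad kap p ?f i - ?h * control_ad kap p (height z) i
     - height z i * (\<Sum>k\<in>UNIV. p k * ?c k) + (\<Sum>k\<in>UNIV. p k * height z k) * ?c i"
    unfolding V control_ad_cyc_sign sum3 by (simp add: algebra_simps)
  finally show ?thesis unfolding f_rate_def px drift_eq_pairing[OF z] by simp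
qed

section \<open>Transversality\<close>
text \<open>Since \<open>J\<^sup>2 = - 1\<close>, the powers of \<open>\<theta> J\<close> alternate like the Taylor coefficients of cosine and sine.\<close>
lemma J_power:
  "((**) (\<theta> *\<^sub>R J) ^^ n) (mat 1)
    = (fact n * cos_coeff n * \<theta> ^ n) *\<^sub>R mat 1 + (fact n * sin_coeff n * \<theta> ^ n) *\<^sub>R J"
proof (induction n)
  case 0 then show ?case by (simp add: cos_coeff_def sin_coeff_def)
next
  case (Suc n)
  have JJ: "J ** J = - mat 1"
    by (simp add: vec_eq_iff forall_2 matrix_matrix_mult_def sum_2 mat_def)
  have scale: "(a *\<^sub>R A) ** (b *\<^sub>R B) = (a * b) *\<^sub>R (A ** B)" for a b and A B :: mat2
    by (simp add: vec_eq_iff matrix_matrix_mult_def sum_distrib_left mult_ac)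
  have "((**) (\<theta> *\<^sub>R J) ^^ Suc n) (mat 1) = (fact n * cos_coeff n * \<theta> ^ Suc n) *\<^sub>R J
      - (fact n * sin_coeff n * \<theta> ^ Suc n) *\<^sub>R mat 1"
    by (simp add: Suc.IH matrix_add_ldistrib scale JJ mult_ac)
  then show ?case
    by (simp add: cos_coeff_Suc sin_coeff_Suc)
qed

lemma mat_exp_J: "mat_exp (\<theta> *\<^sub>R J) = cos \<theta> *\<^sub>R mat 1 + sin \<theta> *\<^sub>R J"
proof -
  have "(\<lambda>n. (cos_coeff n *\<^sub>R \<theta> ^ n) *\<^sub>R mat 1 + (sin_coeff n *\<^sub>R \<theta> ^ n) *\<^sub>R J) sums (cos \<theta> *\<^sub>R mat 1 + sin \<theta> *\<^sub>R J)"
    by (intro sums_add bounded_linear.sums[OF bounded_linear_scaleR_left] cos_converges sin_converges)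
  then have "(\<lambda>n. (1 / fact n) *\<^sub>R ((**) (\<theta> *\<^sub>R J) ^^ n) (mat 1)) sums (cos \<theta> *\<^sub>R mat 1 + sin \<theta> *\<^sub>R J)"
    by (simp add: J_power scaleR_add_right)
  then show ?thesis unfolding mat_exp_def by (rule sums_unique[symmetric])
qed

lemma R_nth: "R$1$1 = 1 / 2" "R$1$2 = - (3 / 4 * kap)" "R$2$1 = 3 / 4 * kap" "R$2$2 = 1 / 2"
proof -
  have "sqrt 3 / 2 = 3 / 4 * kap" by (simp add: kap_def field_simps)
  then show "R$1$1 = 1 / 2" "R$1$2 = - (3 / 4 * kap)" "R$2$1 = 3 / 4 * kap" "R$2$2 = 1 / 2"
    unfolding R_def mat_exp_J by (simp_all add: cos_60 sin_60 mat_def)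
qed

lemma R_inv_nth:
  "matrix_inv R$1$1 = 1 / 2" "matrix_inv R$1$2 = 3 / 4 * kap"
  "matrix_inv R$2$1 = - (3 / 4 * kap)" "matrix_inv R$2$2 = 1 / 2"
proof -
  have "R ** transpose R = mat 1" "transpose R ** R = mat 1"
    by (simp_all add: vec_eq_iff forall_2 matrix_matrix_mult_def sum_2 mat_def transpose_def R_nth kap_squared)
  moreover from this have "R ** matrix_inv R = mat 1 \<and> matrix_inv R ** R = mat 1"
    unfolding matrix_inv_def by (intro someI[of "\<lambda>A. R ** A = mat 1 \<and> A ** R = mat 1"] conjI)
  ultimately have "matrix_inv R = transpose R"
    by (metis matrix_mul_assoc matrix_mul_lid matrix_mul_rid)
  then show "matrix_inv R$1$1 = 1 / 2" "matrix_inv R$1$2 = 3 / 4 * kap"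
    "matrix_inv R$2$1 = - (3 / 4 * kap)" "matrix_inv R$2$2 = 1 / 2"
    by (simp_all add: transpose_def R_nth)
qed

text \<open>The action of \<open>R\<^sup>-\<^sup>1\<close>, a rotation of the half-plane about \<open>\<i>\<close> that permutes the three sides of the star domain cyclically.\<close>
definition turn :: "complex \<Rightarrow> complex" where
  "turn z = (z / 2 + of_real (3 / 4 * kap)) / (1 / 2 - of_real (3 / 4 * kap) * z)"

lemma mat_act_R_inv: "mat_act (matrix_inv R) = turn"
  by (simp add: fun_eq_iff mat_act_def moebius_def R_inv_nth turn_def)

lemma turn_denominator: "Im z > 0 \<Longrightarrow> 1 / 2 - of_real (3 / 4 * kap) * z \<noteq> 0"
  using kap_pos by (auto simp: complex_eq_iff)

text \<open>Conjugation by \<open>R\<close> permutes the \<open>Z\<^sub>i\<close> cyclically, and \<open>turn\<close> conjugates \<open>X\<close> by \<open>R\<^sup>-\<^sup>1\<close>.\<close>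
lemma height_turn:
  assumes z: "Im z > 0"
  shows "height (turn z) i = height z (i + 2)"
proof -
  define q where "q = 1 / 2 - of_real (3 / 4 * kap) * z"
  define n where "n = z / 2 + of_real (3 / 4 * kap)"
  define Q where "Q = (cmod q)^2"
  have q: "q \<noteq> 0" using turn_denominator[OF z] by (simp add: q_def)
  then have Q0: "Q > 0" by (simp add: Q_def)
  have Q: "Q = 1 / 4 - 3 / 4 * kap * Re z + 3 / 4 * ((Re z)^2 + (Im z)^2)"
    unfolding Q_def cmod_power2 q_def by (simp add: algebra_simps power2_eq_square kap_squared)
  have t: "turn z = n * cnj q / of_real Q"
    unfolding turn_def n_def[symmetric] q_def[symmetric] Q_def using q
    unfolding complex_norm_square by simp
  have Re: "Re (turn z) = (3 / 8 * kap * (1 - (Re z)^2 - (Im z)^2) - Re z / 2) / Q"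
    unfolding t by (simp add: n_def q_def algebra_simps power2_eq_square kap_squared)
  have Im: "Im (turn z) = Im z / Q"
    unfolding t by (simp add: n_def q_def algebra_simps kap_squared)
  have "(Re (turn z))^2 + (Im (turn z))^2 = (cmod n)^2 / Q"
    unfolding cmod_power2[symmetric] turn_def n_def[symmetric] q_def[symmetric] Q_def
    by (simp add: norm_divide power_divide)
  also have "(cmod n)^2 = ((Re z)^2 + (Im z)^2) / 4 + 3 / 4 * kap * Re z + 3 / 4"
    unfolding cmod_power2 n_def by (simp add: algebra_simps power2_eq_square kap_squared)
  finally have sq: "(Re (turn z))^2 + (Im (turn z))^2
      = (((Re z)^2 + (Im z)^2) / 4 + 3 / 4 * kap * Re z + 3 / 4) / Q" .
  have num: "(c - k * (a / Q)) / (b / Q) = (c * Q - k * a) / b" for a b c k :: real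
  proof -
    have "c - k * (a / Q) = (c * Q - k * a) / Q" using Q0 by (simp add: field_simps)
    then show ?thesis using Q0 by simp
  qed
  have h1: "height (turn z) 1 = (2 / 3 + kap * Re z) / Im z"
  proof -
    have "height (turn z) 1 = ((((Re z)^2 + (Im z)^2) / 4 + 3 / 4 * kap * Re z + 3 / 4) / Q - 1 / 3) / (Im z / Q)"
      unfolding height_def sq unfolding Im by simp
    also have "\<dots> = (((Re z)^2 + (Im z)^2) / 4 + 3 / 4 * kap * Re z + 3 / 4 - Q / 3) / Im z"
    proof -
      have "A / Q - 1 / 3 = (A - Q / 3) / Q" for A using Q0 by (simp add: field_simps)
      then show ?thesis using Q0 by simp
    qed
    also have "((Re z)^2 + (Im z)^2) / 4 + 3 / 4 * kap * Re z + 3 / 4 - Q / 3 = 2 / 3 + kap * Re z"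
      unfolding Q by (simp add: field_simps)
    finally show ?thesis .
  qed
  have h2: "height (turn z) 2 = ((Re z)^2 + (Im z)^2 - 1 / 3) / Im z"
  proof -
    have "height (turn z) 2 = (2 / 3 * Q - kap * (3 / 8 * kap * (1 - (Re z)^2 - (Im z)^2) - Re z / 2)) / Im z"
      unfolding num[symmetric] by (simp add: height_def Re Im)
    then show ?thesis unfolding Q by (simp add: algebra_simps kap_squared)
  qed
  have h0: "height (turn z) 0 = (2 / 3 - kap * Re z) / Im z"
  proof -
    have "height (turn z) 0 = (2 / 3 * Q - (- kap) * (3 / 8 * kap * (1 - (Re z)^2 - (Im z)^2) - Re z / 2)) / Im z"
      unfolding num[symmetric] by (simp add: height_def Re Im)
    then show ?thesis unfolding Q by (simp add: algebra_simps kap_squared)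
  qed
  show ?thesis using index3_exhaust[of i]
    by (elim disjE) (simp_all add: h0 h1 h2 index3_numerals, simp_all add: height_def)
qed

text \<open>The factor on the left is the derivative of \<open>turn\<close>, so this is the pushforward of a Killing field.\<close>
lemma killing_field_turn:
  assumes z: "Im z > 0"
  shows "killing_field z i / (1 / 2 - of_real (3 / 4 * kap) * z)^2 = killing_field (turn z) (i + 1)"
proof -
  define k where "k = complex_of_real kap"
  have kk: "k * k = 4 / 3" "k * (k * a) = 4 / 3 * a" for a
    using arg_cong[OF kap_squared(1), of complex_of_real] by (simp_all add: k_def mult.assoc[symmetric])
  have k34: "complex_of_real (3 / 4 * kap) = 3 / 4 * k" by (simp add: k_def)
  define q where "q = 1 / 2 - 3 / 4 * k * z"
  have q: "q \<noteq> 0" using turn_denominator[OF z] unfolding q_def k34 .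
  have t: "turn z = (z / 2 + 3 / 4 * k) / q" unfolding turn_def q_def k34 ..
  have eq: "q * q * killing_field (turn z) (i + 1) = killing_field z i"
  proof -
    have 1: "q * q * (turn z)^2 = (z / 2 + 3 / 4 * k)^2" "q * turn z = z / 2 + 3 / 4 * k"
      using q by (simp_all add: t power2_eq_square)
    have 2: "q * q * (c + e * k * turn z) = q * q * c + e * k * q * (q * turn z)" for c e
      by (simp add: algebra_simps)
    show ?thesis using index3_exhaust[of i]
    proof (elim disjE)
      assume "i = 1"
      then have "q * q * killing_field (turn z) (i + 1) = q * q * (2 / 3 + (-1) * k * turn z)"
        by (simp add: killing_field_def k_def)
      also have "\<dots> = z^2 - 1 / 3" unfolding 2 1
        by (simp add: q_def field_simps power2_eq_square kk)
      finally show ?thesis using \<open>i = 1\<close> by (simp add: killing_field_def)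
    next
      assume "i = 2"
      then have "q * q * killing_field (turn z) (i + 1) = q * q * (2 / 3 + 1 * k * turn z)"
        by (simp add: killing_field_def k_def index3_numerals)
      also have "\<dots> = 2 / 3 - k * z" unfolding 2 1
        by (simp add: q_def field_simps power2_eq_square kk)
      finally show ?thesis using \<open>i = 2\<close> by (simp add: killing_field_def k_def)
    next
      assume "i = 0"
      then have "q * q * killing_field (turn z) (i + 1) = q * q * (turn z)^2 - q * q / 3"
        by (simp add: killing_field_def algebra_simps)
      also have "\<dots> = 2 / 3 + k * z" unfolding 1
        by (simp add: q_def field_simps power2_eq_square kk)
      finally show ?thesis using \<open>i = 0\<close> by (simp add: killing_field_def k_def)
    qed
  qed
  then show ?thesis unfolding k34 q_def[symmetric] using q by (simp add: field_simps power2_eq_square)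
qed

lemma turn_has_derivative:
  assumes "Im z > 0"
  shows "(turn has_field_derivative 1 / (1 / 2 - of_real (3 / 4 * kap) * z)^2) (at z)"
proof -
  define k where "k = complex_of_real (3 / 4 * kap)"
  have kk: "k * k = 3 / 4"
    using arg_cong[OF kap_squared(1), of complex_of_real] by (simp add: k_def algebra_simps)
  have q: "1 / 2 - k * z \<noteq> 0" using turn_denominator[OF assms] by (simp add: k_def)
  have "((\<lambda>z. (z / 2 + k) / (1 / 2 - k * z)) has_field_derivative
      (1 / 2 * (1 / 2 - k * z) - (z / 2 + k) * (- k)) / ((1 / 2 - k * z) * (1 / 2 - k * z))) (at z)"
    using q by (auto intro!: derivative_eq_intros)
  also have "1 / 2 * (1 / 2 - k * z) - (z / 2 + k) * (- k) = 1"
    by (simp add: algebra_simps kk)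
  finally show ?thesis unfolding turn_def[abs_def] k_def[symmetric] by (simp add: power2_eq_square)
qed

lemma linear_vec_of_complex: "bounded_linear vec_of_complex"
  by (intro linear_conv_bounded_linear[THEN iffD1] linearI)
     (simp_all add: vec_of_complex_def vec_eq_iff forall_2)

lemma linear_complex_of_vec: "bounded_linear complex_of_vec"
  by (intro linear_conv_bounded_linear[THEN iffD1] linearI)
     (simp_all add: complex_of_vec_def complex_eq_iff)

text \<open>The differential of a holomorphic map is multiplication by its derivative \<open>w\<close>; its transpose is multiplication by the conjugate of \<open>w\<close>.\<close>
lemma transpose_act_differential:
  assumes z: "Im z > 0" and w: "w = 1 / (1 / 2 - of_real (3 / 4 * kap) * z)^2"
  shows "(transpose (act_differential (matrix_inv R) z) *v \<nu>) $ 1 = \<nu>$1 * Re w + \<nu>$2 * Im w"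
    and "(transpose (act_differential (matrix_inv R) z) *v \<nu>) $ 2 = - \<nu>$1 * Im w + \<nu>$2 * Re w"
proof -
  let ?f = "vec_of_complex \<circ> turn \<circ> complex_of_vec"
  have cv: "complex_of_vec (vec_of_complex z) = z"
    by (simp add: complex_of_vec_def vec_of_complex_def)
  have "(?f has_derivative (\<lambda>h. vec_of_complex (w * complex_of_vec h))) (at (vec_of_complex z))"
  proof -
    have "(turn has_derivative (*) w) (at (complex_of_vec (vec_of_complex z)))"
      using turn_has_derivative[OF z] unfolding has_field_derivative_def cv w .
    then have "(turn \<circ> complex_of_vec has_derivative (*) w \<circ> complex_of_vec) (at (vec_of_complex z))"
      by (intro diff_chain_at bounded_linear_imp_has_derivative linear_complex_of_vec)
    from bounded_linear.has_derivative[OF linear_vec_of_complex this]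
    show ?thesis by (simp add: o_def)
  qed
  then have "frechet_derivative ?f (at (vec_of_complex z)) = (\<lambda>h. vec_of_complex (w * complex_of_vec h))"
    by (rule frechet_derivative_at[symmetric])
  then have "act_differential (matrix_inv R) z = matrix (\<lambda>h. vec_of_complex (w * complex_of_vec h))"
    unfolding act_differential_def jacobian_def mat_act_R_inv by simp
  then have e: "act_differential (matrix_inv R) z $ i $ j = vec_of_complex (w * complex_of_vec (axis j 1)) $ i" for i j
    by (simp add: matrix_def)
  show "(transpose (act_differential (matrix_inv R) z) *v \<nu>) $ 1 = \<nu>$1 * Re w + \<nu>$2 * Im w"
    "(transpose (act_differential (matrix_inv R) z) *v \<nu>) $ 2 = - \<nu>$1 * Im w + \<nu>$2 * Re w"
    unfolding matrix_vector_mult_def transpose_def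
    by (simp_all add: sum_2 e vec_of_complex_def complex_of_vec_def axis_def)
qed

lemma dual_conjugate:
  assumes "\<Lambda> \<in> sl2"
  shows "dual (reduced lc (matrix_inv R ** \<Lambda> ** R)) i = dual (reduced lc \<Lambda>) (i + 2)"
  using index3_exhaust[of i] assms
  by (elim disjE) (simp_all add: dual_def reduced_nth matrix_matrix_mult_def sum_2 R_nth R_inv_nth sl2_nth
      index3_numerals field_simps kap_squared)

lemma switch_turn:
  assumes z: "Im z > 0" "Im (turn z) > 0" and \<Lambda>: "\<Lambda> \<in> sl2"
    and \<nu>: "transpose (act_differential (matrix_inv R) z) *v \<nu>' = \<nu>"
  shows "switch (reduced lc (matrix_inv R ** \<Lambda> ** R)) (turn z) \<nu>' i = switch (reduced lc \<Lambda>) z \<nu> (i + 2)"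
proof -
  define w where "w = 1 / (1 / 2 - of_real (3 / 4 * kap) * z)^2"
  have n: "\<nu>$1 = \<nu>'$1 * Re w + \<nu>'$2 * Im w" "\<nu>$2 = - \<nu>'$1 * Im w + \<nu>'$2 * Re w"
    using transpose_act_differential[OF z(1) w_def, of \<nu>'] unfolding \<nu> by auto
  have k: "killing_field (turn z) i = w * killing_field z (i + 2)"
    using killing_field_turn[OF z(1), of "i + 2"] by (simp add: w_def)
  have f: "drift (reduced lc (matrix_inv R ** \<Lambda> ** R)) (turn z) = drift (reduced lc \<Lambda>) z"
    unfolding drift_eq_pairing[OF z(1)] drift_eq_pairing[OF z(2)] height_turn[OF z(1), abs_def]
      dual_conjugate[OF \<Lambda>, abs_def] pairing_shift ..
  show ?thesis
    unfolding switch_def f height_turn[OF z(1)] k n by (simp add: algebra_simps)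
qed

section \<open>Extremals are switching systems\<close>
lemma AE_lebesgue_on_Icc_iff:
  fixes a b :: real
  shows "(AE t in lebesgue_on {a..b}. P t) \<longleftrightarrow> (\<exists>N. negligible N \<and> (\<forall>t\<in>{a..b} - N. P t))"
proof -
  have "(AE t in lebesgue_on {a..b}. P t) \<longleftrightarrow> (AE t in lebesgue. t \<in> {a..b} \<longrightarrow> P t)"
    by (rule AE_restrict_space_iff) simp
  also have "\<dots> \<longleftrightarrow> (\<exists>N. negligible N \<and> (\<forall>t\<in>{a..b} - N. P t))"
  proof
    assume "AE t in lebesgue. t \<in> {a..b} \<longrightarrow> P t"
    then obtain N where N: "N \<in> null_sets lebesgue" "{t. \<not> (t \<in> {a..b} \<longrightarrow> P t)} \<subseteq> N"
      unfolding eventually_ae_filter by auto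
    then have "\<forall>t\<in>{a..b} - N. P t" by blast
    then show "\<exists>N. negligible N \<and> (\<forall>t\<in>{a..b} - N. P t)" using N(1) negligible_iff_null_sets by blast
  next
    assume "\<exists>N. negligible N \<and> (\<forall>t\<in>{a..b} - N. P t)"
    then obtain N where N: "N \<in> null_sets lebesgue" "\<forall>t\<in>{a..b} - N. P t"
      using negligible_iff_null_sets by blast
    have "{t \<in> space lebesgue. \<not> (t \<in> {a..b} \<longrightarrow> P t)} \<subseteq> N" using N(2) by blast
    then show "AE t in lebesgue. t \<in> {a..b} \<longrightarrow> P t" by (rule AE_I'[OF N(1)])
  qed
  finally show ?thesis .
qed

text \<open>The complement of a null set is dense.\<close>
lemma AE_nonneg_imp_nonneg:
  fixes g :: "real \<Rightarrow> real"
  assumes ab: "a < b" and g: "continuous_on {a..b} g" and N: "negligible N"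
    and nonneg: "\<And>t. t \<in> {a..b} - N \<Longrightarrow> 0 \<le> g t" and t: "t \<in> {a..b}"
  shows "0 \<le> g t"
proof -
  have dense: "closure ({a<..<b} - N) = {a..b}"
  proof -
    have "{a<..<b} \<subseteq> closure ({a<..<b} - N)"
    proof
      fix s assume s: "s \<in> {a<..<b}"
      show "s \<in> closure ({a<..<b} - N)"
        unfolding closure_approachable
      proof (intro allI impI)
        fix e :: real assume "e > 0"
        then have "s \<in> ball s e \<inter> {a<..<b}" using s by simp
        then have "ball s e \<inter> {a<..<b} \<noteq> {}" by blast
        then have "\<not> negligible (ball s e \<inter> {a<..<b})"
          by (intro open_not_negligible open_Int open_ball open_greaterThanLessThan)
        then obtain r where "r \<in> ball s e \<inter> {a<..<b}" "r \<notin> N"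
          using N negligible_subset by blast
        then show "\<exists>r\<in>{a<..<b} - N. dist r s < e" by (intro bexI[of _ r]) (auto simp: dist_commute)
      qed
    qed
    then have "closure {a<..<b} \<subseteq> closure ({a<..<b} - N)" by (simp add: closure_minimal)
    moreover have "closure ({a<..<b} - N) \<subseteq> closure {a<..<b}" by (intro closure_mono) auto
    ultimately show ?thesis using ab by auto
  qed
  show ?thesis
    by (rule continuous_ge_on_closure[of "{a<..<b} - N" g t 0]) (use g nonneg t dense in auto)
qed

text \<open>The index shift \<open>2\<close> comes from \<open>height_turn\<close>, \<open>dual_conjugate\<close> and \<open>switch_turn\<close>: the transversality conditions
identify the data at the final time with the shifted data at the initial time.\<close>
lemma extremal_imp_switching_system:
  assumes ext: "pontryagin_extremal tf lc u lam" and sing: "\<forall>t\<in>{0..tf}. (lc, lam t) \<notin> Lambda_sing"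
  defines "x \<equiv> \<lambda>t. height (z_of (lam t))"
    and "m \<equiv> \<lambda>t. dual (reduced lc (Lambda_of (lam t)))"
    and "f \<equiv> \<lambda>t. switch (reduced lc (Lambda_of (lam t))) (z_of (lam t)) (nu_of (lam t))"
    and "p \<equiv> \<lambda>t i. weight (u t) i / (\<Sum>k\<in>UNIV. weight (u t) k * height (z_of (lam t)) k)"
  shows "\<exists>N. switching_system tf kap lc x m f p 2 N"
proof -
  let ?z = "\<lambda>t. z_of (lam t)" and ?g = "\<lambda>t. g_of (lam t)" and ?L = "\<lambda>t. Lambda_of (lam t)"
    and ?n = "\<lambda>t. nu_of (lam t)"
  have lift: "lifted_trajectory tf lc u lam"
    and maxAE: "AE t in lebesgue_on {0..tf}. hamiltonian lc (lam t) (u t) = hamiltonian_max lc (lam t)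
        \<and> hamiltonian_max lc (lam t) = 0"
    and nontriv: "\<And>t. t \<in> {0..tf} \<Longrightarrow> (lc, ?L t, ?n t) \<noteq> 0"
    and lc: "lc \<in> {0, -1}"
    and trans: "?L tf = matrix_inv R ** ?L 0 ** R"
      "transpose (act_differential (matrix_inv R) (?z 0)) *v ?n tf = ?n 0"
    using ext unfolding pontryagin_extremal_def by auto
  have adm: "admissible tf u (g_of \<circ> lam) (z_of \<circ> lam)"
    and lipE: "\<exists>L. L-lipschitz_on {0..tf} lam"
    and sl: "\<And>t. t \<in> {0..tf} \<Longrightarrow> ?L t \<in> sl2"
    and liftAE: "AE t in lebesgue_on {0..tf}.
        ((Lambda_of \<circ> lam) has_vector_derivative bracket (?L t) (X (?z t))) (at t within {0..tf}) \<and>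
        ((nu_of \<circ> lam) has_vector_derivative
           vector [- dH_dx lc (lam t) (u t), - dH_dy lc (lam t) (u t)]) (at t within {0..tf})"
    using lift unfolding lifted_trajectory_def by auto
  have T: "0 < tf" and traj: "trajectory tf u (g_of \<circ> lam) (z_of \<circ> lam)"
    and star: "\<And>t. t \<in> {0..tf} \<Longrightarrow> ?z t \<in> hstar"
    and zend: "?z tf = turn (?z 0)"
    using adm unfolding admissible_def mat_act_R_inv by (auto simp: image_subset_iff)
  have uU: "\<And>t. t \<in> {0..tf} \<Longrightarrow> u t \<in> U" and gSL: "\<And>t. t \<in> {0..tf} \<Longrightarrow> ?g t \<in> SL2"
    and trajAE: "AE t in lebesgue_on {0..tf}.
        ((z_of \<circ> lam) has_vector_derivative
           Complex (f1 (Re (?z t)) (Im (?z t)) (u t)) (f2 (Re (?z t)) (Im (?z t)) (u t))) (at t within {0..tf})"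
    using traj unfolding trajectory_def measurable_control_def by (auto elim: eventually_mono)
  have y: "\<And>t. t \<in> {0..tf} \<Longrightarrow> 0 < Im (?z t)" using star by (auto simp: hstar_def)
  have lam_split: "lam t = ((?g t, ?L t), (?z t, ?n t))" for t
    by (simp add: g_of_def Lambda_of_def z_of_def nu_of_def)
  define S where "S t = (\<Sum>k\<in>UNIV. weight (u t) k * x t k)" for t
  have S: "0 < S t" if "t \<in> {0..tf}" for t
    using weight_height_pos[OF uU[OF that] star[OF that]] by (simp add: S_def x_def)
  have p: "p t i = weight (u t) i / S t" for t i by (simp add: p_def S_def x_def)
  obtain N1 where N1: "negligible N1"
    "\<And>t. t \<in> {0..tf} - N1 \<Longrightarrow> hamiltonian lc (lam t) (u t) = hamiltonian_max lc (lam t)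
        \<and> hamiltonian_max lc (lam t) = 0"
    using maxAE unfolding AE_lebesgue_on_Icc_iff by blast
  obtain N2 where N2: "negligible N2" "\<And>t. t \<in> {0..tf} - N2 \<Longrightarrow>
        ((Lambda_of \<circ> lam) has_vector_derivative bracket (?L t) (X (?z t))) (at t within {0..tf}) \<and>
        ((nu_of \<circ> lam) has_vector_derivative
           vector [- dH_dx lc (lam t) (u t), - dH_dy lc (lam t) (u t)]) (at t within {0..tf})"
    using liftAE unfolding AE_lebesgue_on_Icc_iff by blast
  obtain N3 where N3: "negligible N3" "\<And>t. t \<in> {0..tf} - N3 \<Longrightarrow> ((z_of \<circ> lam) has_vector_derivative
           Complex (f1 (Re (?z t)) (Im (?z t)) (u t)) (f2 (Re (?z t)) (Im (?z t)) (u t))) (at t within {0..tf})"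
    using trajAE unfolding AE_lebesgue_on_Icc_iff by blast
  define N where "N = N1 \<union> N2 \<union> N3"
  have N: "negligible N" using N1 N2 N3 by (simp add: N_def)

  \<comment> \<open>Every coordinate of the lift has the Lipschitz constant of the lift.\<close>
  obtain L where L: "L-lipschitz_on {0..tf} lam" using lipE by blast
  have comp: "lipschitzian {0..tf} (\<lambda>t. F (lam t))" if F: "\<And>a b. \<bar>F a - F b\<bar> \<le> dist a b" for F :: "cotangent \<Rightarrow> real"
  proof -
    have "L-lipschitz_on {0..tf} (\<lambda>t. F (lam t))"
    proof (rule lipschitz_onI)
      fix s t assume "s \<in> {0..tf}" "t \<in> {0..tf}"
      then show "dist (F (lam s)) (F (lam t)) \<le> L * dist s t"
        using order_trans[OF F lipschitz_onD[OF L]] by (simp add: dist_real_def)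
    qed (rule lipschitz_on_nonneg[OF L])
    then show ?thesis unfolding lipschitzian_def by blast
  qed
  have dz: "dist (z_of a) (z_of b) \<le> dist a b" and dn: "dist (nu_of a) (nu_of b) \<le> dist a b"
    and dL: "dist (Lambda_of a) (Lambda_of b) \<le> dist a b" for a b :: cotangent
    unfolding z_of_def nu_of_def Lambda_of_def
    by (meson dist_fst_le dist_snd_le order_trans)+
  have lip_re: "lipschitzian {0..tf} (\<lambda>t. Re (?z t))"
  proof (rule comp)
    fix a b :: cotangent
    show "\<bar>Re (z_of a) - Re (z_of b)\<bar> \<le> dist a b"
      using abs_Re_le_cmod[of "z_of a - z_of b"] dz[of a b] by (simp add: dist_norm)
  qed
  have lip_im: "lipschitzian {0..tf} (\<lambda>t. Im (?z t))"
  proof (rule comp)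
    fix a b :: cotangent
    show "\<bar>Im (z_of a) - Im (z_of b)\<bar> \<le> dist a b"
      using abs_Im_le_cmod[of "z_of a - z_of b"] dz[of a b] by (simp add: dist_norm)
  qed
  have lip_n: "lipschitzian {0..tf} (\<lambda>t. ?n t $ i)" for i
  proof (rule comp)
    fix a b :: cotangent
    show "\<bar>nu_of a $ i - nu_of b $ i\<bar> \<le> dist a b"
      using dist_vec_nth_le[of "nu_of a" i "nu_of b"] dn[of a b] by (simp add: dist_real_def)
  qed
  have lip_L: "lipschitzian {0..tf} (\<lambda>t. ?L t $ i $ j)" for i j
  proof (rule comp)
    fix a b :: cotangent
    show "\<bar>Lambda_of a $ i $ j - Lambda_of b $ i $ j\<bar> \<le> dist a b"
      using dist_vec_nth_le[of "Lambda_of a $ i" j "Lambda_of b $ i"]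
        dist_vec_nth_le[of "Lambda_of a" i "Lambda_of b"] dL[of a b] by (simp add: dist_real_def)
  qed
  have lip_x: "lipschitzian {0..tf} (\<lambda>t. x t i)" for i
    using index3_exhaust[of i] unfolding x_def height_def power2_eq_square
    by (elim disjE) (auto intro!: lipschitzian_intros lip_re lip_im y)
  have lip_m: "lipschitzian {0..tf} (\<lambda>t. m t i)" for i
    using index3_exhaust[of i] unfolding m_def dual_def reduced_nth
    by (elim disjE) (auto intro!: lipschitzian_intros lip_L)
  have lip_k: "lipschitzian {0..tf} (\<lambda>t. Re (killing_field (?z t) i))"
    "lipschitzian {0..tf} (\<lambda>t. Im (killing_field (?z t) i))" for i
    using index3_exhaust[of i] unfolding killing_field_def power2_eq_square
    by (elim disjE; auto intro!: lipschitzian_intros lip_re lip_im)+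
  have lip_h: "lipschitzian {0..tf} (\<lambda>t. drift (reduced lc (?L t)) (?z t))"
    unfolding drift_def reduced_nth power2_eq_square by (intro lipschitzian_intros lip_re lip_im lip_L y)
  have lip_f: "lipschitzian {0..tf} (\<lambda>t. f t i)" for i
    unfolding f_def switch_def
    by (intro lipschitzian_intros lip_h lip_n lip_k) (use lip_x in \<open>simp add: x_def\<close>)

  \<comment> \<open>The maximum is zero, so the Hamiltonian is nonpositive at the vertices for almost every time, and by continuity always.\<close>
  have H: "hamiltonian lc (lam t) v = - (\<Sum>i\<in>UNIV. weight v i * f t i) / (\<Sum>i\<in>UNIV. weight v i * x t i)"
    if t: "t \<in> {0..tf}" and v: "v \<in> U" for t v
    unfolding f_def x_def using weight_height_pos[OF v star[OF t]]
    by (subst lam_split) (intro hamiltonian_eq y t sl, simp)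
  have bdd: "bdd_above (hamiltonian lc (lam t) ` U)" if t: "t \<in> {0..tf}" for t
  proof -
    define \<delta> where "\<delta> = Min (range (x t))"
    define F where "F = (\<Sum>i\<in>UNIV. \<bar>f t i\<bar>)"
    have \<delta>: "0 < \<delta>" "\<And>i. \<delta> \<le> x t i"
      using height_pos[OF star[OF t]] by (auto simp: \<delta>_def x_def)
    have F: "0 \<le> F" by (simp add: F_def sum_nonneg)
    have "hamiltonian lc (lam t) v \<le> F / \<delta>" if v: "v \<in> U" for v
    proof -
      obtain v0 v1 v2 where vv: "v = (v0, v1, v2)" by (cases v) auto
      have w: "0 \<le> weight v i" "weight v i \<le> 1" "(\<Sum>i\<in>UNIV. weight v i) = 1" for i
        using v by (auto simp: U_def vv sum3)
      have "(\<Sum>i\<in>UNIV. weight v i * \<delta>) \<le> (\<Sum>i\<in>UNIV. weight v i * x t i)"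
        using w(1) \<delta>(2) by (intro sum_mono mult_left_mono) auto
      then have 1: "\<delta> \<le> (\<Sum>i\<in>UNIV. weight v i * x t i)"
        using w(3) by (simp add: sum_distrib_right[symmetric])
      have "- (weight v i * f t i) \<le> 1 * \<bar>f t i\<bar>" for i
      proof -
        have "- (weight v i * f t i) \<le> \<bar>weight v i * f t i\<bar>" by (rule abs_ge_minus_self)
        also have "\<dots> = weight v i * \<bar>f t i\<bar>" by (simp add: abs_mult w(1))
        also have "\<dots> \<le> 1 * \<bar>f t i\<bar>" by (intro mult_right_mono w(2)) auto
        finally show ?thesis .
      qed
      then have 2: "- (\<Sum>i\<in>UNIV. weight v i * f t i) \<le> F"
        unfolding F_def sum_negf[symmetric] by (intro sum_mono) auto
      have "- (\<Sum>i\<in>UNIV. weight v i * f t i) / (\<Sum>i\<in>UNIV. weight v i * x t i)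
          \<le> F / (\<Sum>i\<in>UNIV. weight v i * x t i)"
        using 1 2 \<delta>(1) by (intro divide_right_mono) auto
      also have "\<dots> \<le> F / \<delta>" using 1 \<delta>(1) F by (intro divide_left_mono) auto
      finally show ?thesis unfolding H[OF t v] .
    qed
    then show ?thesis by (intro bdd_aboveI[of _ "F / \<delta>"]) auto
  qed
  have f_ae: "0 \<le> f t i" if t: "t \<in> {0..tf} - N1" for t i
  proof -
    have v: "vertex i \<in> U" by (simp add: vertex_def U_def)
    have "hamiltonian lc (lam t) (vertex i) \<le> 0"
      using cSUP_upper[OF v bdd[of t]] N1(2)[OF t] t by (simp add: hamiltonian_max_def)
    moreover have "hamiltonian lc (lam t) (vertex i) = - f t i / x t i"
    proof -
      have "(\<Sum>k\<in>UNIV. weight (vertex i) k * c k) = c i" for c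
        using index3_exhaust[of i] by (auto simp: sum3 vertex_def)
      then show ?thesis using H[of t, OF _ v] t by simp
    qed
    ultimately show ?thesis using height_pos[OF star[of t], of i] t by (simp add: x_def divide_le_0_iff field_simps)
  qed
  have u_f: "(\<Sum>i\<in>UNIV. weight (u t) i * f t i) = 0" if t: "t \<in> {0..tf} - N1" for t
    using N1(2)[OF t] H[of t "u t"] uU[of t] S[of t] t by (simp add: S_def)
  have u_nonneg: "0 \<le> weight (u t) i" if "t \<in> {0..tf}" for t i
    using uU[OF that] by (cases "u t") (auto simp: U_def)
  have p_x: "(\<Sum>i\<in>UNIV. p t i * x t i) = 1" if t: "t \<in> {0..tf}" for t
    using S[OF t] unfolding p by (simp add: sum_divide_distrib[symmetric] S_def)
  have p_f: "(\<Sum>i\<in>UNIV. p t i * f t i) = 0" if t: "t \<in> {0..tf} - N1" for t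
    using u_f[OF t] unfolding p by (simp add: sum_divide_distrib[symmetric])
  have p_nonneg: "0 \<le> p t i" if t: "t \<in> {0..tf}" for t i
    using S[OF t] u_nonneg[OF t] by (simp add: p)
  have f_nonneg: "0 \<le> f t i" if "t \<in> {0..tf}" for t i
    by (rule AE_nonneg_imp_nonneg[OF T lipschitzian_continuous_on[OF lip_f] N1(1) f_ae that])
  have f_min: "\<exists>i. f t i = 0" if t: "t \<in> {0..tf}" for t
  proof -
    have "0 \<le> - (f t 1 * f t 2 * f t 0)"
    proof (rule AE_nonneg_imp_nonneg[OF T _ N1(1) _ t])
      show "continuous_on {0..tf} (\<lambda>t. - (f t 1 * f t 2 * f t 0))"
        by (intro continuous_intros lipschitzian_continuous_on[OF lip_f])
      fix s assume s: "s \<in> {0..tf} - N1"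
      have "p s i * f s i = 0" for i
        using p_f[OF s] p_nonneg[of s] f_nonneg[of s] s by (simp add: sum_nonneg_eq_0_iff)
      moreover have "\<exists>i. p s i \<noteq> 0" 
      proof (rule ccontr)
        assume "\<not> ?thesis"
        then have "(\<Sum>i\<in>UNIV. p s i * x s i) = 0" by simp
        then show False using p_x[of s] s by simp
      qed
      ultimately obtain i where "f s i = 0" by (metis mult_eq_0_iff)
      then show "0 \<le> - (f s 1 * f s 2 * f s 0)" using index3_exhaust[of i] by auto
    qed
    moreover have "0 \<le> f t 1 * f t 2 * f t 0" using f_nonneg[OF t] by simp
    ultimately have "f t 1 * f t 2 * f t 0 = 0" by simp
    then show ?thesis by (metis mult_eq_0_iff)
  qed

  \<comment> \<open>The velocities of the point and of the covector are combinations of the vertex contributions with the weights \<open>p\<close>.\<close>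
  have comp_deriv: "((\<lambda>t. F (c t)) has_real_derivative F c') (at t within {0..tf})"
    if "(c has_vector_derivative c') (at t within {0..tf})" "bounded_linear F"
    for F :: "'b::real_normed_vector \<Rightarrow> real" and c c' t
    using bounded_linear.has_vector_derivative[OF that(2,1)]
    by (simp add: has_real_derivative_iff_has_vector_derivative)
  have z_eq: "f1 (Re (?z t)) (Im (?z t)) (u t) = (\<Sum>k\<in>UNIV. p t k * Re (killing_field (?z t) k))"
    "f2 (Re (?z t)) (Im (?z t)) (u t) = (\<Sum>k\<in>UNIV. p t k * Im (killing_field (?z t) k))" if t: "t \<in> {0..tf}" for t
    using f1_f2_eq[OF y[OF t], of "u t"] S[OF t]
    unfolding p by (simp_all add: S_def x_def sum_divide_distrib[symmetric])
  have derivs: "((\<lambda>t. x t i) has_real_derivative control_ad kap (p t) (x t) i) (at t within {0..tf})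
      \<and> ((\<lambda>t. m t i) has_real_derivative m_rate kap lc (x t) (m t) i) (at t within {0..tf})
      \<and> ((\<lambda>t. f t i) has_real_derivative f_rate kap (p t) (x t) (m t) (f t) i) (at t within {0..tf})"
    if tN: "t \<in> {0..tf} - N" for t i
  proof -
    have t: "t \<in> {0..tf}" and t1: "t \<in> {0..tf} - N1" and t2: "t \<in> {0..tf} - N2" and t3: "t \<in> {0..tf} - N3"
      using tN by (auto simp: N_def)
    define a where "a = (\<Sum>k\<in>UNIV. p t k * Re (killing_field (?z t) k))"
    define b where "b = (\<Sum>k\<in>UNIV. p t k * Im (killing_field (?z t) k))"
    have zd: "((\<lambda>t. ?z t) has_vector_derivative Complex a b) (at t within {0..tf})"
      using N3(2)[OF t3] unfolding z_eq[OF t] a_def b_def by (simp add: o_def)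
    have re: "((\<lambda>t. Re (?z t)) has_real_derivative a) (at t within {0..tf})"
      using comp_deriv[OF zd bounded_linear_Re] by simp
    have im: "((\<lambda>t. Im (?z t)) has_real_derivative b) (at t within {0..tf})"
      using comp_deriv[OF zd bounded_linear_Im] by simp
    have Ld: "((\<lambda>t. ?L t $ i $ j) has_real_derivative bracket (?L t) (X (?z t)) $ i $ j) (at t within {0..tf})" for i j
    proof -
      have "bounded_linear (\<lambda>A::mat2. A $ i $ j)"
        using bounded_linear_compose[OF bounded_linear_vec_nth[of j] bounded_linear_vec_nth[of i]] .
      then show ?thesis using comp_deriv[of ?L "bracket (?L t) (X (?z t))" t "\<lambda>A. A $ i $ j"] N2(2)[OF t2]
        by (simp add: o_def)
    qed
    have Md: "((\<lambda>t. reduced lc (?L t) $ i $ j) has_real_derivative bracket (?L t) (X (?z t)) $ i $ j) (at t within {0..tf})" for i j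
      unfolding reduced_def by (auto intro!: derivative_eq_intros Ld)
    have nd: "((\<lambda>t. ?n t $ i) has_real_derivative vector [- dH_dx lc (lam t) (u t), - dH_dy lc (lam t) (u t)] $ i)
        (at t within {0..tf})" for i
      using comp_deriv[of ?n _ t "\<lambda>v. v $ i", OF _ bounded_linear_vec_nth] N2(2)[OF t2] by (simp add: o_def)
    have S0: "(\<Sum>i\<in>UNIV. weight (u t) i * height (?z t) i) \<noteq> 0" using S[OF t] by (simp add: S_def x_def)
    have max0: "(\<Sum>i\<in>UNIV. weight (u t) i * switch (reduced lc (?L t)) (?z t) (?n t) i) = 0"
      using u_f[OF t1] by (simp add: f_def)
    have n1: "((\<lambda>t. ?n t $ 1) has_real_derivative (\<Sum>k\<in>UNIV. p t k * switch_x (reduced lc (?L t)) (?z t) (?n t) k))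
        (at t within {0..tf})"
    proof -
      have "- dH_dx lc (lam t) (u t) = (\<Sum>k\<in>UNIV. p t k * switch_x (reduced lc (?L t)) (?z t) (?n t) k)"
        using dH_eq(1)[OF y[OF t] sl[OF t] S0 max0, of "?g t"]
        unfolding p lam_split[of t, symmetric] by (simp add: S_def x_def sum_divide_distrib[symmetric])
      then show ?thesis using nd[of 1] by simp
    qed
    have n2: "((\<lambda>t. ?n t $ 2) has_real_derivative (\<Sum>k\<in>UNIV. p t k * switch_y (reduced lc (?L t)) (?z t) (?n t) k))
        (at t within {0..tf})"
    proof -
      have "- dH_dy lc (lam t) (u t) = (\<Sum>k\<in>UNIV. p t k * switch_y (reduced lc (?L t)) (?z t) (?n t) k)"
        using dH_eq(2)[OF y[OF t] sl[OF t] S0 max0, of "?g t"]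
        unfolding p lam_split[of t, symmetric] by (simp add: S_def x_def sum_divide_distrib[symmetric])
      then show ?thesis using nd[of 2] by simp
    qed
    have "((\<lambda>t. x t i) has_real_derivative control_ad kap (p t) (x t) i) (at t within {0..tf})"
    proof -
      have "height_x (?z t) i * a + height_y (?z t) i * b
         = (\<Sum>k\<in>UNIV. p t k * (height_x (?z t) i * Re (killing_field (?z t) k) + height_y (?z t) i * Im (killing_field (?z t) k)))"
        unfolding a_def b_def sum3 by (simp add: algebra_simps)
      also have "\<dots> = control_ad kap (p t) (x t) i"
        unfolding height_flow[OF y[OF t]] control_ad_cyc_sign x_def ..
      finally show ?thesis using height_along[OF re im y[OF t], of i] by (simp add: x_def)
    qed
    moreover have "((\<lambda>t. m t i) has_real_derivative m_rate kap lc (x t) (m t) i) (at t within {0..tf})"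
    proof -
      have "((\<lambda>t. m t i) has_real_derivative dual (bracket (?L t) (X (?z t))) i) (at t within {0..tf})"
        using index3_exhaust[of i] unfolding m_def dual_def
        by (elim disjE) (auto intro!: derivative_eq_intros Md)
      then show ?thesis unfolding dual_bracket[OF sl[OF t] y[OF t], where lc = lc] by (simp add: x_def m_def)
    qed
    moreover have "((\<lambda>t. f t i) has_real_derivative f_rate kap (p t) (x t) (m t) (f t) i) (at t within {0..tf})"
      using switch_along[OF re im y[OF t] Md n1 n2, of i]
        switch_flow[OF y[OF t], of "p t" a b _ "reduced lc (?L t)" "?n t" _ i, OF _ a_def b_def refl refl] p_x[OF t]
      unfolding drift_bracket[OF sl[OF t] y[OF t]] by (simp add: x_def m_def f_def)
    ultimately show ?thesis by blast
  qed

  \<comment> \<open>Two Killing fields span the plane, so \<open>\<nu> = 0\<close>, and \<open>\<Lambda> = (3/2) \<lambda>\<^sub>c\<^sub>o\<^sub>s\<^sub>t J\<close>; equal heights then mean \<open>z = \<i>\<close>, a singular point.\<close>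
  have nonsing: "lc \<noteq> 0 \<and> (\<exists>i. x t i \<noteq> x t (i + 1))"
    if t: "t \<in> {0..tf}" and fz: "\<And>i. f t i = 0" and mz: "\<And>i. m t i = 0" for t
  proof -
    have h: "drift (reduced lc (?L t)) (?z t) = 0"
      unfolding drift_eq_pairing[OF y[OF t]] using mz by (simp add: m_def pairing_eq[where i=0])
    have nk: "?n t $ 1 * Re (killing_field (?z t) i) + ?n t $ 2 * Im (killing_field (?z t) i) = 0" for i
      using fz[of i] h by (simp add: f_def switch_def)
    have "?n t $ 1 * (Re (killing_field (?z t) 2) + Re (killing_field (?z t) 0))
        + ?n t $ 2 * (Im (killing_field (?z t) 2) + Im (killing_field (?z t) 0)) = 0"
      unfolding distrib_left using nk[of 2] nk[of 0] by linarith
    then have "?n t $ 1 = 0" by (simp add: killing_field_def)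
    moreover from this have "?n t $ 2 = 0" using nk[of 2] y[OF t] kap_pos by (simp add: killing_field_def)
    ultimately have n0: "?n t = 0" by (simp add: vec_eq_iff forall_2)
    have "reduced lc (?L t) $ 1 $ 1 = 0 \<and> reduced lc (?L t) $ 2 $ 1 = 0 \<and> reduced lc (?L t) $ 1 $ 2 = 0"
      using mz[of 1] mz[of 2] mz[of 0] kap_pos by (auto simp: m_def dual_def)
    then have L0: "?L t = (3 / 2 * lc) *\<^sub>R J"
      using sl2_nth[OF sl[OF t]] by (simp add: vec_eq_iff forall_2 reduced_nth)
    have lc1: "lc \<noteq> 0" using nontriv[OF t] n0 L0 by (auto simp: zero_prod_def)
    have "\<exists>i. x t i \<noteq> x t (i + 1)"
    proof (rule ccontr)
      assume "\<not> ?thesis"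
      then have "x t 1 = x t (1 + 1)" "x t 2 = x t (2 + 1)" by blast+
      then have eq: "x t 1 = x t 2" "x t 2 = x t 0" by (simp_all add: index3_numerals)
      have "Re (?z t) = 0" using eq(2) y[OF t] kap_pos by (simp add: x_def height_def)
      moreover have "height (?z t) 1 * Im (?z t) = height (?z t) 2 * Im (?z t)" using eq(1) by (simp add: x_def)
      ultimately have "(Im (?z t))^2 = 1" using y[OF t] by (simp add: height_def)
      then have "Im (?z t) = 1" using y[OF t] by (simp add: power2_eq_1_iff)
      then have "?z t = \<i>" using \<open>Re (?z t) = 0\<close> by (simp add: complex_eq_iff)
      then have "(lc, ((?g t, ?L t), (?z t, ?n t))) \<in> Lambda_sing"
        unfolding Lambda_sing_def using lc lc1 gSL[OF t] L0 n0 by auto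
      then have "(lc, lam t) \<in> Lambda_sing" by (subst lam_split)
      then show False using sing t by blast
    qed
    then show ?thesis using lc1 by blast
  qed

  have "switching_system tf kap lc x m f p 2 N"
  proof
    have T0: "tf \<in> {0..tf}" "0 \<in> {0..tf}" using T by auto
    fix i
    show "x tf i = x 0 (i + 2)" unfolding x_def zend using height_turn[OF y[OF T0(2)]] .
    show "m tf i = m 0 (i + 2)" unfolding m_def trans(1) using dual_conjugate[OF sl[OF T0(2)]] .
    show "f tf i = f 0 (i + 2)"
      unfolding f_def trans(1) zend
      by (rule switch_turn[OF y[OF T0(2)] _ sl[OF T0(2)] trans(2)]) (use y[OF T0(1)] zend in simp)
  next
    fix t i assume t: "t \<in> {0..tf}"
    show "0 < x t i" unfolding x_def by (rule height_pos[OF star[OF t]])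
    show "x t i * x t (i + 1) + x t (i + 1) * x t (i + 2) + x t (i + 2) * x t i = 4 / 3"
      unfolding x_def by (rule height_quad[OF y[OF t]])
    show "pairing (f t) (x t) = - 2 * pairing (m t) (x t)"
      unfolding f_def x_def m_def by (rule switch_constraint[OF y[OF t]])
  next
    fix t i assume t: "t \<in> {0..tf} - N"
    then have t1: "t \<in> {0..tf} - N1" by (simp add: N_def)
    show "0 \<le> p t i" "(\<Sum>i\<in>UNIV. p t i * x t i) = 1" "(\<Sum>i\<in>UNIV. p t i * f t i) = 0"
      using p_nonneg p_x p_f[OF t1] t by auto
    show "((\<lambda>t. x t i) has_real_derivative control_ad kap (p t) (x t) i) (at t within {0..tf})"
      "((\<lambda>t. m t i) has_real_derivative m_rate kap lc (x t) (m t) i) (at t within {0..tf})"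
      "((\<lambda>t. f t i) has_real_derivative f_rate kap (p t) (x t) (m t) (f t) i) (at t within {0..tf})"
      using derivs[OF t, of i] by auto
  qed (use T kap_pos N lip_x lip_m lip_f f_nonneg f_min nonsing in auto)
  then show ?thesis by blast
qed

section \<open>The bang-bang control\<close>
lemma partition_avoiding_finite_set:
  fixes B :: "real set"
  assumes B: "finite B" and T: "0 < T"
  shows "\<exists>n \<tau>. \<tau> 0 = 0 \<and> \<tau> n = T \<and> (\<forall>i<n. \<tau> i < \<tau> (Suc i) \<and> 0 \<le> \<tau> i \<and> \<tau> (Suc i) \<le> T
    \<and> {\<tau> i<..<\<tau> (Suc i)} \<inter> B = {})"
proof -
  define A where "A = {0, T} \<union> (B \<inter> {0..T})"
  define xs where "xs = sorted_list_of_set A"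
  have A: "finite A" using B by (simp add: A_def)
  have xs: "set xs = A" "sorted_wrt (<) xs" using A by (simp_all add: xs_def)
  have "length xs > 0" using xs(1) by (auto simp: A_def)
  then obtain n where len: "length xs = Suc n" using gr0_implies_Suc by blast
  have less: "xs ! i < xs ! j" if "i < j" "j \<le> n" for i j
    using sorted_wrt_nth_less[OF xs(2), of i j] that len by simp
  have mem: "xs ! i \<in> A" if "i \<le> n" for i using that len xs(1) nth_mem[of i xs] by simp
  have ex: "\<exists>j\<le>n. xs ! j = s" if "s \<in> A" for s
    using that xs(1) len by (metis in_set_conv_nth less_Suc_eq_le)
  have range: "0 \<le> xs ! i" "xs ! i \<le> T" if "i \<le> n" for i using mem[OF that] T by (auto simp: A_def)
  have "xs ! 0 = 0"
  proof -
    obtain j where j: "j \<le> n" "xs ! j = 0" using ex[of 0] by (auto simp: A_def)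
    then show ?thesis using less[of 0 j] range(1)[of 0] by (cases "j = 0") auto
  qed
  moreover have "xs ! n = T"
  proof -
    obtain j where j: "j \<le> n" "xs ! j = T" using ex[of T] by (auto simp: A_def)
    then show ?thesis using less[of j n] range(2)[of n] by (cases "j = n") auto
  qed
  moreover have "{xs ! i<..<xs ! Suc i} \<inter> B = {}" if i: "i < n" for i
  proof (rule ccontr)
    assume "\<not> ?thesis"
    then obtain s where s: "s \<in> B" "xs ! i < s" "s < xs ! Suc i" by auto
    then have "s \<in> A" using range(1)[of i] range(2)[of "Suc i"] i by (auto simp: A_def)
    then obtain j where j: "j \<le> n" "xs ! j = s" using ex by blast
    have "\<not> j \<le> i" using less[of j i] i j s by (cases "j = i") auto
    moreover have "\<not> Suc i \<le> j" using less[of "Suc i" j] j s by (cases "j = Suc i") auto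
    ultimately show False by simp
  qed
  ultimately show ?thesis
    using less range by (intro exI[of _ n] exI[of _ "\<lambda>i. xs ! i"]) auto
qed

text \<open>The zero set of one switching function is closed; without ties it is also the set where the two others are positive, hence open.
An interval is connected.\<close>
lemma (in switching_system) unique_zero_on_interval:
  assumes ab: "0 \<le> a" "a < b" "b \<le> T" and single: "\<And>t. t \<in> {a<..<b} \<Longrightarrow> \<not> tie t"
  shows "\<exists>k. \<forall>t\<in>{a<..<b}. f t k = 0 \<and> (\<forall>j. j \<noteq> k \<longrightarrow> 0 < f t j)"
proof -
  have mid: "(a + b) / 2 \<in> {a<..<b}" using ab by simp
  have sub: "{a<..<b} \<subseteq> {0..T}" using ab by auto
  have cont: "continuous_on {a<..<b} (\<lambda>t. f t j)" for j
    by (rule continuous_on_subset[OF lipschitzian_continuous_on[OF lip(3)] sub])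
  have pos: "0 < f t j" if "t \<in> {a<..<b}" "f t k = 0" "j \<noteq> k" for t j k
    using single[OF that(1)] that f_nonneg[of t j] sub unfolding tie_def by (metis less_eq_real_def subsetD)
  obtain k where k: "f ((a + b) / 2) k = 0" using f_min[of "(a + b) / 2"] mid sub by blast
  define S where "S = {a<..<b} \<inter> (\<lambda>t. f t k) -` {0}"
  have "closedin (top_of_set {a<..<b}) S"
    unfolding S_def by (rule continuous_closedin_preimage[OF cont closed_singleton])
  moreover have "S = ({a<..<b} \<inter> (\<lambda>t. f t (k + 1)) -` {0<..}) \<inter> ({a<..<b} \<inter> (\<lambda>t. f t (k + 2)) -` {0<..})"
  proof -
    have "f t k = 0" if t: "t \<in> {a<..<b}" and "0 < f t (k + 1)" "0 < f t (k + 2)" for t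
    proof -
      obtain l where "f t l = 0" using f_min[of t] t sub by blast
      then show ?thesis using index3_cases[of l k] that by auto
    qed
    moreover have "0 < f t (k + 1) \<and> 0 < f t (k + 2)" if "t \<in> {a<..<b}" "f t k = 0" for t
      using pos[OF that, of "k + 1"] pos[OF that, of "k + 2"] by simp
    ultimately show ?thesis
      unfolding S_def set_eq_iff Int_iff vimage_eq singleton_iff greaterThan_iff by blast
  qed
  then have "openin (top_of_set {a<..<b}) S"
    using openin_Int continuous_openin_preimage_gen[OF cont open_greaterThan] by metis
  moreover have "(a + b) / 2 \<in> S" using k mid by (simp add: S_def)
  moreover have "connected {a<..<b}" by simp
  ultimately have "S = {a<..<b}" unfolding connected_clopen by blast
  then have "f t k = 0" if "t \<in> {a<..<b}" for t using that unfolding S_def by blast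
  then show ?thesis using pos by blast
qed

lemma pontryagin_extremal_AE_cong:
  assumes ext: "pontryagin_extremal tf lc u lam" and v: "measurable_control tf v"
    and eq: "AE t in lebesgue_on {0..tf}. u t = v t"
  shows "pontryagin_extremal tf lc v lam"
proof -
  have "trajectory tf v g z" if "trajectory tf u g z" for g z
    using that eq unfolding trajectory_def by (auto simp: v elim: eventually_elim2)
  then have "admissible tf v g z" if "admissible tf u g z" for g z
    using that unfolding admissible_def by auto
  then have "lifted_trajectory tf lc v lam"
    using ext eq unfolding pontryagin_extremal_def lifted_trajectory_def by (auto elim: eventually_elim2)
  moreover have "AE t in lebesgue_on {0..tf}. hamiltonian lc (lam t) (v t) = hamiltonian_max lc (lam t)
      \<and> hamiltonian_max lc (lam t) = 0"
  proof -
    have "AE t in lebesgue_on {0..tf}. hamiltonian lc (lam t) (u t) = hamiltonian_max lc (lam t)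
        \<and> hamiltonian_max lc (lam t) = 0"
      using ext unfolding pontryagin_extremal_def by blast
    then show ?thesis using eq by eventually_elim simp
  qed
  ultimately show ?thesis using ext unfolding pontryagin_extremal_def by blast
qed

text \<open>The new control is the vertex whose switching function vanishes. At the finitely many ties its value is an arbitrary vertex;
at all other times it agrees almost everywhere with \<open>u\<close>, since the weights of \<open>u\<close> vanish where the switching functions are positive.\<close>
theorem theorem5p4p2:
  fixes tf lcost :: real
    and u :: "real \<Rightarrow> control"
    and lam :: "real \<Rightarrow> cotangent"
  assumes "pontryagin_extremal tf lcost u lam"
    and "\<forall>t\<in>{0..tf}. (lcost, lam t) \<notin> Lambda_sing"
  shows "\<exists>v. bang_bang tf v \<and> finitely_many_switches tf v \<and>
           (AE t in lebesgue_on {0..tf}. u t = v t) \<and>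
           pontryagin_extremal tf lcost v lam"
proof -
  define f where "f = (\<lambda>t. switch (reduced lcost (Lambda_of (lam t))) (z_of (lam t)) (nu_of (lam t)))"
  define p where "p = (\<lambda>t i. weight (u t) i / (\<Sum>k\<in>UNIV. weight (u t) k * height (z_of (lam t)) k))"
  obtain N where "switching_system tf kap lcost (\<lambda>t. height (z_of (lam t)))
      (\<lambda>t. dual (reduced lcost (Lambda_of (lam t)))) f p 2 N"
    using extremal_imp_switching_system[OF assms] unfolding f_def p_def by blast
  then interpret switching_system tf kap lcost "\<lambda>t. height (z_of (lam t))"
    "\<lambda>t. dual (reduced lcost (Lambda_of (lam t)))" f p 2 N .
  define v where "v t = (if 0 < f t 2 \<and> 0 < f t 0 then vertex 1
    else if 0 < f t 1 \<and> 0 < f t 0 then vertex 2 else vertex 0)" for t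
  have v_eq: "v t = vertex k" if "f t k = 0" "\<And>j. j \<noteq> k \<Longrightarrow> 0 < f t j" for t k
    using index3_exhaust[of k] that(1) that(2)[of 0] that(2)[of 1] that(2)[of 2] by (auto simp: v_def)
  have bb: "bang_bang tf v"
  proof -
    have [measurable]: "(\<lambda>t. f t k) \<in> borel_measurable (lebesgue_on {0..tf})" for k
      by (intro continuous_imp_measurable_on_sets_lebesgue lipschitzian_continuous_on lip) simp
    have "v \<in> borel_measurable (lebesgue_on {0..tf})" unfolding v_def by measurable
    then show ?thesis by (auto simp: bang_bang_def U_vertices_def v_def vertex_def)
  qed
  have mc: "measurable_control tf v"
    using bb by (auto simp: bang_bang_def measurable_control_def U_vertices_def U_def)
  have sw: "finitely_many_switches tf v"
  proof -
    obtain n \<tau> where \<tau>: "\<tau> 0 = 0" "\<tau> n = tf"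
      "\<And>i. i < n \<Longrightarrow> \<tau> i < \<tau> (Suc i) \<and> 0 \<le> \<tau> i \<and> \<tau> (Suc i) \<le> tf
        \<and> {\<tau> i<..<\<tau> (Suc i)} \<inter> {t \<in> {0..tf}. tie t} = {}"
      using partition_avoiding_finite_set[OF finite_ties T] by metis
    have "\<exists>e. \<forall>t\<in>{\<tau> i<..<\<tau> (Suc i)}. v t = e" if i: "i < n" for i
    proof -
      have "\<not> tie t" if "t \<in> {\<tau> i<..<\<tau> (Suc i)}" for t using \<tau>(3)[OF i] that by fastforce
      then obtain k where "\<And>t. t \<in> {\<tau> i<..<\<tau> (Suc i)} \<Longrightarrow> f t k = 0 \<and> (\<forall>j. j \<noteq> k \<longrightarrow> 0 < f t j)"
        using unique_zero_on_interval[of "\<tau> i" "\<tau> (Suc i)"] \<tau>(3)[OF i] by blast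
      then show ?thesis using v_eq by blast
    qed
    then show ?thesis unfolding finitely_many_switches_def using \<tau> by blast
  qed
  have eq: "AE t in lebesgue_on {0..tf}. u t = v t"
    unfolding AE_lebesgue_on_Icc_iff
  proof (intro exI conjI ballI)
    show "negligible (N \<union> {t \<in> {0..tf}. tie t})"
      using N negligible_finite[OF finite_ties] by simp
    fix t assume tt: "t \<in> {0..tf} - (N \<union> {t \<in> {0..tf}. tie t})"
    then have t: "t \<in> {0..tf}" and tN: "t \<in> {0..tf} - N" and nm: "\<not> tie t" by auto
    obtain k where k: "f t k = 0" using f_min[OF t] by blast
    have pos: "0 < f t j" if "j \<noteq> k" for j
      using nm k that f_nonneg[OF t, of j] unfolding tie_def by (metis less_eq_real_def)
    have "p t j * f t j = 0" for j
      using p_f[OF tN] p_nonneg[OF tN] f_nonneg[OF t] by (simp add: sum_nonneg_eq_0_iff)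
    then have p0: "p t j = 0" if "j \<noteq> k" for j using pos[OF that] by (metis less_irrefl mult_eq_0_iff)
    have "(\<Sum>i\<in>UNIV. weight (u t) i * height (z_of (lam t)) i) \<noteq> 0"
      using p_x[OF tN] by (auto simp: p_def)
    then have w0: "weight (u t) j = 0" if "j \<noteq> k" for j using p0[OF that] by (simp add: p_def)
    have "u t \<in> U"
      using assms(1) t unfolding pontryagin_extremal_def lifted_trajectory_def admissible_def trajectory_def
        measurable_control_def by blast
    then have "u t = vertex k"
      using w0[of 0] w0[of 1] w0[of 2] index3_exhaust[of k] by (cases "u t") (auto simp: U_def vertex_def)
    then show "u t = v t" using v_eq[OF k pos] by simp
  qed
  show ?thesis using bb sw eq pontryagin_extremal_AE_cong[OF assms(1) mc eq] by blast
qed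

end
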